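(* Let $\phi$ be a right-continuous non-decreasing function and let $\boldsymbol{\zeta}=(\zeta_1,\dots,\zeta_n)\in\mathscr{Z}$. Then: (i) for all càdlàg submartingales $X$, $$\mathbb{E}[\phi(\bar X_T)]\ \le\ \mathrm{UB}(X,\phi,\boldsymbol{\zeta}) := \phi(X_0)+\int_{(X_0,\infty)}\sum_{i=1}^n\mathbb{E}\big[\lambda_i^{\boldsymbol{\zeta},m}(X_{t_i})\big]\,\mathrm{d}\phi(m),$$ where $$\lambda_i^{\boldsymbol{\zeta},m}(x):=\frac{(x-\zeta_i(m))^+}{m-\zeta_i(m)}-\frac{(x-\zeta_{i+1}(m))^+}{m-\zeta_{i+1}(m)}\,\mathbf{1}_{\{i<n\}};$$ (ii) if $\zeta_1$ is non-decreasing and $\zeta_1$ and $\phi$ satisfy the condition that there exists $\alpha>0$ such that $$\liminf_{m\to\infty}\frac{\zeta_1(m)}{\alpha m}\ge 1\qquad\text{and}\qquad \limsup_{m\to\infty}\frac{\phi(m)}{m^{\gamma}}=0\ \text{ for some }\gamma<\frac{1}{1-\alpha},$$ then there exists a continuous martingale $X$ which achieves equality in (i), i.e. $\mathbb{E}[\phi(\bar X_T)]=\mathrm{UB}(X,\phi,\boldsymbol{\zeta})$.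
   Context: Fixed are a filtered probability space supporting a standard real-valued Brownian motion with some initial value $X_0\in\mathbb{R}$, and arbitrary times $0=t_0\le t_1\le\dots\le t_n=:T$. Martingales and submartingales $X=(X_t)$ are understood with respect to their own natural filtration and have initial value $X_0$; $\bar X_t:=\sup_{s\le t}X_s$. $\mathscr{Z}$ is the set of $\boldsymbol{\zeta}=(\zeta_1,\dots,\zeta_n)$, $n\in\mathbb{N}$, such that each $\zeta_i:(X_0,\infty)\to\mathbb{R}$ is right-continuous and $\zeta_1(m)\le\dots\le\zeta_n(m)<m$ for all $m>X_0$.
   Formalization: Part (ii) is stated with the additional assumption t_1 > 0; for t_1 = 0 it fails, e.g. n=1, X_0=0, ζ_1(m)=m/2-1, φ(m)=max(m,0), where E[φ(max)]=0 but UB>0. *)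

theory Defs
  imports "HOL-Probability.Probability"
begin

text \<open>Processes are functions of type \<open>real \<Rightarrow> 'a \<Rightarrow> real\<close>; only their values at times \<open>t \<ge> 0\<close> are used.\<close>

definition filtered_prob_space :: "'a measure \<Rightarrow> (real \<Rightarrow> 'a measure) \<Rightarrow> bool" where
  "filtered_prob_space M F \<longleftrightarrow> prob_space M \<and> (\<forall>t\<ge>0. subalgebra M (F t)) \<and>
     (\<forall>s\<ge>0. \<forall>t\<ge>s. subalgebra (F t) (F s))"

definition brownian_motion ::
    "'a measure \<Rightarrow> (real \<Rightarrow> 'a measure) \<Rightarrow> real \<Rightarrow> (real \<Rightarrow> 'a \<Rightarrow> real) \<Rightarrow> bool" where
  "brownian_motion M F x0 B \<longleftrightarrow>
     (\<forall>t\<ge>0. B t \<in> borel_measurable (F t)) \<and>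
     (\<forall>\<omega>\<in>space M. B 0 \<omega> = x0 \<and> continuous_on {0..} (\<lambda>t. B t \<omega>)) \<and>
     (\<forall>s\<ge>0. \<forall>t>s.
        distributed M lborel (\<lambda>\<omega>. B t \<omega> - B s \<omega>)
          (\<lambda>x. ennreal (normal_density 0 (sqrt (t - s)) x)) \<and>
        prob_space.indep_set M (sets (F s))
          {(\<lambda>\<omega>. B t \<omega> - B s \<omega>) -` A \<inter> space M | A. A \<in> sets borel})"

definition natural_filtration :: "'a measure \<Rightarrow> (real \<Rightarrow> 'a \<Rightarrow> real) \<Rightarrow> real \<Rightarrow> 'a measure" where
  "natural_filtration M X t = sigma (space M)
     (\<Union>s\<in>{0..t}. {X s -` A \<inter> space M | A. A \<in> sets borel})"

text \<open>Adaptedness is automatic below, since the filtration is the natural one of the process.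
  The initial value is the constant \<open>x0\<close>.\<close>

definition submartingale :: "'a measure \<Rightarrow> real \<Rightarrow> (real \<Rightarrow> 'a \<Rightarrow> real) \<Rightarrow> bool" where
  "submartingale M x0 X \<longleftrightarrow>
     (\<forall>\<omega>\<in>space M. X 0 \<omega> = x0) \<and> (\<forall>t\<ge>0. integrable M (X t)) \<and>
     (\<forall>s\<ge>0. \<forall>t\<ge>s. AE \<omega> in M. X s \<omega> \<le> real_cond_exp M (natural_filtration M X s) (X t) \<omega>)"

definition martingale :: "'a measure \<Rightarrow> real \<Rightarrow> (real \<Rightarrow> 'a \<Rightarrow> real) \<Rightarrow> bool" where
  "martingale M x0 X \<longleftrightarrow>
     (\<forall>\<omega>\<in>space M. X 0 \<omega> = x0) \<and> (\<forall>t\<ge>0. integrable M (X t)) \<and>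
     (\<forall>s\<ge>0. \<forall>t\<ge>s. AE \<omega> in M. real_cond_exp M (natural_filtration M X s) (X t) \<omega> = X s \<omega>)"

definition cadlag_paths :: "'a measure \<Rightarrow> (real \<Rightarrow> 'a \<Rightarrow> real) \<Rightarrow> bool" where
  "cadlag_paths M X \<longleftrightarrow> (\<forall>\<omega>\<in>space M.
     (\<forall>t\<ge>0. continuous (at_right t) (\<lambda>s. X s \<omega>)) \<and>
     (\<forall>t>0. \<exists>l. ((\<lambda>s. X s \<omega>) \<longlongrightarrow> l) (at_left t)))"

definition continuous_paths :: "'a measure \<Rightarrow> (real \<Rightarrow> 'a \<Rightarrow> real) \<Rightarrow> bool" where
  "continuous_paths M X \<longleftrightarrow> (\<forall>\<omega>\<in>space M. continuous_on {0..} (\<lambda>t. X t \<omega>))"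

definition running_max :: "(real \<Rightarrow> 'a \<Rightarrow> real) \<Rightarrow> real \<Rightarrow> 'a \<Rightarrow> real" where
  "running_max X t \<omega> = (SUP s\<in>{0..t}. X s \<omega>)"

text \<open>Only \<open>\<zeta> 1, \<dots>, \<zeta> n\<close>, restricted to \<open>(x0, \<infinity>)\<close>, are relevant.\<close>

definition zeta_class :: "nat \<Rightarrow> real \<Rightarrow> (nat \<Rightarrow> real \<Rightarrow> real) set" where
  "zeta_class n x0 = {\<zeta>. n \<ge> 1 \<and>
     (\<forall>i\<in>{1..n}. \<forall>m>x0. continuous (at_right m) (\<zeta> i)) \<and>
     (\<forall>m>x0. (\<forall>i\<in>{1..<n}. \<zeta> i m \<le> \<zeta> (i + 1) m) \<and> \<zeta> n m < m)}"

definition lambda_zeta :: "nat \<Rightarrow> (nat \<Rightarrow> real \<Rightarrow> real) \<Rightarrow> nat \<Rightarrow> real \<Rightarrow> real \<Rightarrow> real" where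
  "lambda_zeta n \<zeta> i m x = max 0 (x - \<zeta> i m) / (m - \<zeta> i m)
     - max 0 (x - \<zeta> (i + 1) m) / (m - \<zeta> (i + 1) m) * of_bool (i < n)"

text \<open>The extended-real integral (integral of the positive part minus integral of the negative
  part), so that an infinite value is not collapsed to 0 as by the Bochner integral.
  It is only meaningful if one of the two parts is finite. This is the case wherever it is used below:
  \<open>\<phi>\<close> of the running maximum is bounded below by \<open>\<phi> x0\<close>, and the integrand of the upper bound
  dominates the probability that the running maximum reaches \<open>m\<close>.\<close>

definition ereal_integral :: "'a measure \<Rightarrow> ('a \<Rightarrow> real) \<Rightarrow> ereal" where
  "ereal_integral M f =
     enn2ereal (\<integral>\<^sup>+ x. ennreal (f x) \<partial>M) - enn2ereal (\<integral>\<^sup>+ x. ennreal (- f x) \<partial>M)"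

text \<open>The integral with respect to \<open>d\<phi>\<close> is the Lebesgue-Stieltjes integral; \<open>interval_measure \<phi>\<close>
  gives mass \<open>\<phi> b - \<phi> a\<close> to \<open>(a, b]\<close> for non-decreasing right-continuous \<open>\<phi>\<close>.\<close>

definition UB :: "'a measure \<Rightarrow> real \<Rightarrow> nat \<Rightarrow> (nat \<Rightarrow> real) \<Rightarrow> (real \<Rightarrow> 'a \<Rightarrow> real)
    \<Rightarrow> (real \<Rightarrow> real) \<Rightarrow> (nat \<Rightarrow> real \<Rightarrow> real) \<Rightarrow> ereal" where
  "UB M x0 n t X \<phi> \<zeta> = ereal (\<phi> x0) +
     ereal_integral (restrict_space (interval_measure \<phi>) {x0<..})
       (\<lambda>m. \<Sum>i=1..n. (\<integral>\<omega>. lambda_zeta n \<zeta> i m (X (t i) \<omega>) \<partial>M))"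

text \<open>The condition relating \<open>\<zeta>\<^sub>1\<close> and \<open>\<phi>\<close>. The bound on \<open>\<gamma>\<close> is stated in the extended reals, so
  that \<open>1 / (1 - \<alpha>)\<close> is \<open>\<infinity>\<close> for \<open>\<alpha> = 1\<close>.\<close>

definition growth_condition :: "(real \<Rightarrow> real) \<Rightarrow> (real \<Rightarrow> real) \<Rightarrow> bool" where
  "growth_condition \<zeta>1 \<phi> \<longleftrightarrow> (\<exists>\<alpha>>0.
     Liminf at_top (\<lambda>m. ereal (\<zeta>1 m / (\<alpha> * m))) \<ge> 1 \<and>
     (\<exists>\<gamma>::real. ereal \<gamma> < 1 / ereal (1 - \<alpha>) \<and>
        Limsup at_top (\<lambda>m. ereal (\<phi> m / m powr \<gamma>)) = 0))"

end

theory Submission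
  imports Defs
begin

text \<open>
  Both parts are statements about one level \<open>m > x0\<close> at a time. Since
  \<open>\<phi> S = \<phi> x0 + \<integral> 1{x0 < m \<le> S} d\<phi>(m)\<close>, Fubini turns the expectation of \<open>\<phi>\<close> of the running maximum
  into the \<open>d\<phi>\<close>-integral of its tail probabilities (\<open>layer_cake\<close>), so it suffices to compare
  \<open>P(max \<ge> m)\<close> with \<open>\<Sum>i. E[\<lambda>\<^sub>i(X (t i))]\<close>.

  Upper bound. Write \<open>c\<^sub>i x = (x - \<zeta> i m)\<^sup>+ / (m - \<zeta> i m)\<close>. The sum of the \<open>\<lambda>\<^sub>i\<close> rearranges to
  \<open>c\<^sub>1 x0 + \<Sum>i. (c\<^sub>i(X (t i)) - c\<^sub>i(X (t (i - 1))))\<close>. As long as the path stays below \<open>m\<close>, the partial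
  sum dominates its last call payoff, because \<open>c\<^sub>i x\<close> decreases in the strike when \<open>x \<le> m\<close>. On the event that \<open>m\<close> is
  first exceeded in the \<open>i\<close>-th period, Doob's maximal inequality gives \<open>c\<^sub>i(X (t i))\<close> an expectation
  of at least the probability of that event. Afterwards the increments have non-negative expectation,
  because \<open>c\<^sub>i\<close> is convex and non-decreasing. This bounds \<open>P(max > l)\<close> for any level \<open>l\<close> above \<open>x0\<close> and the strikes
  (\<open>crossing_bound\<close>); letting \<open>l\<close> increase to \<open>m\<close> while the strikes stay at \<open>\<zeta> i m\<close> gives
  \<open>P(max \<ge> m)\<close> (\<open>running_max_bound\<close>).

  Sharpness. For a process that is constant from \<open>t 1\<close> on, with value \<open>Y\<close>, the sum of the \<open>\<lambda>\<^sub>i\<close> collapses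
  to \<open>c\<^sub>1 Y\<close>, and the barriers other than \<open>\<zeta> 1\<close> disappear. Equality then holds for the
  Azema-Yor embedding: Brownian motion is stopped when it first falls below \<open>\<zeta> 1\<close> of its running maximum, and
  the infinite time axis is compressed to \<open>[0, t 1)\<close> by the clock \<open>t / (t 1 - t)\<close>. By monotonicity of
  \<open>\<zeta> 1\<close>, the stopped value is at least \<open>\<zeta> 1 m\<close> if the maximum exceeds \<open>m\<close>, and at most \<open>\<zeta> 1 m\<close>
  otherwise, where right continuity settles the case that the maximum equals \<open>m\<close>; so \<open>(Y - \<zeta> 1 m)\<^sup>+ = (Y - \<zeta> 1 m) 1{max > m}\<close>, while a martingale that has passed \<open>m\<close> has
  conditional mean \<open>m\<close> from then on.

  To make this rigorous, all integrability is extracted from one identity, \<open>E[m - B\<^sub>\<rho>; max > m] = 0\<close> for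
  the stopping time \<open>\<rho>\<close> cut off at a finite time (\<open>expectation_above_level\<close>). It follows from optional
  stopping alone, by comparing \<open>\<rho>\<close> with \<open>\<rho>\<close> cut further at the first passage over \<open>m\<close>. Where the barrier
  grows linearly, it bounds the expected maximum uniformly in time. Hence the stopping time is almost surely
  finite and the stopped process has an integrable upper bound. On the lower side it gives
  \<open>E[(\<zeta> 1 m - B\<^sub>\<rho>)\<^sup>+] \<le> m - x0\<close>, which tends to \<open>0\<close> as \<open>m\<close> decreases to \<open>x0\<close> and replaces a lower bound, which is
  missing when \<open>\<zeta> 1\<close> tends to \<open>-\<infinity>\<close> at \<open>x0\<close>. Together these make the stopped process converge in
  \<open>L\<^sup>1\<close>, so that the time-changed process is a martingale up to and including time \<open>t 1\<close>.
\<close>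

section \<open>Integration of a monotone function along a random variable\<close>

lemma ereal_integral_nonneg:
  assumes "\<And>x. x \<in> space N \<Longrightarrow> 0 \<le> f x"
  shows "ereal_integral N f = enn2ereal (\<integral>\<^sup>+x. ennreal (f x) \<partial>N)"
proof -
  have "(\<integral>\<^sup>+x. ennreal (- f x) \<partial>N) = (\<integral>\<^sup>+x. 0 \<partial>N)"
    by (intro nn_integral_cong) (use assms in \<open>auto simp: ennreal_eq_0_iff\<close>)
  then show ?thesis
    by (simp add: ereal_integral_def zero_ennreal.rep_eq)
qed

text \<open>A bounded shift can move mass between the positive and the negative part, but only a finite amount,
  so it commutes with the extended integral even if the integral of \<open>h\<close> is infinite.\<close>

lemma ereal_integral_const_add:
  assumes "prob_space M" and [measurable]: "h \<in> borel_measurable M"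
    and nonneg: "\<And>\<omega>. \<omega> \<in> space M \<Longrightarrow> 0 \<le> h \<omega>"
  shows "ereal_integral M (\<lambda>\<omega>. c + h \<omega>) = ereal c + enn2ereal (\<integral>\<^sup>+\<omega>. ennreal (h \<omega>) \<partial>M)"
proof -
  interpret prob_space M by fact
  define P N H where "P = (\<integral>\<^sup>+\<omega>. ennreal (c + h \<omega>) \<partial>M)"
    and "N = (\<integral>\<^sup>+\<omega>. ennreal (- (c + h \<omega>)) \<partial>M)" and "H = (\<integral>\<^sup>+\<omega>. ennreal (h \<omega>) \<partial>M)"
  have "P + ennreal (- c) = (\<integral>\<^sup>+\<omega>. ennreal (c + h \<omega>) + ennreal (- c) \<partial>M)"
    by (subst nn_integral_add) (auto simp: P_def emeasure_space_1)
  also have "\<dots> = (\<integral>\<^sup>+\<omega>. ennreal (h \<omega>) + ennreal c + ennreal (- (c + h \<omega>)) \<partial>M)"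
  proof (intro nn_integral_cong)
    fix \<omega> assume "\<omega> \<in> space M"
    then have h: "0 \<le> h \<omega>" by (rule nonneg)
    consider "0 \<le> c" | "c < 0" "0 \<le> c + h \<omega>" | "c < 0" "c + h \<omega> < 0" by linarith
    then show "ennreal (c + h \<omega>) + ennreal (- c) = ennreal (h \<omega>) + ennreal c + ennreal (- (c + h \<omega>))"
      using h by cases (auto simp: ennreal_neg simp flip: ennreal_plus)
  qed
  also have "\<dots> = H + ennreal c + N"
    by (subst nn_integral_add nn_integral_add, (simp; fail), (simp; fail))+
       (simp add: H_def N_def emeasure_space_1)
  finally have eq: "P + ennreal (- c) = H + ennreal c + N" .
  have "N \<le> (\<integral>\<^sup>+\<omega>. ennreal (- c) \<partial>M)"
    unfolding N_def by (intro nn_integral_mono ennreal_leI) (use nonneg in force)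
  then have "N \<le> ennreal (- c)" by (simp add: emeasure_space_1)
  then obtain r where r: "N = ennreal r" "0 \<le> r"
    by (metis ennreal_cases ennreal_less_top leD)
  have "enn2ereal P - enn2ereal N = ereal c + enn2ereal H"
  proof (cases H)
    case (real x)
    with eq r have fin: "P \<noteq> top"
      by (metis ennreal_add_eq_top ennreal_neq_top)
    then obtain p where p: "P = ennreal p" "0 \<le> p" by (cases P) auto
    have "p + max 0 (- c) = x + max 0 c + r"
      using eq real r p
      by (cases "0 \<le> c") (auto simp: ennreal_neg ennreal_plus[symmetric] simp del: ennreal_plus)
    then show ?thesis
      using p r real by (auto simp: max_def split: if_splits)
  next
    case top
    with eq have "P = top" by (metis ennreal_add_eq_top ennreal_neq_top)
    then show ?thesis using r top by (simp add: top_ennreal.rep_eq)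
  qed
  then show ?thesis
    by (simp add: ereal_integral_def P_def N_def H_def)
qed

text \<open>\<open>\<phi> s - \<phi> x0\<close> is the \<open>d\<phi>\<close>-mass of \<open>(x0, s]\<close>; Tonelli exchanges this mass with the expectation.\<close>

lemma layer_cake:
  assumes "prob_space M" and mono: "mono \<phi>" and rc: "\<And>x. continuous (at_right x) \<phi>"
    and [measurable]: "S \<in> borel_measurable M"
    and ge: "\<And>\<omega>. \<omega> \<in> space M \<Longrightarrow> x0 \<le> S \<omega>"
  shows "ereal_integral M (\<lambda>\<omega>. \<phi> (S \<omega>)) = ereal (\<phi> x0) +
    enn2ereal (\<integral>\<^sup>+m. ennreal (measure M {\<omega> \<in> space M. m \<le> S \<omega>})
      \<partial>restrict_space (interval_measure \<phi>) {x0<..})"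
proof -
  interpret prob_space M by fact
  interpret I: sigma_finite_measure "interval_measure \<phi>"
    by (rule sigma_finite_interval_measure) (use mono rc in \<open>auto simp: mono_def\<close>)
  interpret pair_sigma_finite M "interval_measure \<phi>" ..
  have [measurable]: "\<phi> \<in> borel_measurable borel"
    by (rule borel_measurable_mono[OF mono])
  have "ereal_integral M (\<lambda>\<omega>. \<phi> (S \<omega>)) = ereal_integral M (\<lambda>\<omega>. \<phi> x0 + (\<phi> (S \<omega>) - \<phi> x0))"
    by simp
  also have "\<dots> = ereal (\<phi> x0) + enn2ereal (\<integral>\<^sup>+\<omega>. ennreal (\<phi> (S \<omega>) - \<phi> x0) \<partial>M)"
    by (rule ereal_integral_const_add) (use assms(1) ge mono in \<open>auto simp: mono_def\<close>)
  also have "(\<integral>\<^sup>+\<omega>. ennreal (\<phi> (S \<omega>) - \<phi> x0) \<partial>M) =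
      (\<integral>\<^sup>+\<omega>. \<integral>\<^sup>+m. indicator {x0<..} m * indicator {p. snd p \<le> S (fst p)} (\<omega>, m)
         \<partial>interval_measure \<phi> \<partial>M)"
  proof (intro nn_integral_cong)
    fix \<omega> assume "\<omega> \<in> space M"
    then have "ennreal (\<phi> (S \<omega>) - \<phi> x0) = emeasure (interval_measure \<phi>) {x0<..S \<omega>}"
      by (subst emeasure_interval_measure_Ioc) (use ge mono rc in \<open>auto simp: mono_def\<close>)
    also have "\<dots> = (\<integral>\<^sup>+m. indicator {x0<..S \<omega>} m \<partial>interval_measure \<phi>)"
      by simp
    also have "\<dots> = (\<integral>\<^sup>+m. indicator {x0<..} m * indicator {p. snd p \<le> S (fst p)} (\<omega>, m)
         \<partial>interval_measure \<phi>)"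
      by (intro nn_integral_cong) (auto split: split_indicator)
    finally show "ennreal (\<phi> (S \<omega>) - \<phi> x0) = \<dots>" .
  qed
  also have "\<dots> = (\<integral>\<^sup>+m. \<integral>\<^sup>+\<omega>. indicator {x0<..} m * indicator {p. snd p \<le> S (fst p)} (\<omega>, m)
         \<partial>M \<partial>interval_measure \<phi>)"
  proof (rule Fubini'[symmetric])
    have [measurable]: "(\<lambda>p. S (fst p)) \<in> borel_measurable (M \<Otimes>\<^sub>M (borel :: real measure))"
      "(snd :: 'a \<times> real \<Rightarrow> real) \<in> borel_measurable (M \<Otimes>\<^sub>M borel)"
      by (auto intro: measurable_compose[OF measurable_fst])
    have "{p \<in> space (M \<Otimes>\<^sub>M borel). snd p \<le> S (fst p)} \<in> sets (M \<Otimes>\<^sub>M borel)"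
      by (rule borel_measurable_le) measurable
    then have "(\<lambda>p. indicator {x0<..} (snd p) * (if snd p \<le> S (fst p) then 1 else 0 :: ennreal))
        \<in> borel_measurable (M \<Otimes>\<^sub>M borel)"
      by (intro borel_measurable_times_ennreal measurable_If) measurable
    also have "(\<lambda>p. indicator {x0<..} (snd p) * (if snd p \<le> S (fst p) then 1 else 0 :: ennreal)) =
      (\<lambda>(\<omega>, m). indicator {x0<..} m * indicator {p. snd p \<le> S (fst p)} (\<omega>, m) :: ennreal)"
      by (auto simp: fun_eq_iff split: split_indicator)
    finally show "(\<lambda>(\<omega>, m). indicator {x0<..} m * indicator {p. snd p \<le> S (fst p)} (\<omega>, m) :: ennreal)
        \<in> borel_measurable (M \<Otimes>\<^sub>M interval_measure \<phi>)"
      unfolding measurable_cong_sets[OF sets_pair_measure_cong[OF refl sets_interval_measure] refl] .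
  qed
  also have "\<dots> = (\<integral>\<^sup>+m. ennreal (measure M {\<omega> \<in> space M. m \<le> S \<omega>}) * indicator {x0<..} m
      \<partial>interval_measure \<phi>)"
  proof (intro nn_integral_cong)
    fix m
    have "(\<integral>\<^sup>+\<omega>. indicator {x0<..} m * indicator {p. snd p \<le> S (fst p)} (\<omega>, m) \<partial>M)
       = (\<integral>\<^sup>+\<omega>. indicator {x0<..} m * indicator {\<omega> \<in> space M. m \<le> S \<omega>} \<omega> \<partial>M)"
      by (intro nn_integral_cong) (auto split: split_indicator)
    also have "\<dots> = ennreal (measure M {\<omega> \<in> space M. m \<le> S \<omega>}) * indicator {x0<..} m"
      by (subst nn_integral_cmult) (auto simp: emeasure_eq_measure mult.commute)
    finally show "(\<integral>\<^sup>+\<omega>. indicator {x0<..} m * indicator {p. snd p \<le> S (fst p)} (\<omega>, m) \<partial>M) = \<dots>" .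
  qed
  also have "\<dots> = (\<integral>\<^sup>+m. ennreal (measure M {\<omega> \<in> space M. m \<le> S \<omega>})
      \<partial>restrict_space (interval_measure \<phi>) {x0<..})"
    by (subst nn_integral_restrict_space) auto
  finally show ?thesis .
qed

section \<open>Right-continuous submartingales and their maxima\<close>

lemma (in finite_measure) integrable_const_indicator [intro, simp]:
  "A \<in> sets M \<Longrightarrow> integrable M (\<lambda>\<omega>. c * indicator A \<omega> :: real)"
  by (intro integrable_mult_right integrable_real_indicator) (auto simp: less_top[symmetric])

lemma space_natural_filtration [simp]: "space (natural_filtration M X t) = space M"
  unfolding natural_filtration_def by (rule space_measure_of) auto

lemma measurable_natural_filtration:
  assumes "0 \<le> s" "s \<le> t"
  shows "X s \<in> borel_measurable (natural_filtration M X t)"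
proof (rule measurableI)
  fix A :: "real set" assume "A \<in> sets borel"
  then have "X s -` A \<inter> space M \<in> (\<Union>s\<in>{0..t}. {X s -` A \<inter> space M | A. A \<in> sets borel})"
    using assms by fastforce
  then show "X s -` A \<inter> space (natural_filtration M X t) \<in> sets (natural_filtration M X t)"
    unfolding space_natural_filtration unfolding natural_filtration_def
    by (subst sets_measure_of) auto
qed simp

lemma sets_natural_filtration_mono:
  assumes "s \<le> t"
  shows "sets (natural_filtration M X s) \<subseteq> sets (natural_filtration M X t)"
proof -
  let ?G = "\<lambda>t. \<Union>s\<in>{0..t}. {X s -` A \<inter> space M | A. A \<in> sets borel}"
  have "sets (natural_filtration M X t) = sigma_sets (space M) (?G t)" for t
    unfolding natural_filtration_def by (rule sets_measure_of) auto
  moreover have "?G s \<subseteq> ?G t" by (rule UN_mono) (use assms in auto)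
  ultimately show ?thesis by (simp only: sigma_sets_mono')
qed

lemma subalgebra_natural_filtration:
  assumes "\<And>s. 0 \<le> s \<Longrightarrow> s \<le> t \<Longrightarrow> X s \<in> borel_measurable M"
  shows "subalgebra M (natural_filtration M X t)"
  unfolding subalgebra_def
proof
  show "sets (natural_filtration M X t) \<subseteq> sets M"
    unfolding natural_filtration_def
    by (subst sets_measure_of; (intro sets.sigma_sets_subset)?)
       (use assms in \<open>auto intro: measurable_sets\<close>)
qed simp

text \<open>Right limits bound a path just after each time and left limits just before it; compactness of
  the time interval does the rest.\<close>

lemma cadlag_bdd_above:
  fixes f :: "real \<Rightarrow> real"
  assumes rc: "\<And>t. 0 \<le> t \<Longrightarrow> continuous (at_right t) f"
    and ll: "\<And>t. 0 < t \<Longrightarrow> \<exists>l. (f \<longlongrightarrow> l) (at_left t)"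
  shows "bdd_above (f ` {0..T})"
proof -
  have "\<exists>U c. open U \<and> t \<in> U \<and> (\<forall>s\<in>U. 0 \<le> s \<longrightarrow> f s \<le> c)" if t: "t \<in> {0..T}" for t
  proof -
    have R: "\<forall>\<^sub>F s in at_right t. f s < f t + 1"
      using rc[of t] t by (intro order_tendstoD[where y = "f t"]) (auto simp: continuous_within)
    obtain l where L: "\<forall>\<^sub>F s in at_left t. 0 \<le> s \<longrightarrow> f s < l"
    proof (cases "t = 0")
      case True
      have "\<forall>\<^sub>F s in at_left t. s < t" by (simp add: eventually_at_filter)
      then have "\<forall>\<^sub>F s in at_left t. 0 \<le> s \<longrightarrow> f s < 0" by eventually_elim (use True in auto)
      then show ?thesis by (rule that)
    next
      case False
      then obtain l where "(f \<longlongrightarrow> l) (at_left t)" using ll[of t] t by auto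
      then have "\<forall>\<^sub>F s in at_left t. f s < l + 1" by (intro order_tendstoD) auto
      then have "\<forall>\<^sub>F s in at_left t. 0 \<le> s \<longrightarrow> f s < l + 1" by eventually_elim auto
      then show ?thesis by (rule that)
    qed
    define c where "c = max (f t + 1) l"
    have "\<forall>\<^sub>F s in at t. 0 \<le> s \<longrightarrow> f s \<le> c"
      unfolding eventually_at_split
      using R L by (auto elim!: eventually_mono simp: c_def)
    then have "\<forall>\<^sub>F s in nhds t. 0 \<le> s \<longrightarrow> f s \<le> c"
      unfolding eventually_at_filter by (rule eventually_mono) (auto simp: c_def)
    then show ?thesis unfolding eventually_nhds by blast
  qed
  then obtain U c where U: "\<And>t. t \<in> {0..T} \<Longrightarrow> open (U t) \<and> t \<in> U t"
    and c: "\<And>t s. t \<in> {0..T} \<Longrightarrow> s \<in> U t \<Longrightarrow> 0 \<le> s \<Longrightarrow> f s \<le> c t"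
    by metis
  obtain D where D: "D \<subseteq> {0..T}" "finite D" "{0..T} \<subseteq> (\<Union>t\<in>D. U t)"
    by (rule compactE_image[OF compact_Icc[of 0 T], of "{0..T}" U]) (use U in auto)
  show ?thesis
  proof (rule bdd_aboveI2)
    fix s assume s: "s \<in> {0..T}"
    then obtain t where "t \<in> D" "s \<in> U t" using D by auto
    then have "f s \<le> c t" using c D s by auto
    also have "\<dots> \<le> Max (c ` D)" using \<open>t \<in> D\<close> D by auto
    finally show "f s \<le> Max (c ` D)" .
  qed
qed

text \<open>Exceeding a level is an open condition, so a right-continuous path that does it at some time also
  does it at a rational time just after, except at the right end point, which is added by hand.
  This makes the events below measurable with respect to the uncompleted natural filtration.\<close>

lemma exceeds_iff_rational:
  fixes f :: "real \<Rightarrow> real"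
  assumes "\<And>r. s \<le> r \<Longrightarrow> r < t \<Longrightarrow> continuous (at_right r) f"
  shows "(\<exists>r\<in>{s..t}. m < f r) \<longleftrightarrow> (\<exists>r\<in>{s..t} \<inter> insert t \<rat>. m < f r)"
proof
  assume "\<exists>r\<in>{s..t}. m < f r"
  then obtain r where r: "s \<le> r" "r \<le> t" "m < f r" by auto
  show "\<exists>r\<in>{s..t} \<inter> insert t \<rat>. m < f r"
  proof (cases "r = t")
    case False
    then have "\<forall>\<^sub>F q in at_right r. m < f q"
      using assms[of r] r by (intro order_tendstoD) (auto simp: continuous_within)
    then obtain b where b: "r < b" "\<And>q. r < q \<Longrightarrow> q < b \<Longrightarrow> m < f q"
      unfolding eventually_at_right_field by auto
    have "r < min b t" using b False r by auto
    then obtain q where "q \<in> \<rat>" "r < q" "q < min b t" using Rats_dense_in_real by blast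
    then show ?thesis using b r by (intro bexI[of _ q]) auto
  qed (use r in auto)
qed auto

lemma sets_exceeds:
  fixes X :: "real \<Rightarrow> 'a \<Rightarrow> real"
  assumes "\<And>r. s \<le> r \<Longrightarrow> r \<le> t \<Longrightarrow> X r \<in> borel_measurable N"
    and "\<And>\<omega> r. \<omega> \<in> space N \<Longrightarrow> s \<le> r \<Longrightarrow> r < t \<Longrightarrow> continuous (at_right r) (\<lambda>r. X r \<omega>)"
  shows "{\<omega> \<in> space N. \<exists>r\<in>{s..t}. m < X r \<omega>} \<in> sets N"
proof -
  have "{\<omega> \<in> space N. \<exists>r\<in>{s..t}. m < X r \<omega>} = {\<omega> \<in> space N. \<exists>r\<in>{s..t} \<inter> insert t \<rat>. m < X r \<omega>}"
    by (intro Collect_cong conj_cong refl exceeds_iff_rational assms(2))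
  also have "\<dots> = (\<Union>r\<in>{s..t} \<inter> insert t \<rat>. {\<omega> \<in> space N. m < X r \<omega>})" by auto
  also have "\<dots> \<in> sets N"
  proof (rule sets.countable_UN'')
    show "countable ({s..t} \<inter> insert t \<rat>)"
      by (rule countable_subset[of _ "insert t \<rat>"]) (auto intro: countable_rat)
    fix r assume "r \<in> {s..t} \<inter> insert t \<rat>"
    then have [measurable]: "X r \<in> borel_measurable N" using assms(1) by auto
    show "{\<omega> \<in> space N. m < X r \<omega>} \<in> sets N" by measurable
  qed
  finally show ?thesis .
qed

lemma measurable_running_max:
  assumes "0 \<le> T" and "\<And>\<omega>. \<omega> \<in> space N \<Longrightarrow> bdd_above ((\<lambda>s. X s \<omega>) ` {0..T})"
    and "\<And>r. 0 \<le> r \<Longrightarrow> r \<le> T \<Longrightarrow> X r \<in> borel_measurable N"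
    and "\<And>\<omega> r. \<omega> \<in> space N \<Longrightarrow> 0 \<le> r \<Longrightarrow> r < T \<Longrightarrow> continuous (at_right r) (\<lambda>r. X r \<omega>)"
  shows "running_max X T \<in> borel_measurable N"
  unfolding borel_measurable_iff_greater
proof
  fix c
  have "{\<omega> \<in> space N. c < running_max X T \<omega>} = {\<omega> \<in> space N. \<exists>r\<in>{0..T}. c < X r \<omega>}"
    using less_cSUP_iff[OF _ assms(2), of _ c] assms(1) by (auto simp: running_max_def)
  then show "{\<omega> \<in> space N. c < running_max X T \<omega>} \<in> sets N"
    using sets_exceeds[of 0 T X N c] assms(3,4) by simp
qed

locale right_continuous_submartingale = prob_space M for M :: "'a measure" +
  fixes X :: "real \<Rightarrow> 'a \<Rightarrow> real" and x0 :: real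
  assumes submart: "submartingale M x0 X"
    and right_cont: "\<And>\<omega> t. \<omega> \<in> space M \<Longrightarrow> 0 \<le> t \<Longrightarrow> continuous (at_right t) (\<lambda>s. X s \<omega>)"
begin

lemma X_0: "\<omega> \<in> space M \<Longrightarrow> X 0 \<omega> = x0"
  and integrable_X: "0 \<le> t \<Longrightarrow> integrable M (X t)"
  and cond_exp_ge:
    "0 \<le> s \<Longrightarrow> s \<le> t \<Longrightarrow> AE \<omega> in M. X s \<omega> \<le> real_cond_exp M (natural_filtration M X s) (X t) \<omega>"
  using submart by (auto simp: submartingale_def)

lemma measurable_X [measurable]: "0 \<le> t \<Longrightarrow> X t \<in> borel_measurable M"
  using integrable_X by auto

lemma subalgebra_nf: "subalgebra M (natural_filtration M X t)"
  by (rule subalgebra_natural_filtration) auto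

lemma sets_nf: "A \<in> sets (natural_filtration M X t) \<Longrightarrow> A \<in> sets M"
  using subalgebra_nf by (auto simp: subalgebra_def)

lemma submartingale_on_set:
  assumes "0 \<le> s" "s \<le> t" "A \<in> sets (natural_filtration M X s)"
  shows "(\<integral>\<omega>. X s \<omega> * indicator A \<omega> \<partial>M) \<le> (\<integral>\<omega>. X t \<omega> * indicator A \<omega> \<partial>M)"
proof -
  interpret sf: sigma_finite_subalgebra M "natural_filtration M X s"
    by (intro finite_measure_subalgebra_is_sigma_finite finite_measure_subalgebra.intro
        finite_measure_axioms subalgebra_nf finite_measure_subalgebra_axioms.intro)
  have [measurable]: "A \<in> sets M" by (rule sets_nf) fact
  have int: "integrable M (\<lambda>\<omega>. indicator A \<omega> * X t \<omega>)" "integrable M (\<lambda>\<omega>. indicator A \<omega> * X s \<omega>)"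
    using integrable_mult_indicator[of A M "X t"] integrable_mult_indicator[of A M "X s"]
      integrable_X assms by auto
  have "(\<integral>\<omega>. X s \<omega> * indicator A \<omega> \<partial>M) = (\<integral>\<omega>. indicator A \<omega> * X s \<omega> \<partial>M)"
    by (simp add: mult.commute)
  also have "\<dots> \<le> (\<integral>\<omega>. indicator A \<omega> * real_cond_exp M (natural_filtration M X s) (X t) \<omega> \<partial>M)"
    using cond_exp_ge[OF assms(1,2)]
    by (intro integral_mono_AE int sf.real_cond_exp_intg)
       (use assms in \<open>auto elim!: eventually_mono intro: mult_left_mono borel_measurable_indicator\<close>)
  also have "\<dots> = (\<integral>\<omega>. indicator A \<omega> * X t \<omega> \<partial>M)"
    by (rule sf.real_cond_exp_intg) (use assms int in auto)
  finally show ?thesis by (simp add: mult.commute)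
qed

lemma integrable_X_indicator:
  "0 \<le> t \<Longrightarrow> A \<in> sets M \<Longrightarrow> integrable M (\<lambda>\<omega>. X t \<omega> * indicator A \<omega>)"
  using integrable_mult_indicator[of A M "X t"] integrable_X by (simp add: mult.commute)

lemma integrable_call: "0 \<le> t \<Longrightarrow> integrable M (\<lambda>\<omega>. max 0 (X t \<omega> - z))"
  using integrable_X[of t] by (intro integrable_max) auto

text \<open>Jensen's inequality for the call payoff, obtained by exercising at time \<open>t\<close> exactly when the option
  is in the money at time \<open>s\<close>.\<close>

lemma call_submartingale_on_set:
  assumes "0 \<le> s" "s \<le> t" "A \<in> sets (natural_filtration M X s)"
  shows "(\<integral>\<omega>. max 0 (X s \<omega> - z) * indicator A \<omega> \<partial>M) \<le> (\<integral>\<omega>. max 0 (X t \<omega> - z) * indicator A \<omega> \<partial>M)"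
proof -
  have [measurable]: "X s \<in> borel_measurable (natural_filtration M X s)"
    by (rule measurable_natural_filtration) (use assms in auto)
  define A' where "A' = A \<inter> {\<omega> \<in> space (natural_filtration M X s). z < X s \<omega>}"
  have A': "A' \<in> sets (natural_filtration M X s)"
    unfolding A'_def using assms(3) by measurable
  note [measurable] = sets_nf[OF A'] sets_nf[OF assms(3)]
  have int: "integrable M (\<lambda>\<omega>. X s \<omega> * indicator A' \<omega>)" "integrable M (\<lambda>\<omega>. X t \<omega> * indicator A' \<omega>)"
    "integrable M (\<lambda>\<omega>. max 0 (X t \<omega> - z) * indicator A \<omega>)"
    using integrable_X_indicator[of s A'] integrable_X_indicator[of t A'] assms
      integrable_mult_indicator[OF _ integrable_call[of t z], of A]
    by (auto simp: mult.commute)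
  note int = int integrable_const_indicator[OF sets_nf[OF A'], of z]
  have "(\<integral>\<omega>. max 0 (X s \<omega> - z) * indicator A \<omega> \<partial>M)
      = (\<integral>\<omega>. X s \<omega> * indicator A' \<omega> - z * indicator A' \<omega> \<partial>M)"
    by (intro Bochner_Integration.integral_cong) (auto simp: A'_def split: split_indicator)
  also have "\<dots> \<le> (\<integral>\<omega>. X t \<omega> * indicator A' \<omega> - z * indicator A' \<omega> \<partial>M)"
    using submartingale_on_set[OF assms(1,2) A'] int by simp
  also have "\<dots> \<le> (\<integral>\<omega>. max 0 (X t \<omega> - z) * indicator A \<omega> \<partial>M)"
    using int by (intro integral_mono) (auto simp: A'_def split: split_indicator)
  finally show ?thesis .
qed

text \<open>Doob's maximal inequality, localised to an event known at time \<open>s\<close>: sort the outcomes by the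
  first time in \<open>Q\<close> at which the process exceeds \<open>m\<close> and use the submartingale property from there.\<close>

lemma doob_finite:
  assumes "finite Q" "Q \<subseteq> {s..t}" "0 \<le> s" "s \<le> t" "A \<in> sets (natural_filtration M X s)"
  shows "0 \<le> (\<integral>\<omega>. (X t \<omega> - m) * indicator (A \<inter> {\<omega> \<in> space M. \<exists>r\<in>Q. m < X r \<omega>}) \<omega> \<partial>M)"
  using assms
proof (induction Q arbitrary: s A rule: finite_linorder_min_induct)
  case empty
  then show ?case by simp
next
  case (insert r Q)
  have r: "0 \<le> r" "s \<le> r" "r \<le> t" using insert.prems by auto
  have [measurable]: "X r \<in> borel_measurable (natural_filtration M X r)"
    by (rule measurable_natural_filtration) (use r in auto)
  have A: "A \<in> sets (natural_filtration M X r)"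
    using sets_natural_filtration_mono[OF r(2)] insert.prems by blast
  define A1 A2 where "A1 = A \<inter> {\<omega> \<in> space (natural_filtration M X r). m < X r \<omega>}"
    and "A2 = A \<inter> {\<omega> \<in> space (natural_filtration M X r). \<not> m < X r \<omega>}"
  have A1: "A1 \<in> sets (natural_filtration M X r)" and A2: "A2 \<in> sets (natural_filtration M X r)"
    unfolding A1_def A2_def using A by measurable
  note [measurable] = sets_nf[OF A1] sets_nf[OF A2]
  define D where "D = A2 \<inter> {\<omega> \<in> space M. \<exists>q\<in>Q. m < X q \<omega>}"
  have "{\<omega> \<in> space M. \<exists>q\<in>Q. m < X q \<omega>} = (\<Union>q\<in>Q. {\<omega> \<in> space M. m < X q \<omega>})" by auto
  also have "\<dots> \<in> sets M"
    using insert.hyps(1) insert.prems by (intro sets.finite_UN) auto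
  finally have [measurable]: "D \<in> sets M" unfolding D_def by measurable
  have int: "integrable M (\<lambda>\<omega>. (X t \<omega> - m) * indicator E \<omega>)" if "E \<in> sets M" for E
    using integrable_mult_indicator[OF that, of "\<lambda>\<omega>. X t \<omega> - m"] integrable_X[of t] r
    by (simp add: mult.commute)
  have "0 \<le> (\<integral>\<omega>. (X t \<omega> - m) * indicator A1 \<omega> \<partial>M)"
  proof -
    note i = integrable_const_indicator[OF sets_nf[OF A1], of m]
    have "0 \<le> (\<integral>\<omega>. X r \<omega> * indicator A1 \<omega> - m * indicator A1 \<omega> \<partial>M)"
      by (intro integral_nonneg_AE) (auto simp: A1_def split: split_indicator)
    also have "\<dots> \<le> (\<integral>\<omega>. X t \<omega> * indicator A1 \<omega> - m * indicator A1 \<omega> \<partial>M)"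
      using submartingale_on_set[OF r(1,3) A1] i integrable_X_indicator[of r A1]
        integrable_X_indicator[of t A1] r by simp
    finally show ?thesis by (simp add: left_diff_distrib)
  qed
  moreover have "0 \<le> (\<integral>\<omega>. (X t \<omega> - m) * indicator D \<omega> \<partial>M)"
  proof -
    have "Q \<subseteq> {r..t}" using insert.hyps(2) insert.prems(1) by (auto simp: less_imp_le)
    then show ?thesis unfolding D_def by (rule insert.IH) (use r A2 in auto)
  qed
  moreover have "(\<integral>\<omega>. (X t \<omega> - m) * indicator (A \<inter> {\<omega> \<in> space M. \<exists>q\<in>insert r Q. m < X q \<omega>}) \<omega> \<partial>M)
      = (\<integral>\<omega>. (X t \<omega> - m) * indicator A1 \<omega> + (X t \<omega> - m) * indicator D \<omega> \<partial>M)"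
    by (intro Bochner_Integration.integral_cong)
       (auto simp: A1_def A2_def D_def split: split_indicator)
  ultimately show ?case by (simp add: int)
qed

lemma crossing_measurable:
  assumes "0 \<le> s"
  shows "{\<omega> \<in> space M. \<exists>r\<in>{s..t}. m < X r \<omega>} \<in> sets (natural_filtration M X t)"
  using sets_exceeds[of s t X "natural_filtration M X t" m] right_cont assms
  by (simp add: measurable_natural_filtration)

lemma doob:
  assumes "0 \<le> s" "s \<le> t" "A \<in> sets (natural_filtration M X s)"
  shows "0 \<le> (\<integral>\<omega>. (X t \<omega> - m) * indicator (A \<inter> {\<omega> \<in> space M. \<exists>r\<in>{s..t}. m < X r \<omega>}) \<omega> \<partial>M)"
proof -
  define C where "C = {s..t} \<inter> insert t \<rat>"
  define e where "e = from_nat_into C"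
  have C: "countable C" "C \<noteq> {}"
    using assms unfolding C_def
    by (auto intro!: countable_Int2 countable_rat)
  have e: "range e = C" unfolding e_def using C by (simp add: range_from_nat_into)
  have C_sub: "C \<subseteq> {s..t}" using assms unfolding C_def by auto
  have [measurable]: "X t \<in> borel_measurable M" using assms by auto
  define E where "E k = A \<inter> {\<omega> \<in> space M. \<exists>r\<in>e ` {..k}. m < X r \<omega>}" for k :: nat
  define E' where "E' = A \<inter> {\<omega> \<in> space M. \<exists>r\<in>{s..t}. m < X r \<omega>}"
  have [measurable]: "E k \<in> sets M" for k
  proof -
    have "{\<omega> \<in> space M. \<exists>r\<in>e ` {..k}. m < X r \<omega>} = (\<Union>r\<in>e ` {..k}. {\<omega> \<in> space M. m < X r \<omega>})" by auto
    also have "\<dots> \<in> sets M"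
    proof (rule sets.finite_UN)
      fix r assume "r \<in> e ` {..k}"
      then have "r \<in> C" using e by auto
      then have "0 \<le> r" using C_sub assms by auto
      then have [measurable]: "X r \<in> borel_measurable M" by (rule measurable_X)
      show "{\<omega> \<in> space M. m < X r \<omega>} \<in> sets M" by measurable
    qed simp
    finally show ?thesis unfolding E_def using sets_nf[OF assms(3)] by auto
  qed
  have [measurable]: "E' \<in> sets M"
    unfolding E'_def using sets_nf[OF assms(3)] sets_nf[OF crossing_measurable[OF assms(1)]] by auto
  have lim: "(\<lambda>k. \<integral>\<omega>. (X t \<omega> - m) * indicator (E k) \<omega> \<partial>M) \<longlonglongrightarrow> (\<integral>\<omega>. (X t \<omega> - m) * indicator E' \<omega> \<partial>M)"
  proof (rule integral_dominated_convergence[where w = "\<lambda>\<omega>. \<bar>X t \<omega> - m\<bar>"])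
    show "AE \<omega> in M. (\<lambda>k. (X t \<omega> - m) * indicator (E k) \<omega>) \<longlonglongrightarrow> (X t \<omega> - m) * indicator E' \<omega>"
    proof (rule AE_I2)
      fix \<omega> assume \<omega>: "\<omega> \<in> space M"
      have "\<forall>\<^sub>F k in sequentially. indicator (E k) \<omega> = (indicator E' \<omega> :: real)"
      proof (cases "\<omega> \<in> E'")
        case True
        then have "\<omega> \<in> A" "\<exists>r\<in>C. m < X r \<omega>"
          using exceeds_iff_rational[of s t "\<lambda>r. X r \<omega>" m] right_cont[OF \<omega>] assms(1)
          unfolding E'_def C_def by auto
        then obtain k where "m < X (e k) \<omega>" unfolding e[symmetric] by auto
        then have "\<omega> \<in> E j" if "j \<ge> k" for j
          using that \<omega> \<open>\<omega> \<in> A\<close> unfolding E_def by auto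
        then show ?thesis
          using True by (intro eventually_sequentiallyI[of k]) auto
      next
        case False
        then have "\<omega> \<notin> E j" for j
          unfolding E_def E'_def using e C_sub by blast
        then show ?thesis using False by simp
      qed
      then show "(\<lambda>k. (X t \<omega> - m) * indicator (E k) \<omega>) \<longlonglongrightarrow> (X t \<omega> - m) * indicator E' \<omega>"
        by (intro tendsto_eventually) (auto elim!: eventually_mono)
    qed
    show "integrable M (\<lambda>\<omega>. \<bar>X t \<omega> - m\<bar>)" using integrable_X[of t] assms by auto
  qed (auto simp: indicator_def)
  have "0 \<le> (\<integral>\<omega>. (X t \<omega> - m) * indicator (E k) \<omega> \<partial>M)" for k
    unfolding E_def by (rule doob_finite) (use assms e C_sub in auto)
  then show ?thesis
    by (intro LIMSEQ_le_const[OF lim[unfolded E'_def]]) auto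
qed

end

section \<open>The upper bound at a single level\<close>

lemma grid_mono:
  fixes t :: "nat \<Rightarrow> real"
  assumes "\<And>i. i < n \<Longrightarrow> t i \<le> t (i + 1)" "i \<le> j" "j \<le> n"
  shows "t i \<le> t j"
  using assms(2,3)
proof (induction j)
  case (Suc j)
  then show ?case using assms(1)[of j] by (cases "i = Suc j") auto
qed simp

lemma grid_nonneg:
  fixes t :: "nat \<Rightarrow> real"
  assumes "t 0 = 0" "\<And>i. i < n \<Longrightarrow> t i \<le> t (i + 1)" "i \<le> n"
  shows "0 \<le> t i"
  using grid_mono[of n t 0 i] assms by auto

lemma call_ratio_antimono:
  fixes x m :: real
  assumes "z \<le> z'" "z' < m" "x \<le> m"
  shows "max 0 (x - z') / (m - z') \<le> max 0 (x - z) / (m - z)"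
proof (cases "x \<le> z'")
  case False
  have "(x - z') * (m - z) \<le> (x - z) * (m - z')"
    using mult_nonneg_nonneg[of "z' - z" "m - x"] assms by (simp add: algebra_simps)
  then have "(x - z') / (m - z') \<le> (x - z) / (m - z)"
    using assms by (simp add: field_simps)
  then show ?thesis using False assms by (simp add: max_def)
qed (use assms in auto)

context right_continuous_submartingale
begin

text \<open>The bound for constant strikes \<open>z\<close>. The process \<open>R\<close> is the telescoping form of the sum of the
  \<open>\<lambda>\<^sub>i\<close>; with \<open>D k\<close> the event that \<open>m\<close> is exceeded by time \<open>t k\<close>, the estimate
  \<open>P(D k) \<le> E[R k; D k]\<close> is propagated from one date to the next. Strikes are indexed from \<open>0\<close>, and
  form an infinite sequence, to avoid a special case at the last date.\<close>

lemma crossing_bound: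
  fixes t z :: "nat \<Rightarrow> real"
  assumes t0: "t 0 = 0" and t_mono: "\<And>i. i < n \<Longrightarrow> t i \<le> t (i + 1)"
    and z_mono: "\<And>i. z i \<le> z (i + 1)" and z_less: "\<And>i. z i < m" and x0_less: "x0 < m"
  defines "R \<equiv> \<lambda>k \<omega>. max 0 (x0 - z 0) / (m - z 0) +
      (\<Sum>i<k. max 0 (X (t (i + 1)) \<omega> - z i) / (m - z i) - max 0 (X (t i) \<omega> - z i) / (m - z i))"
  shows "measure M {\<omega> \<in> space M. \<exists>r\<in>{0..t n}. m < X r \<omega>} \<le> (\<integral>\<omega>. R n \<omega> \<partial>M)"
proof -
  define D where "D k = {\<omega> \<in> space M. \<exists>r\<in>{0..t k}. m < X r \<omega>}" for k
  have t_nonneg: "0 \<le> t i" if "i \<le> n" for i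
    by (rule grid_nonneg) (use t0 t_mono that in auto)
  have int_c: "integrable M (\<lambda>\<omega>. max 0 (X (t i) \<omega> - z j) / (m - z j))" if "i \<le> n" for i j
    using integrable_call[OF t_nonneg[OF that], of "z j"] by auto
  have int_R: "integrable M (R k)" if "k \<le> n" for k
    unfolding R_def
    by (intro Bochner_Integration.integrable_add Bochner_Integration.integrable_sum
        Bochner_Integration.integrable_diff int_c) (use that in auto)
  have D_meas: "D k \<in> sets M" if "k \<le> n" for k
    unfolding D_def by (rule sets_nf[OF crossing_measurable]) simp
  \<comment> \<open>As long as the level has not been crossed the telescoping sum dominates its last term, since the
    normalised call payoffs decrease in the strike below \<open>m\<close>.\<close>
  have R_ge: "max 0 (X (t k) \<omega> - z k) / (m - z k) \<le> R k \<omega>"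
    if "k \<le> n" "\<omega> \<in> space M" "\<omega> \<notin> D k" for k \<omega>
    using that
  proof (induction k)
    case 0
    then show ?case using X_0 t0 by (simp add: R_def)
  next
    case (Suc k)
    have "t k \<le> t (Suc k)" using t_mono[of k] Suc by simp
    then have "\<omega> \<notin> D k" using Suc.prems unfolding D_def by force
    then have "max 0 (X (t k) \<omega> - z k) / (m - z k) \<le> R k \<omega>" using Suc by auto
    then have "max 0 (X (t (Suc k)) \<omega> - z k) / (m - z k) \<le> R (Suc k) \<omega>"
      by (simp add: R_def)
    moreover have "X (t (Suc k)) \<omega> \<le> m"
      using Suc.prems t_nonneg[of "Suc k"] unfolding D_def by force
    ultimately show ?case
      using call_ratio_antimono[of "z k" "z (Suc k)" m "X (t (Suc k)) \<omega>"] z_mono[of k] z_less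
      by (auto intro: order_trans)
  qed
  have "measure M (D k) \<le> (\<integral>\<omega>. R k \<omega> * indicator (D k) \<omega> \<partial>M)" if "k \<le> n" for k
    using that
  proof (induction k)
    case 0
    have "D 0 = {}" using X_0 t0 x0_less by (auto simp: D_def)
    then show ?case by simp
  next
    case (Suc k)
    then have k: "k < n" by simp
    note tk = t_nonneg[of k] t_mono[of k]
    let ?c = "\<lambda>j \<omega>. max 0 (X (t j) \<omega> - z k) / (m - z k)"
    define E where "E = (space M - D k) \<inter> {\<omega> \<in> space M. \<exists>r\<in>{t k..t (Suc k)}. m < X r \<omega>}"
    have Dk: "D k \<in> sets (natural_filtration M X (t k))"
      unfolding D_def by (rule crossing_measurable) simp
    have cDk: "space M - D k \<in> sets (natural_filtration M X (t k))"
      using sets.compl_sets[OF Dk] by simp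
    have D_eq: "D (Suc k) = D k \<union> E"
      unfolding D_def E_def using tk k by force
    have disj: "D k \<inter> E = {}" unfolding E_def by auto
    note [measurable] = D_meas[of k] D_meas[of "Suc k"]
    have E_eq: "E = D (Suc k) - D k" using D_eq disj by auto
    have [measurable]: "E \<in> sets M" unfolding E_eq using k by auto
    have int: "integrable M (\<lambda>\<omega>. f \<omega> * indicator A \<omega>)"
      if "integrable M f" "A \<in> sets M" for f :: "'a \<Rightarrow> real" and A
      using integrable_mult_indicator[OF that(2,1)] by (simp add: mult.commute)
    have [simp]: "integrable M (R k)" "integrable M (R (Suc k))" "integrable M (?c k)"
      "integrable M (?c (Suc k))" "D k \<in> sets M"
      using k by (auto intro!: int_R int_c D_meas simp del: max_0_1)
    have step: "R (Suc k) \<omega> = R k \<omega> + ?c (Suc k) \<omega> - ?c k \<omega>" for \<omega>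
      by (simp add: R_def)
    have "measure M (D (Suc k)) = measure M (D k) + measure M E"
      unfolding D_eq by (rule finite_measure_Union) (use disj in auto)
    moreover have "measure M (D k) \<le> (\<integral>\<omega>. R (Suc k) \<omega> * indicator (D k) \<omega> \<partial>M)"
    proof -
      have "(\<integral>\<omega>. ?c k \<omega> * indicator (D k) \<omega> \<partial>M)
          = (\<integral>\<omega>. max 0 (X (t k) \<omega> - z k) * indicator (D k) \<omega> \<partial>M) / (m - z k)" by simp
      also have "\<dots> \<le> (\<integral>\<omega>. max 0 (X (t (Suc k)) \<omega> - z k) * indicator (D k) \<omega> \<partial>M) / (m - z k)"
        by (intro divide_right_mono call_submartingale_on_set Dk)
           (use tk k z_less[of k] in auto)
      also have "\<dots> = (\<integral>\<omega>. ?c (Suc k) \<omega> * indicator (D k) \<omega> \<partial>M)" by simp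
      finally have "(\<integral>\<omega>. ?c k \<omega> * indicator (D k) \<omega> \<partial>M) \<le> (\<integral>\<omega>. ?c (Suc k) \<omega> * indicator (D k) \<omega> \<partial>M)" .
      moreover have "(\<integral>\<omega>. R (Suc k) \<omega> * indicator (D k) \<omega> \<partial>M) = (\<integral>\<omega>. R k \<omega> * indicator (D k) \<omega>
          + ?c (Suc k) \<omega> * indicator (D k) \<omega> - ?c k \<omega> * indicator (D k) \<omega> \<partial>M)"
        by (simp add: step algebra_simps)
      moreover have "\<dots> = (\<integral>\<omega>. R k \<omega> * indicator (D k) \<omega> \<partial>M)
          + (\<integral>\<omega>. ?c (Suc k) \<omega> * indicator (D k) \<omega> \<partial>M) - (\<integral>\<omega>. ?c k \<omega> * indicator (D k) \<omega> \<partial>M)"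
        by (intro trans[OF Bochner_Integration.integral_diff] trans[OF Bochner_Integration.integral_add]
            arg_cong2[where f = minus] refl int Bochner_Integration.integrable_add) auto
      ultimately show ?thesis using Suc by linarith
    qed
    moreover have "measure M E \<le> (\<integral>\<omega>. R (Suc k) \<omega> * indicator E \<omega> \<partial>M)"
    proof -
      have "0 \<le> (\<integral>\<omega>. (X (t (Suc k)) \<omega> - m) * indicator E \<omega> \<partial>M)"
        unfolding E_def by (rule doob) (use tk k cDk in auto)
      then have "0 \<le> (\<integral>\<omega>. (X (t (Suc k)) \<omega> - m) / (m - z k) * indicator E \<omega> \<partial>M)"
        using z_less[of k] by simp
      moreover have "(\<integral>\<omega>. indicator E \<omega> + (X (t (Suc k)) \<omega> - m) / (m - z k) * indicator E \<omega> \<partial>M)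
        \<le> (\<integral>\<omega>. R (Suc k) \<omega> * indicator E \<omega> \<partial>M)"
      proof (intro integral_mono)
        fix \<omega> assume \<omega>: "\<omega> \<in> space M"
        show "indicator E \<omega> + (X (t (Suc k)) \<omega> - m) / (m - z k) * indicator E \<omega> \<le> R (Suc k) \<omega> * indicator E \<omega>"
        proof (cases "\<omega> \<in> E")
          case True
          then have "?c k \<omega> \<le> R k \<omega>" using R_ge[of k \<omega>] k \<omega> unfolding E_def by auto
          then have "?c (Suc k) \<omega> \<le> R (Suc k) \<omega>" using step[of \<omega>] by linarith
          moreover have "1 + (X (t (Suc k)) \<omega> - m) / (m - z k) = (X (t (Suc k)) \<omega> - z k) / (m - z k)"
            using z_less[of k] by (simp add: field_simps)
          moreover have "\<dots> \<le> ?c (Suc k) \<omega>"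
            using z_less[of k] by (intro divide_right_mono) auto
          ultimately show ?thesis using True by simp
        qed simp
      next
        have "integrable M (X (t (Suc k)))" using integrable_X[of "t (Suc k)"] tk k by simp
        then show "integrable M (\<lambda>\<omega>. indicator E \<omega> + (X (t (Suc k)) \<omega> - m) / (m - z k) * indicator E \<omega>)"
          using integrable_const_indicator[of E 1]
          by (intro Bochner_Integration.integrable_add int) auto
      qed (intro int; simp)
      moreover have "(\<integral>\<omega>. indicator E \<omega> + (X (t (Suc k)) \<omega> - m) / (m - z k) * indicator E \<omega> \<partial>M)
        = measure M E + (\<integral>\<omega>. (X (t (Suc k)) \<omega> - m) / (m - z k) * indicator E \<omega> \<partial>M)"
      proof (subst Bochner_Integration.integral_add)
        have "integrable M (X (t (Suc k)))" using integrable_X[of "t (Suc k)"] tk k by simp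
        then show "integrable M (\<lambda>\<omega>. (X (t (Suc k)) \<omega> - m) / (m - z k) * indicator E \<omega>)"
          by (intro int) auto
      qed (use integrable_const_indicator[of E 1] in auto)
      ultimately show ?thesis by linarith
    qed
    moreover have "(\<integral>\<omega>. R (Suc k) \<omega> * indicator (D (Suc k)) \<omega> \<partial>M)
      = (\<integral>\<omega>. R (Suc k) \<omega> * indicator (D k) \<omega> + R (Suc k) \<omega> * indicator E \<omega> \<partial>M)"
      unfolding D_eq using disj
      by (intro Bochner_Integration.integral_cong) (auto split: split_indicator)
    moreover have "\<dots> = (\<integral>\<omega>. R (Suc k) \<omega> * indicator (D k) \<omega> \<partial>M) + (\<integral>\<omega>. R (Suc k) \<omega> * indicator E \<omega> \<partial>M)"
      by (intro Bochner_Integration.integral_add int) auto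
    ultimately show ?case by linarith
  qed
  from this[of n] have "measure M (D n) \<le> (\<integral>\<omega>. R n \<omega> * indicator (D n) \<omega> \<partial>M)" by simp
  also have "\<dots> \<le> (\<integral>\<omega>. R n \<omega> \<partial>M)"
  proof (rule integral_mono)
    show "integrable M (\<lambda>\<omega>. R n \<omega> * indicator (D n) \<omega>)"
      using integrable_mult_indicator[OF D_meas[OF order_refl] int_R[OF order_refl]]
      by (simp add: mult.commute)
    show "R n \<omega> * indicator (D n) \<omega> \<le> R n \<omega>" if "\<omega> \<in> space M" for \<omega>
    proof (cases "\<omega> \<in> D n")
      case False
      have "0 \<le> max 0 (X (t n) \<omega> - z n) / (m - z n)" using z_less[of n] by simp
      also have "\<dots> \<le> R n \<omega>" using R_ge[of n \<omega>] False that by simp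
      finally show ?thesis using False by simp
    qed simp
  qed (rule int_R[OF order_refl])
  finally show ?thesis unfolding D_def .
qed

end

text \<open>Collecting the two payoffs with the same strike, instead of the two with the same date, turns the
  sum of the \<open>\<lambda>\<^sub>i\<close> into increments of call payoffs.\<close>

lemma sum_lambda_zeta:
  assumes "1 \<le> n"
  shows "(\<Sum>i=1..n. lambda_zeta n \<zeta> i m (x i)) =
    max 0 (x 0 - \<zeta> 1 m) / (m - \<zeta> 1 m) +
    (\<Sum>i<n. max 0 (x (i + 1) - \<zeta> (i + 1) m) / (m - \<zeta> (i + 1) m)
           - max 0 (x i - \<zeta> (i + 1) m) / (m - \<zeta> (i + 1) m))"
proof -
  obtain k where n: "n = Suc k" using assms by (cases n) auto
  have "(\<Sum>i<Suc k. max 0 (x i - \<zeta> (Suc i) m) / (m - \<zeta> (Suc i) m)) =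
      max 0 (x 0 - \<zeta> (Suc 0) m) / (m - \<zeta> (Suc 0) m) +
      (\<Sum>i<k. max 0 (x (Suc i) - \<zeta> (Suc (Suc i)) m) / (m - \<zeta> (Suc (Suc i)) m))"
    by (rule sum.lessThan_Suc_shift)
  then show ?thesis
    unfolding n lambda_zeta_def sum_subtractf One_nat_def sum.atLeast1_atMost_eq by simp
qed

context right_continuous_submartingale
begin

text \<open>The event \<open>m \<le> max\<close> is contained in \<open>l < max\<close> for every \<open>l < m\<close>. The strikes are frozen at
  \<open>\<zeta> i m\<close> when \<open>l\<close> tends to \<open>m\<close>, so that the bound is continuous in \<open>l\<close> although \<open>\<zeta>\<close> may jump.\<close>

lemma running_max_bound:
  fixes t :: "nat \<Rightarrow> real"
  assumes bdd: "\<And>\<omega>. \<omega> \<in> space M \<Longrightarrow> bdd_above ((\<lambda>s. X s \<omega>) ` {0..t n})"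
    and t0: "t 0 = 0" and t_mono: "\<And>i. i < n \<Longrightarrow> t i \<le> t (i + 1)"
    and \<zeta>: "\<zeta> \<in> zeta_class n x0" and m: "x0 < m"
  shows "measure M {\<omega> \<in> space M. m \<le> running_max X (t n) \<omega>}
    \<le> (\<Sum>i=1..n. \<integral>\<omega>. lambda_zeta n \<zeta> i m (X (t i) \<omega>) \<partial>M)"
proof -
  have n: "1 \<le> n" and \<zeta>_mono: "\<And>i. i \<in> {1..<n} \<Longrightarrow> \<zeta> i m \<le> \<zeta> (i + 1) m" and \<zeta>_less: "\<zeta> n m < m"
    using \<zeta> m by (auto simp: zeta_class_def)
  have t_nonneg: "0 \<le> t i" if "i \<le> n" for i
    by (rule grid_nonneg) (use t0 t_mono that in auto)
  \<comment> \<open>The barriers continued constantly past \<open>n\<close>, so that they form an infinite non-decreasing sequence.\<close>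
  define z where "z i = \<zeta> (min (i + 1) n) m" for i
  have z_mono: "z i \<le> z (i + 1)" for i
    using \<zeta>_mono[of "i + 1"] by (cases "i + 1 < n") (auto simp: z_def min_absorb1 min_absorb2)
  have z_le: "z i \<le> \<zeta> n m" for i
  proof -
    have "z i \<le> z (i + n)" by (rule lift_Suc_mono_le) (use z_mono in auto)
    then show ?thesis by (simp add: z_def)
  qed
  define a where "a i j = (\<integral>\<omega>. max 0 (X (t i) \<omega> - z j) \<partial>M)" for i j
  define g where "g l = max 0 (x0 - z 0) / (l - z 0) +
      (\<Sum>i<n. a (i + 1) i / (l - z i) - a i i / (l - z i))" for l
  have int: "integrable M (\<lambda>\<omega>. max 0 (X (t i) \<omega> - z j) / c)" if "i \<le> n" for i j c
    using integrable_call[OF t_nonneg[OF that], of "z j"] by auto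
  have g: "(\<integral>\<omega>. max 0 (x0 - z 0) / (l - z 0) + (\<Sum>i<n. max 0 (X (t (i + 1)) \<omega> - z i) / (l - z i)
      - max 0 (X (t i) \<omega> - z i) / (l - z i)) \<partial>M) = g l" for l
  proof -
    have "(\<integral>\<omega>. max 0 (X (t (i + 1)) \<omega> - z i) / (l - z i) - max 0 (X (t i) \<omega> - z i) / (l - z i) \<partial>M)
        = a (i + 1) i / (l - z i) - a i i / (l - z i)" if "i < n" for i
      unfolding a_def
      by (subst Bochner_Integration.integral_diff; (rule int)?) (use that in auto)
    then show ?thesis
      unfolding g_def
      by (subst Bochner_Integration.integral_add Bochner_Integration.integral_sum;
          (intro Bochner_Integration.integrable_sum Bochner_Integration.integrable_diff int)?;
          (simp add: prob_space)?)+
  qed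
  have "(\<Sum>i=1..n. \<integral>\<omega>. lambda_zeta n \<zeta> i m (X (t i) \<omega>) \<partial>M)
      = (\<integral>\<omega>. (\<Sum>i=1..n. lambda_zeta n \<zeta> i m (X (t i) \<omega>)) \<partial>M)"
    unfolding lambda_zeta_def
    by (subst Bochner_Integration.integral_sum)
       (use integrable_call[OF t_nonneg] in \<open>auto intro!: Bochner_Integration.integrable_diff\<close>)
  also have "\<dots> = (\<integral>\<omega>. max 0 (x0 - z 0) / (m - z 0) + (\<Sum>i<n. max 0 (X (t (i + 1)) \<omega> - z i) / (m - z i)
      - max 0 (X (t i) \<omega> - z i) / (m - z i)) \<partial>M)"
    by (intro Bochner_Integration.integral_cong refl, subst sum_lambda_zeta[OF n])
       (use n X_0 t0 in \<open>auto simp: z_def min_def Suc_le_eq intro!: sum.cong\<close>)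
  also have "\<dots> = g m" by (rule g)
  finally have sum_eq: "(\<Sum>i=1..n. \<integral>\<omega>. lambda_zeta n \<zeta> i m (X (t i) \<omega>) \<partial>M) = g m" .
  have "measure M {\<omega> \<in> space M. m \<le> running_max X (t n) \<omega>} \<le> g l"
    if l: "x0 < l" "\<zeta> n m < l" "l < m" for l
  proof -
    have "{\<omega> \<in> space M. m \<le> running_max X (t n) \<omega>} \<subseteq> {\<omega> \<in> space M. \<exists>r\<in>{0..t n}. l < X r \<omega>}"
      using l t_nonneg[of n] less_cSUP_iff[OF _ bdd, of _ l]
      by (auto simp: running_max_def dest!: less_le_trans[OF l(3)])
    then have "measure M {\<omega> \<in> space M. m \<le> running_max X (t n) \<omega>}
        \<le> measure M {\<omega> \<in> space M. \<exists>r\<in>{0..t n}. l < X r \<omega>}"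
      by (rule finite_measure_mono) (rule sets_nf[OF crossing_measurable], simp)
    also have "\<dots> \<le> (\<integral>\<omega>. max 0 (x0 - z 0) / (l - z 0) + (\<Sum>i<n. max 0 (X (t (i + 1)) \<omega> - z i) / (l - z i)
      - max 0 (X (t i) \<omega> - z i) / (l - z i)) \<partial>M)"
      by (rule crossing_bound) (use t0 t_mono z_mono le_less_trans[OF z_le l(2)] l in auto)
    finally show ?thesis unfolding g .
  qed
  moreover have "(g \<longlongrightarrow> g m) (at_left m)"
    unfolding g_def using z_le \<zeta>_less
    by (intro tendsto_intros) (auto simp: less_le_trans not_less dest: le_less_trans)
  moreover have "\<forall>\<^sub>F l in at_left m. x0 < l \<and> \<zeta> n m < l \<and> l < m"
    using m \<zeta>_less eventually_at_left_real[of "max x0 (\<zeta> n m)" m]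
    by (auto elim!: eventually_mono)
  ultimately have "measure M {\<omega> \<in> space M. m \<le> running_max X (t n) \<omega>} \<le> g m"
    by (intro tendsto_lowerbound[where f = g and F = "at_left m"])
       (auto elim!: eventually_mono)
  then show ?thesis unfolding sum_eq .
qed

end

section \<open>Optional stopping of Brownian motion\<close>

text \<open>Fatou's lemma in the form in which it is used below: it yields integrability of the limit as well.\<close>

lemma (in finite_measure) integral_le_of_tendsto:
  fixes f :: "nat \<Rightarrow> 'a \<Rightarrow> real"
  assumes int: "\<And>k. integrable M (f k)" and nonneg: "\<And>k \<omega>. \<omega> \<in> space M \<Longrightarrow> 0 \<le> f k \<omega>"
    and le: "\<And>k. (\<integral>\<omega>. f k \<omega> \<partial>M) \<le> C" and [measurable]: "g \<in> borel_measurable M"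
    and lim: "AE \<omega> in M. (\<lambda>k. f k \<omega>) \<longlonglongrightarrow> g \<omega>"
  shows "integrable M g" "(\<integral>\<omega>. g \<omega> \<partial>M) \<le> C"
proof -
  have "0 \<le> (\<integral>\<omega>. f 0 \<omega> \<partial>M)" using nonneg by simp
  with le[of 0] have C: "0 \<le> C" by linarith
  have g: "AE \<omega> in M. 0 \<le> g \<omega>"
    using lim AE_space by eventually_elim (rule LIMSEQ_le_const, use nonneg in auto)
  have "(\<integral>\<^sup>+\<omega>. ennreal (g \<omega>) \<partial>M) = (\<integral>\<^sup>+\<omega>. liminf (\<lambda>k. ennreal (f k \<omega>)) \<partial>M)"
    by (intro nn_integral_cong_AE)
       (use lim in eventually_elim, auto intro!: lim_imp_Liminf[symmetric] tendsto_ennrealI)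
  also have "\<dots> \<le> liminf (\<lambda>k. \<integral>\<^sup>+\<omega>. ennreal (f k \<omega>) \<partial>M)"
    by (rule nn_integral_liminf) (use int in auto)
  also have "\<dots> \<le> ennreal C"
    using le nonneg
    by (intro Liminf_le) (auto simp: nn_integral_eq_integral[OF int] intro!: always_eventually ennreal_leI)
  finally have nn: "(\<integral>\<^sup>+\<omega>. ennreal (g \<omega>) \<partial>M) \<le> ennreal C" .
  then show i: "integrable M g"
    by (intro integrableI_nonneg g) (auto intro: le_less_trans)
  show "(\<integral>\<omega>. g \<omega> \<partial>M) \<le> C"
    using nn C unfolding nn_integral_eq_integral[OF i g] by (simp add: ennreal_le_iff)
qed

text \<open>Boundedness in \<open>L\<^sup>2\<close> makes the tails uniformly small: truncating at \<open>K\<close> changes every expectation by at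
  most \<open>C / K\<close>, and truncated functions converge by dominated convergence.\<close>

lemma (in prob_space) tendsto_expectation_L2_bounded:
  fixes f :: "nat \<Rightarrow> 'a \<Rightarrow> real"
  assumes [measurable]: "\<And>k. f k \<in> borel_measurable M"
    and sq_int: "\<And>k. integrable M (\<lambda>\<omega>. (f k \<omega>)\<^sup>2)" and sq_le: "\<And>k. (\<integral>\<omega>. (f k \<omega>)\<^sup>2 \<partial>M) \<le> C"
    and lim: "\<And>\<omega>. \<omega> \<in> space M \<Longrightarrow> (\<lambda>k. f k \<omega>) \<longlonglongrightarrow> g \<omega>"
  shows "integrable M g" "(\<lambda>k. \<integral>\<omega>. f k \<omega> \<partial>M) \<longlonglongrightarrow> (\<integral>\<omega>. g \<omega> \<partial>M)"
proof -
  have [measurable]: "g \<in> borel_measurable M"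
    by (rule borel_measurable_LIMSEQ_real[OF lim]) auto
  have "0 \<le> (\<integral>\<omega>. (f 0 \<omega>)\<^sup>2 \<partial>M)" by simp
  with sq_le[of 0] have C: "0 \<le> C" by linarith
  have "AE \<omega> in M. (\<lambda>k. (f k \<omega>)\<^sup>2) \<longlonglongrightarrow> (g \<omega>)\<^sup>2"
    by (intro AE_I2 tendsto_power lim)
  note sq = integral_le_of_tendsto[OF sq_int zero_le_power2 sq_le _ this]
  have sq_g: "integrable M (\<lambda>\<omega>. (g \<omega>)\<^sup>2)" and sq_g_le: "(\<integral>\<omega>. (g \<omega>)\<^sup>2 \<partial>M) \<le> C"
    by (intro sq; simp)+
  have L1: "integrable M h" if [measurable]: "h \<in> borel_measurable M" and "integrable M (\<lambda>\<omega>. (h \<omega>)\<^sup>2)"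
    for h :: "'a \<Rightarrow> real"
  proof (rule Bochner_Integration.integrable_bound)
    show "integrable M (\<lambda>\<omega>. 1 + (h \<omega>)\<^sup>2)" using that by auto
    show "AE \<omega> in M. norm (h \<omega>) \<le> norm (1 + (h \<omega>)\<^sup>2)"
    proof (rule AE_I2)
      fix \<omega>
      have "0 \<le> (\<bar>h \<omega>\<bar> - 1)\<^sup>2" by simp
      then have "2 * \<bar>h \<omega>\<bar> \<le> (h \<omega>)\<^sup>2 + 1" by (simp add: power2_diff)
      then show "norm (h \<omega>) \<le> norm (1 + (h \<omega>)\<^sup>2)" by simp
    qed
  qed simp
  show int_g: "integrable M g" by (rule L1) (use sq_g in auto)
  have int_f: "integrable M (f k)" for k by (rule L1) (use sq_int in auto)
  show "(\<lambda>k. \<integral>\<omega>. f k \<omega> \<partial>M) \<longlonglongrightarrow> (\<integral>\<omega>. g \<omega> \<partial>M)"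
  proof (rule LIMSEQ_I)
    fix \<epsilon> :: real assume \<epsilon>: "0 < \<epsilon>"
    \<comment> \<open>Chosen such that both truncation errors are below \<open>\<epsilon> / 4\<close>.\<close>
    define K where "K = 4 * C / \<epsilon> + 1"
    have K: "0 < K" using C \<epsilon> by (simp add: K_def add_nonneg_pos)
    have CK: "C / K < \<epsilon> / 4" using \<epsilon> K by (simp add: K_def field_simps)
    define clip where "clip x = max (- K) (min K x)" for x
    have clip_diff: "\<bar>x - clip x\<bar> \<le> x\<^sup>2 / K" for x
    proof -
      \<comment> \<open>Nothing is cut off unless \<open>\<bar>x\<bar> > K\<close>.\<close>
      have "\<bar>x - clip x\<bar> * K \<le> \<bar>x\<bar> * \<bar>x\<bar>"
      proof (cases "\<bar>x\<bar> \<le> K")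
        case False
        then show ?thesis
          using K by (intro mult_mono) (auto simp: clip_def max_def min_def)
      qed (auto simp: clip_def max_def min_def)
      then show ?thesis using K by (simp add: field_simps power2_eq_square)
    qed
    have [measurable]: "clip \<in> borel_measurable borel" unfolding clip_def by measurable
    have clip_bd: "\<bar>clip x\<bar> \<le> K" for x using K by (auto simp: clip_def)
    have int_clip: "integrable M (\<lambda>\<omega>. clip (h \<omega>))" if [measurable]: "h \<in> borel_measurable M" for h :: "'a \<Rightarrow> real"
      by (rule integrable_const_bound[of _ K]) (use clip_bd in auto)
    have near: "\<bar>(\<integral>\<omega>. h \<omega> \<partial>M) - (\<integral>\<omega>. clip (h \<omega>) \<partial>M)\<bar> < \<epsilon> / 4"
      if h[measurable]: "h \<in> borel_measurable M" "integrable M h" "integrable M (\<lambda>\<omega>. (h \<omega>)\<^sup>2)"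
        "(\<integral>\<omega>. (h \<omega>)\<^sup>2 \<partial>M) \<le> C" for h :: "'a \<Rightarrow> real"
    proof -
      have "\<bar>(\<integral>\<omega>. h \<omega> \<partial>M) - (\<integral>\<omega>. clip (h \<omega>) \<partial>M)\<bar> = \<bar>\<integral>\<omega>. h \<omega> - clip (h \<omega>) \<partial>M\<bar>"
        using h int_clip[of h] by simp
      also have "\<dots> \<le> (\<integral>\<omega>. \<bar>h \<omega> - clip (h \<omega>)\<bar> \<partial>M)" by (rule integral_abs_bound)
      also have "\<dots> \<le> (\<integral>\<omega>. (h \<omega>)\<^sup>2 / K \<partial>M)"
        by (intro integral_mono) (use h int_clip[of h] clip_diff in auto)
      also have "\<dots> \<le> C / K" using h K by (simp add: divide_right_mono)
      finally show ?thesis using CK by linarith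
    qed
    have "(\<lambda>k. \<integral>\<omega>. clip (f k \<omega>) \<partial>M) \<longlonglongrightarrow> (\<integral>\<omega>. clip (g \<omega>) \<partial>M)"
    proof (rule integral_dominated_convergence[where w = "\<lambda>_. K"])
      show "AE \<omega> in M. (\<lambda>k. clip (f k \<omega>)) \<longlonglongrightarrow> clip (g \<omega>)"
        unfolding clip_def by (intro AE_I2 tendsto_intros lim)
    qed (use clip_bd in auto)
    then obtain k0 where k0: "\<And>k. k \<ge> k0 \<Longrightarrow> \<bar>(\<integral>\<omega>. clip (f k \<omega>) \<partial>M) - (\<integral>\<omega>. clip (g \<omega>) \<partial>M)\<bar> < \<epsilon> / 4"
      using LIMSEQ_D[of _ _ "\<epsilon> / 4"] \<epsilon> by fastforce
    show "\<exists>k0. \<forall>k\<ge>k0. norm ((\<integral>\<omega>. f k \<omega> \<partial>M) - (\<integral>\<omega>. g \<omega> \<partial>M)) < \<epsilon>"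
    proof (intro exI allI impI)
      fix k assume "k \<ge> k0"
      then show "norm ((\<integral>\<omega>. f k \<omega> \<partial>M) - (\<integral>\<omega>. g \<omega> \<partial>M)) < \<epsilon>"
        using k0[of k] near[of "f k"] near[of g] int_f sq_int sq_le int_g sq_g sq_g_le \<epsilon>
        unfolding real_norm_def by (auto simp: abs_if split: if_splits)
    qed
  qed
qed

lemma Int_stable_vimages: "Int_stable {h -` A \<inter> S |A. A \<in> sets N}"
proof (rule Int_stableI)
  fix a b assume "a \<in> {h -` A \<inter> S |A. A \<in> sets N}" "b \<in> {h -` A \<inter> S |A. A \<in> sets N}"
  then obtain A A' where "a = h -` A \<inter> S" "A \<in> sets N" "b = h -` A' \<inter> S" "A' \<in> sets N" by auto
  then have "a \<inter> b = h -` (A \<inter> A') \<inter> S" "A \<inter> A' \<in> sets N" by auto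
  then show "a \<inter> b \<in> {h -` A \<inter> S |A. A \<in> sets N}" by blast
qed

locale filtered_brownian =
  fixes M :: "'a measure" and F :: "real \<Rightarrow> 'a measure" and x0 :: real and B :: "real \<Rightarrow> 'a \<Rightarrow> real"
  assumes filtered: "filtered_prob_space M F" and brownian: "brownian_motion M F x0 B"
begin

sublocale prob_space M
  using filtered by (simp add: filtered_prob_space_def)

lemma space_F [simp]: "0 \<le> t \<Longrightarrow> space (F t) = space M"
  and sets_F: "0 \<le> t \<Longrightarrow> A \<in> sets (F t) \<Longrightarrow> A \<in> sets M"
  using filtered by (auto simp: filtered_prob_space_def subalgebra_def)

lemma sets_F_mono: "0 \<le> s \<Longrightarrow> s \<le> t \<Longrightarrow> A \<in> sets (F s) \<Longrightarrow> A \<in> sets (F t)"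
  using filtered unfolding filtered_prob_space_def subalgebra_def by blast

lemma measurable_F_mono:
  "0 \<le> s \<Longrightarrow> s \<le> t \<Longrightarrow> f \<in> borel_measurable (F s) \<Longrightarrow> f \<in> borel_measurable (F t)"
  using filtered measurable_from_subalg[of "F t" "F s"] by (auto simp: filtered_prob_space_def)

lemma measurable_F_M: "0 \<le> t \<Longrightarrow> f \<in> borel_measurable (F t) \<Longrightarrow> f \<in> borel_measurable M"
  using filtered measurable_from_subalg[of M "F t"] by (auto simp: filtered_prob_space_def)

lemma measurable_B: "0 \<le> s \<Longrightarrow> s \<le> t \<Longrightarrow> B s \<in> borel_measurable (F t)"
  using brownian measurable_F_mono[of s t] by (auto simp: brownian_motion_def)

lemma measurable_B_M [measurable]: "0 \<le> s \<Longrightarrow> B s \<in> borel_measurable M"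
  using measurable_F_M measurable_B by blast

lemma B_0: "\<omega> \<in> space M \<Longrightarrow> B 0 \<omega> = x0"
  and continuous_B: "\<omega> \<in> space M \<Longrightarrow> continuous_on {0..} (\<lambda>t. B t \<omega>)"
  using brownian by (auto simp: brownian_motion_def)

lemma increment_distributed:
  "0 \<le> s \<Longrightarrow> s < t \<Longrightarrow> distributed M lborel (\<lambda>\<omega>. B t \<omega> - B s \<omega>)
     (\<lambda>x. ennreal (normal_density 0 (sqrt (t - s)) x))"
  using brownian by (auto simp: brownian_motion_def)

lemma
  assumes "0 \<le> s" "s < t"
  shows integrable_increment: "integrable M (\<lambda>\<omega>. B t \<omega> - B s \<omega>)"
    and expectation_increment: "(\<integral>\<omega>. B t \<omega> - B s \<omega> \<partial>M) = 0"
    and integrable_increment_sq: "integrable M (\<lambda>\<omega>. (B t \<omega> - B s \<omega>)\<^sup>2)"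
    and expectation_increment_sq: "(\<integral>\<omega>. (B t \<omega> - B s \<omega>)\<^sup>2 \<partial>M) = t - s"
proof -
  note D = increment_distributed[OF assms]
  have pos: "0 < sqrt (t - s)" using assms by simp
  show "integrable M (\<lambda>\<omega>. B t \<omega> - B s \<omega>)"
    using distributed_integrable[OF D, of "\<lambda>x. x"] integrable_normal_moment[OF pos, of 0 1] by simp
  show "(\<integral>\<omega>. B t \<omega> - B s \<omega> \<partial>M) = 0"
    using normal_distributed_expectation[OF pos D] by simp
  show "integrable M (\<lambda>\<omega>. (B t \<omega> - B s \<omega>)\<^sup>2)"
    using distributed_integrable[OF D, of "\<lambda>x. x\<^sup>2"] integrable_normal_moment[OF pos, of 0 2] by simp
  show "(\<integral>\<omega>. (B t \<omega> - B s \<omega>)\<^sup>2 \<partial>M) = t - s"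
    using normal_distributed_variance[OF pos D] normal_distributed_expectation[OF pos D] assms
    by simp
qed

lemma
  assumes "0 \<le> s" "s < t" and g: "g \<in> borel_measurable (F s)" "integrable M g"
  shows integrable_mult_increment: "integrable M (\<lambda>\<omega>. g \<omega> * (B t \<omega> - B s \<omega>))"
    and expectation_mult_increment: "(\<integral>\<omega>. g \<omega> * (B t \<omega> - B s \<omega>) \<partial>M) = 0"
    and integrable_mult_increment_sq: "integrable M (\<lambda>\<omega>. g \<omega> * (B t \<omega> - B s \<omega>)\<^sup>2)"
proof -
  let ?I = "{(\<lambda>\<omega>. B t \<omega> - B s \<omega>) -` A \<inter> space M | A. A \<in> sets borel}"
  have [measurable]: "g \<in> borel_measurable M" "B s \<in> borel_measurable M" "B t \<in> borel_measurable M"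
    using assms by (auto intro: measurable_F_M)
  have "indep_set (sets (F s)) ?I"
    using brownian assms by (auto simp: brownian_motion_def)
  then have I: "prob (a \<inter> b) = prob a * prob b" if "a \<in> sets (F s)" "b \<in> ?I" for a b
    using that by (rule indep_setD)
  have indep: "indep_var borel g borel (\<lambda>\<omega>. f (B t \<omega> - B s \<omega>))"
    if [measurable]: "f \<in> borel_measurable borel" for f :: "real \<Rightarrow> real"
    unfolding indep_var_eq
  proof (intro conjI indep_set_sigma_sets)
    show "indep_set {g -` A \<inter> space M |A. A \<in> sets borel}
        {(\<lambda>\<omega>. f (B t \<omega> - B s \<omega>)) -` A \<inter> space M |A. A \<in> sets borel}"
      unfolding indep_sets2_eq
    proof (intro conjI ballI)
      fix a b assume a: "a \<in> {g -` A \<inter> space M |A. A \<in> sets borel}"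
        and b: "b \<in> {(\<lambda>\<omega>. f (B t \<omega> - B s \<omega>)) -` A \<inter> space M |A. A \<in> sets borel}"
      obtain A where A: "a = g -` A \<inter> space M" "A \<in> sets borel" using a by auto
      have "a \<in> sets (F s)" using measurable_sets[OF g(1) A(2)] A assms by simp
      moreover obtain A' where A': "b = (\<lambda>\<omega>. f (B t \<omega> - B s \<omega>)) -` A' \<inter> space M" "A' \<in> sets borel"
        using b by auto
      have "f -` A' \<in> sets borel" using measurable_sets[OF that A'(2)] by simp
      then have "b \<in> ?I" unfolding A'(1) by (intro CollectI exI[of _ "f -` A'"]) auto
      ultimately show "prob (a \<inter> b) = prob a * prob b" by (rule I)
    qed (auto intro: measurable_sets)
  qed (use Int_stable_vimages in auto)
  note i1 = indep[of "\<lambda>x. x", simplified] and i2 = indep[of "\<lambda>x. x\<^sup>2"]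
  show "integrable M (\<lambda>\<omega>. g \<omega> * (B t \<omega> - B s \<omega>))"
    by (rule indep_var_integrable[OF i1 g(2) integrable_increment[OF assms(1,2)]])
  show "(\<integral>\<omega>. g \<omega> * (B t \<omega> - B s \<omega>) \<partial>M) = 0"
    using indep_var_lebesgue_integral[OF i1 g(2) integrable_increment[OF assms(1,2)]]
      expectation_increment[OF assms(1,2)] by simp
  show "integrable M (\<lambda>\<omega>. g \<omega> * (B t \<omega> - B s \<omega>)\<^sup>2)"
    by (rule indep_var_integrable[OF i2 g(2) integrable_increment_sq[OF assms(1,2)]]) measurable
qed

text \<open>The strict inequality makes this weaker than being a stopping time. It suits first entrance times into
  right-open sets in a filtration that is not assumed right-continuous.\<close>

definition optional_time :: "real \<Rightarrow> ('a \<Rightarrow> real) \<Rightarrow> bool" where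
  "optional_time T \<sigma> \<longleftrightarrow> (\<forall>\<omega>\<in>space M. 0 \<le> \<sigma> \<omega> \<and> \<sigma> \<omega> \<le> T) \<and>
     (\<forall>u\<in>{0<..T}. {\<omega> \<in> space M. \<sigma> \<omega> < u} \<in> sets (F u))"

text \<open>The increments of \<open>B\<close> over those of the first \<open>k\<close> grid intervals of length \<open>T / N\<close> that begin before \<open>\<sigma>\<close> or at
  \<open>\<sigma>\<close>. Thus \<open>x0 + grid_stopped T \<sigma> N N\<close> is \<open>B\<close> at the first grid time after \<open>\<sigma>\<close> (or at \<open>T\<close>), written
  as a discrete stochastic integral.\<close>

definition grid_stopped :: "real \<Rightarrow> ('a \<Rightarrow> real) \<Rightarrow> nat \<Rightarrow> nat \<Rightarrow> 'a \<Rightarrow> real" where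
  "grid_stopped T \<sigma> N k \<omega> = (\<Sum>j<k. indicator {\<omega> \<in> space M. \<not> \<sigma> \<omega> < T * real j / real N} \<omega> *
     (B (T * real (Suc j) / real N) \<omega> - B (T * real j / real N) \<omega>))"

lemma not_before_in_F:
  assumes "optional_time T \<sigma>" "0 \<le> u" "u \<le> T"
  shows "{\<omega> \<in> space M. \<not> \<sigma> \<omega> < u} \<in> sets (F u)"
proof -
  have "{\<omega> \<in> space M. \<sigma> \<omega> < u} \<in> sets (F u)"
  proof (cases "u = 0")
    case True
    then have "{\<omega> \<in> space M. \<sigma> \<omega> < u} = {}"
      using assms by (auto simp: optional_time_def not_less)
    then show ?thesis by (simp only: sets.empty_sets)
  qed (use assms in \<open>auto simp: optional_time_def\<close>)
  then have "space (F u) - {\<omega> \<in> space M. \<sigma> \<omega> < u} \<in> sets (F u)" by (rule sets.compl_sets)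
  also have "space (F u) - {\<omega> \<in> space M. \<sigma> \<omega> < u} = {\<omega> \<in> space M. \<not> \<sigma> \<omega> < u}"
    using assms by auto
  finally show ?thesis .
qed

text \<open>The integrand at each grid time is known by then, so the summands are centred and orthogonal; the
  second moment is at most the sum of the interval lengths.\<close>

lemma grid_stopped_moments:
  assumes \<sigma>: "optional_time T \<sigma>" and T: "0 < T" and N: "0 < N" and k: "k \<le> N"
  shows "grid_stopped T \<sigma> N k \<in> borel_measurable (F (T * k / N))"
    and "integrable M (grid_stopped T \<sigma> N k)" and "(\<integral>\<omega>. grid_stopped T \<sigma> N k \<omega> \<partial>M) = 0"
    and "integrable M (\<lambda>\<omega>. (grid_stopped T \<sigma> N k \<omega>)\<^sup>2)"
    and "(\<integral>\<omega>. (grid_stopped T \<sigma> N k \<omega>)\<^sup>2 \<partial>M) \<le> T * k / N"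
proof -
  define u where "u j = T * real j / real N" for j
  define V where "V = grid_stopped T \<sigma> N"
  have "V k \<in> borel_measurable (F (u k)) \<and> integrable M (V k) \<and> (\<integral>\<omega>. V k \<omega> \<partial>M) = 0 \<and>
    integrable M (\<lambda>\<omega>. (V k \<omega>)\<^sup>2) \<and> (\<integral>\<omega>. (V k \<omega>)\<^sup>2 \<partial>M) \<le> u k"
    using k
  proof (induction k)
    case 0
    then show ?case by (auto simp: V_def u_def grid_stopped_def[abs_def])
  next
    case (Suc k)
    then have IH: "V k \<in> borel_measurable (F (u k))" "integrable M (V k)" "(\<integral>\<omega>. V k \<omega> \<partial>M) = 0"
      "integrable M (\<lambda>\<omega>. (V k \<omega>)\<^sup>2)" "(\<integral>\<omega>. (V k \<omega>)\<^sup>2 \<partial>M) \<le> u k" by auto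
    have u: "0 \<le> u k" "u k < u (Suc k)" "u k \<le> T" "u (Suc k) \<le> T"
      using T N Suc.prems mult_left_mono[of "real (Suc k)" "real N" T]
      by (auto simp: u_def field_simps)
    define A where "A = {\<omega> \<in> space M. \<not> \<sigma> \<omega> < u k}"
    define d where "d \<omega> = B (u (Suc k)) \<omega> - B (u k) \<omega>" for \<omega>
    have A: "A \<in> sets (F (u k))" unfolding A_def by (rule not_before_in_F[OF \<sigma> u(1,3)])
    note AM = sets_F[OF u(1) A]
    have Suc_eq: "V (Suc k) = (\<lambda>\<omega>. V k \<omega> + indicator A \<omega> * d \<omega>)"
      unfolding V_def grid_stopped_def[abs_def] A_def d_def u_def by (simp only: sum.lessThan_Suc)
    have i_A: "integrable M (indicator A :: _ \<Rightarrow> real)"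
      using integrable_const_indicator[OF AM, of 1] by simp
    have m_A: "indicator A \<in> borel_measurable (F (u k))" using A by auto
    have V_M: "V k \<in> borel_measurable M" by (rule measurable_F_M[OF u(1) IH(1)])
    have VA: "(\<lambda>\<omega>. V k \<omega> * indicator A \<omega>) \<in> borel_measurable (F (u k))"
      "integrable M (\<lambda>\<omega>. V k \<omega> * indicator A \<omega>)"
      using IH(1) A integrable_mult_indicator[OF AM IH(2)] by (auto simp: mult.commute)
    note m1 = integrable_mult_increment[OF u(1,2) m_A i_A, folded d_def]
      expectation_mult_increment[OF u(1,2) m_A i_A, folded d_def]
      integrable_mult_increment_sq[OF u(1,2) m_A i_A, folded d_def]
    note m2 = integrable_mult_increment[OF u(1,2) VA, folded d_def]
      expectation_mult_increment[OF u(1,2) VA, folded d_def]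
    have sq: "(V (Suc k) \<omega>)\<^sup>2 = (V k \<omega>)\<^sup>2 + 2 * (V k \<omega> * indicator A \<omega> * d \<omega>) + indicator A \<omega> * (d \<omega>)\<^sup>2" for \<omega>
      unfolding Suc_eq by (auto simp: power2_sum split: split_indicator)
    \<comment> \<open>The mixed term in the square vanishes because the increment is centred and independent of the past.\<close>
    have "(\<integral>\<omega>. indicator A \<omega> * (d \<omega>)\<^sup>2 \<partial>M) \<le> (\<integral>\<omega>. (d \<omega>)\<^sup>2 \<partial>M)"
      by (intro integral_mono m1 integrable_increment_sq[OF u(1,2), folded d_def])
         (auto split: split_indicator)
    also have "\<dots> = u (Suc k) - u k"
      unfolding d_def by (rule expectation_increment_sq[OF u(1,2)])
    finally have le: "(\<integral>\<omega>. indicator A \<omega> * (d \<omega>)\<^sup>2 \<partial>M) \<le> u (Suc k) - u k" .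
    have "V (Suc k) \<in> borel_measurable (F (u (Suc k)))"
      unfolding Suc_eq d_def
      by (intro borel_measurable_add borel_measurable_times borel_measurable_diff measurable_B
          measurable_F_mono[OF u(1) less_imp_le[OF u(2)]] IH m_A) (use u in auto)
    moreover have "(\<integral>\<omega>. (V (Suc k) \<omega>)\<^sup>2 \<partial>M) \<le> u (Suc k)"
      unfolding sq using IH m1 m2 le by simp
    ultimately show ?case
      unfolding sq using IH m1 m2 by (auto simp: Suc_eq)
  qed
  then show "grid_stopped T \<sigma> N k \<in> borel_measurable (F (T * k / N))"
    and "integrable M (grid_stopped T \<sigma> N k)" and "(\<integral>\<omega>. grid_stopped T \<sigma> N k \<omega> \<partial>M) = 0"
    and "integrable M (\<lambda>\<omega>. (grid_stopped T \<sigma> N k \<omega>)\<^sup>2)"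
    and "(\<integral>\<omega>. (grid_stopped T \<sigma> N k \<omega>)\<^sup>2 \<partial>M) \<le> T * k / N"
    by (auto simp: V_def u_def)
qed

lemma grid_stopped_at_grid_point:
  assumes \<sigma>: "optional_time T \<sigma>" and T: "0 \<le> T" and N: "0 < N" and \<omega>: "\<omega> \<in> space M"
  shows "\<exists>u. x0 + grid_stopped T \<sigma> N N \<omega> = B u \<omega> \<and> \<sigma> \<omega> \<le> u \<and> u \<le> \<sigma> \<omega> + T / N"
proof -
  define u where "u j = T * real j / real N" for j
  have s: "0 \<le> \<sigma> \<omega>" "\<sigma> \<omega> \<le> T" using \<sigma> \<omega> by (auto simp: optional_time_def)
  have "\<exists>j\<le>k. x0 + grid_stopped T \<sigma> N k \<omega> = B (u j) \<omega> \<and> u j \<le> \<sigma> \<omega> + T / N \<and> (j = k \<or> \<sigma> \<omega> < u j)" for k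
  proof (induction k)
    case 0
    then show ?case using B_0[OF \<omega>] s T N by (auto simp: grid_stopped_def u_def)
  next
    case (Suc k)
    then obtain j where j: "j \<le> k" "x0 + grid_stopped T \<sigma> N k \<omega> = B (u j) \<omega>" "u j \<le> \<sigma> \<omega> + T / N"
      "j = k \<or> \<sigma> \<omega> < u j" by auto
    have step: "grid_stopped T \<sigma> N (Suc k) \<omega> = grid_stopped T \<sigma> N k \<omega> +
        indicator {\<omega> \<in> space M. \<not> \<sigma> \<omega> < u k} \<omega> * (B (u (Suc k)) \<omega> - B (u k) \<omega>)"
      by (simp add: grid_stopped_def u_def add.commute)
    show ?case
    proof (cases "\<sigma> \<omega> < u k")
      case True
      then show ?thesis using j step by (intro exI[of _ j]) auto
    next
      case False
      have "u j \<le> u k" using j T N by (auto simp: u_def intro!: divide_right_mono mult_left_mono)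
      with False j have "j = k" by auto
      moreover have "u (Suc k) = u k + T / N" by (simp add: u_def field_simps add_divide_distrib)
      ultimately show ?thesis using j step False \<omega> by (intro exI[of _ "Suc k"]) auto
    qed
  qed
  then obtain j where "x0 + grid_stopped T \<sigma> N N \<omega> = B (u j) \<omega>" "u j \<le> \<sigma> \<omega> + T / N"
      "j = N \<or> \<sigma> \<omega> < u j" by blast
  moreover have "u N = T" using N by (simp add: u_def)
  ultimately show ?thesis using s by (intro exI[of _ "u j"]) auto
qed

lemma grid_stopped_tendsto:
  assumes \<sigma>: "optional_time T \<sigma>" and T: "0 \<le> T" and \<omega>: "\<omega> \<in> space M"
  shows "(\<lambda>N. x0 + grid_stopped T \<sigma> (Suc N) (Suc N) \<omega>) \<longlonglongrightarrow> B (\<sigma> \<omega>) \<omega>"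
proof -
  have "\<forall>N. \<exists>u. x0 + grid_stopped T \<sigma> (Suc N) (Suc N) \<omega> = B u \<omega> \<and> \<sigma> \<omega> \<le> u \<and> u \<le> \<sigma> \<omega> + T / Suc N"
    using grid_stopped_at_grid_point[OF \<sigma> T _ \<omega>] by blast
  then obtain u where u: "\<And>N. x0 + grid_stopped T \<sigma> (Suc N) (Suc N) \<omega> = B (u N) \<omega>"
    "\<And>N. \<sigma> \<omega> \<le> u N" "\<And>N. u N \<le> \<sigma> \<omega> + T / Suc N" by metis
  have s: "0 \<le> \<sigma> \<omega>" using \<sigma> \<omega> by (auto simp: optional_time_def)
  have "(\<lambda>N. \<sigma> \<omega> + T / real (Suc N)) \<longlonglongrightarrow> \<sigma> \<omega> + 0"
    by (intro tendsto_intros LIMSEQ_Suc[OF lim_const_over_n])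
  then have "u \<longlonglongrightarrow> \<sigma> \<omega>"
    by (intro tendsto_sandwich[OF _ _ tendsto_const, of "\<sigma> \<omega>" u]) (use u in auto)
  then have "(\<lambda>N. B (u N) \<omega>) \<longlonglongrightarrow> B (\<sigma> \<omega>) \<omega>"
    by (rule continuous_on_tendsto_compose[OF continuous_B[OF \<omega>]])
       (use s order_trans[OF s u(2)] in auto)
  then show ?thesis using u(1) by simp
qed

lemma measurable_stopped:
  assumes \<sigma>: "optional_time T \<sigma>" and T: "0 \<le> T"
  shows "(\<lambda>\<omega>. B (\<sigma> \<omega>) \<omega>) \<in> borel_measurable (F T)"
proof (cases "T = 0")
  case True
  then have "B (\<sigma> \<omega>) \<omega> = x0" if "\<omega> \<in> space (F T)" for \<omega>
    using \<sigma> B_0 that by (force simp: optional_time_def)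
  then show ?thesis by (subst measurable_cong[where g = "\<lambda>_. x0"]) auto
next
  case False
  show ?thesis
  proof (rule borel_measurable_LIMSEQ_real)
    show "(\<lambda>N. x0 + grid_stopped T \<sigma> (Suc N) (Suc N) \<omega>) \<longlonglongrightarrow> B (\<sigma> \<omega>) \<omega>" if "\<omega> \<in> space (F T)" for \<omega>
      by (rule grid_stopped_tendsto[OF \<sigma> T]) (use that T in auto)
    show "(\<lambda>\<omega>. x0 + grid_stopped T \<sigma> (Suc N) (Suc N) \<omega>) \<in> borel_measurable (F T)" for N
      using grid_stopped_moments(1)[OF \<sigma>, of "Suc N" "Suc N"] T False by simp
  qed
qed

text \<open>The grid times decrease to \<open>\<sigma>\<close> and paths are continuous, so the discrete approximations
  converge pointwise; their second moments are bounded by \<open>T\<close>.\<close>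

lemma
  assumes \<sigma>: "optional_time T \<sigma>" and T: "0 \<le> T"
  shows integrable_stopped: "integrable M (\<lambda>\<omega>. B (\<sigma> \<omega>) \<omega>)"
    and expectation_stopped: "(\<integral>\<omega>. B (\<sigma> \<omega>) \<omega> \<partial>M) = x0"
proof -
  have "integrable M (\<lambda>\<omega>. B (\<sigma> \<omega>) \<omega>) \<and> (\<integral>\<omega>. B (\<sigma> \<omega>) \<omega> \<partial>M) = x0"
  proof (cases "T = 0")
    case True
    then have "B (\<sigma> \<omega>) \<omega> = x0" if "\<omega> \<in> space M" for \<omega>
      using \<sigma> B_0 that by (force simp: optional_time_def)
    then show ?thesis
      by (auto simp: prob_space cong: Bochner_Integration.integral_cong Bochner_Integration.integrable_cong)
  next
    case False
    let ?V = "\<lambda>N. grid_stopped T \<sigma> (Suc N) (Suc N)"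
    have T': "0 < T" using T False by simp
    note V = grid_stopped_moments[OF \<sigma> T' zero_less_Suc order_refl]
    note L2 = tendsto_expectation_L2_bounded[where f = ?V and C = T and g = "\<lambda>\<omega>. B (\<sigma> \<omega>) \<omega> - x0"]
    have lim: "(\<lambda>N. ?V N \<omega>) \<longlonglongrightarrow> B (\<sigma> \<omega>) \<omega> - x0" if "\<omega> \<in> space M" for \<omega>
      using tendsto_diff[OF grid_stopped_tendsto[OF \<sigma> T that] tendsto_const[of x0]] by simp
    have "(\<integral>\<omega>. (?V N \<omega>)\<^sup>2 \<partial>M) \<le> T" for N using V(5)[of N] by simp
    then have "integrable M (\<lambda>\<omega>. B (\<sigma> \<omega>) \<omega> - x0)" "(\<lambda>N. \<integral>\<omega>. ?V N \<omega> \<partial>M) \<longlonglongrightarrow> (\<integral>\<omega>. B (\<sigma> \<omega>) \<omega> - x0 \<partial>M)"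
      by (auto intro!: L2 V lim borel_measurable_integrable)
    moreover from this(2) have "(\<integral>\<omega>. B (\<sigma> \<omega>) \<omega> - x0 \<partial>M) = 0"
      unfolding V(3) by (simp add: LIMSEQ_const_iff)
    moreover have "integrable M (\<lambda>\<omega>. (B (\<sigma> \<omega>) \<omega> - x0) + x0)" if "integrable M (\<lambda>\<omega>. B (\<sigma> \<omega>) \<omega> - x0)"
      using that by (intro Bochner_Integration.integrable_add) auto
    ultimately have "integrable M (\<lambda>\<omega>. B (\<sigma> \<omega>) \<omega>)" "(\<integral>\<omega>. B (\<sigma> \<omega>) \<omega> - x0 \<partial>M) = 0" by auto
    then show ?thesis by (simp add: prob_space)
  qed
  then show "integrable M (\<lambda>\<omega>. B (\<sigma> \<omega>) \<omega>)" "(\<integral>\<omega>. B (\<sigma> \<omega>) \<omega> \<partial>M) = x0" by auto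
qed

end

section \<open>Paths stopped at a barrier that depends on their maximum\<close>

text \<open>The first entrance time into \<open>D\<close>, capped at the horizon \<open>T\<close>; inserting \<open>T\<close> avoids the infimum of
  the empty set.\<close>

definition debut :: "real \<Rightarrow> real set \<Rightarrow> real" where
  "debut T D = Inf (insert T (D \<inter> {0..T}))"

lemma debut_bounds: "0 \<le> T \<Longrightarrow> 0 \<le> debut T D" "0 \<le> T \<Longrightarrow> debut T D \<le> T"
  unfolding debut_def by (rule cInf_greatest; auto) (rule cInf_lower; auto intro!: bdd_belowI[of _ 0])

lemma debut_less_iff:
  assumes "0 \<le> T" "u \<le> T"
  shows "debut T D < u \<longleftrightarrow> (\<exists>s\<in>D. 0 \<le> s \<and> s < u)"
proof -
  have "debut T D < u \<longleftrightarrow> (\<exists>s\<in>insert T (D \<inter> {0..T}). s < u)"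
    unfolding debut_def using assms by (intro cInf_less_iff) (auto intro!: bdd_belowI[of _ 0])
  then show ?thesis using assms by auto
qed

lemma debut_min:
  assumes "0 \<le> s" "s \<le> T"
  shows "debut s D = min s (debut T D)"
proof (rule antisym)
  show "debut s D \<le> min s (debut T D)"
    using debut_less_iff[of T "debut s D" D] debut_less_iff[of s "debut s D" D] debut_bounds[of s D] assms
    by (auto simp flip: not_less)
  show "min s (debut T D) \<le> debut s D"
    using debut_less_iff[of T "min s (debut T D)" D] debut_less_iff[of s "min s (debut T D)" D] assms
    by (auto simp flip: not_less)
qed

definition path_max :: "(real \<Rightarrow> real) \<Rightarrow> real \<Rightarrow> real" where
  "path_max b t = (SUP s\<in>{0..t}. b s)"

lemma running_max_eq_path_max: "running_max X t \<omega> = path_max (\<lambda>s. X s \<omega>) t"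
  by (simp add: running_max_def path_max_def)

locale continuous_path =
  fixes b :: "real \<Rightarrow> real"
  assumes cont: "continuous_on {0..} b"
begin

lemma bdd_above_path: "bdd_above (b ` {0..t})"
  by (intro bounded_imp_bdd_above compact_imp_bounded compact_continuous_image compact_Icc
      continuous_on_subset[OF cont]) auto

lemma less_path_max_iff: "0 \<le> t \<Longrightarrow> c < path_max b t \<longleftrightarrow> (\<exists>s\<in>{0..t}. c < b s)"
  unfolding path_max_def by (rule less_cSUP_iff[OF _ bdd_above_path]) auto

lemma path_max_le_iff: "0 \<le> t \<Longrightarrow> path_max b t \<le> c \<longleftrightarrow> (\<forall>s\<in>{0..t}. b s \<le> c)"
  using less_path_max_iff[of t c] by (auto simp: not_less[symmetric])

lemma le_path_max: "0 \<le> s \<Longrightarrow> s \<le> t \<Longrightarrow> b s \<le> path_max b t"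
  using path_max_le_iff[of t "path_max b t"] by auto

lemma path_max_mono: "0 \<le> s \<Longrightarrow> s \<le> t \<Longrightarrow> path_max b s \<le> path_max b t"
  using path_max_le_iff[of s "path_max b t"] le_path_max by auto

lemma path_max_attained:
  assumes "0 \<le> t"
  obtains r where "0 \<le> r" "r \<le> t" "b r = path_max b t"
proof -
  obtain r where r: "r \<in> {0..t}" "\<forall>s\<in>{0..t}. b s \<le> b r"
    using continuous_attains_sup[of "{0..t}" b] continuous_on_subset[OF cont] assms by auto
  then have "path_max b t \<le> b r" using path_max_le_iff[OF assms] by auto
  then show ?thesis using that[of r] r le_path_max[of r t] by auto
qed

lemma right_tendsto: "0 \<le> t \<Longrightarrow> (b \<longlongrightarrow> b t) (at_right t)"
  using cont by (auto simp: continuous_on_def intro: tendsto_within_subset)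

lemma left_tendsto: "0 < t \<Longrightarrow> (b \<longlongrightarrow> b t) (at_left t)"
proof -
  assume t: "0 < t"
  then have "(b \<longlongrightarrow> b t) (at t within {0..})" using cont by (auto simp: continuous_on_def)
  moreover have "at t within {0..} = at t" by (rule at_within_interior) (use t in auto)
  ultimately show ?thesis by (auto simp: filterlim_at_split)
qed

text \<open>If the stopped path exceeds \<open>m\<close>, then its first passage over \<open>m\<close> comes before the old stopping time, and
  by continuity it happens at height \<open>m\<close>; otherwise the additional stopping rule never acts.\<close>

lemma debut_with_level:
  assumes T: "0 \<le> T" and b0: "b 0 < m"
  shows "b (debut T (D \<union> {s. m < b s})) = (if m < path_max b (debut T D) then m else b (debut T D))"
proof -
  define \<rho> \<sigma> where "\<rho> = debut T D" and "\<sigma> = debut T (D \<union> {s. m < b s})"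
  note \<rho> = debut_bounds[OF T, of D, folded \<rho>_def]
  note \<sigma> = debut_bounds[OF T, of "D \<union> {s. m < b s}", folded \<sigma>_def]
  have less_\<sigma>: "u \<le> T \<Longrightarrow> \<sigma> < u \<longleftrightarrow> (\<exists>s\<in>D \<union> {s. m < b s}. 0 \<le> s \<and> s < u)"
    and less_\<rho>: "u \<le> T \<Longrightarrow> \<rho> < u \<longleftrightarrow> (\<exists>s\<in>D. 0 \<le> s \<and> s < u)" for u
    unfolding \<sigma>_def \<rho>_def by (rule debut_less_iff[OF T]; simp)+
  have below: "b s \<le> m" if "0 \<le> s" "s < \<sigma>" for s
    using less_\<sigma>[of \<sigma>] \<sigma> that by (auto simp: not_less)
  show ?thesis
  proof (cases "m < path_max b \<rho>")
    case True
    then obtain r where r: "0 \<le> r" "r \<le> \<rho>" "m < b r" using less_path_max_iff[OF \<rho>(1)] by auto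
    have \<sigma>_le: "\<sigma> \<le> r" using below[of r] r by (auto simp: not_le[symmetric])
    have "b \<sigma> \<le> m"
    proof (cases "\<sigma> = 0")
      case False
      then have "0 < \<sigma>" using \<sigma> by simp
      then have "\<forall>\<^sub>F s in at_left \<sigma>. 0 < s \<and> s < \<sigma>"
        using eventually_at_left_real[of 0 \<sigma>] by simp
      then have "\<forall>\<^sub>F s in at_left \<sigma>. b s \<le> m" by eventually_elim (auto intro: below)
      then show ?thesis by (rule tendsto_upperbound[OF left_tendsto[OF \<open>0 < \<sigma>\<close>]]) simp
    qed (use b0 in auto)
    moreover have "m \<le> b \<sigma>"
    proof (rule ccontr)
      assume "\<not> m \<le> b \<sigma>"
      then have lt: "b \<sigma> < m" by simp
      then have "\<sigma> < \<rho>" using \<sigma>_le r by (cases "\<sigma> = r") auto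
      have "\<forall>\<^sub>F s in at_right \<sigma>. b s < m"
        using right_tendsto[OF \<sigma>(1)] lt by (rule order_tendstoD)
      then obtain e where e: "\<sigma> < e" "\<And>s. \<sigma> < s \<Longrightarrow> s < e \<Longrightarrow> b s < m"
        unfolding eventually_at_right_field by auto
      define u where "u = min e \<rho>"
      have u: "\<sigma> < u" "u \<le> T" "u \<le> \<rho>" using e \<open>\<sigma> < \<rho>\<close> \<rho> by (auto simp: u_def)
      then obtain s where s: "s \<in> D \<union> {s. m < b s}" "0 \<le> s" "s < u" using less_\<sigma> by auto
      have "s \<notin> D" using less_\<rho>[of \<rho>] \<rho> s u by auto
      then have "m < b s" using s by auto
      moreover have "\<sigma> \<le> s" using below[of s] calculation s by (auto simp: not_le[symmetric])
      ultimately show False using e(2)[of s] lt s by (cases "s = \<sigma>") (auto simp: u_def)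
    qed
    ultimately show ?thesis using True by (simp add: \<rho>_def \<sigma>_def)
  next
    case False
    then have le: "b s \<le> m" if "0 \<le> s" "s \<le> \<rho>" for s
      using path_max_le_iff[OF \<rho>(1)] that by (auto simp: not_less)
    have "\<not> \<sigma> < \<rho>"
      using less_\<sigma>[of \<rho>] less_\<rho>[of \<rho>] \<rho> le by (fastforce simp: not_less)
    moreover have "\<not> \<rho> < \<sigma>"
      using less_\<sigma>[of \<sigma>] less_\<rho>[of \<sigma>] \<sigma> by auto
    ultimately have "\<sigma> = \<rho>" by simp
    then show ?thesis using False by (simp add: \<rho>_def \<sigma>_def)
  qed
qed

end

text \<open>The strict inequality makes the set right-open, so that its first entrance time is decided at
  rational times. Times before the path has left its starting point upwards are excluded, because
  \<open>\<zeta>\<close> carries information only to the right of \<open>b 0\<close>.\<close>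

definition below_barrier :: "(real \<Rightarrow> real) \<Rightarrow> (real \<Rightarrow> real) \<Rightarrow> real set" where
  "below_barrier \<zeta> b = {s. 0 \<le> s \<and> b 0 < path_max b s \<and> b s < \<zeta> (path_max b s)}"

locale barrier_path = continuous_path b for b :: "real \<Rightarrow> real" +
  fixes \<zeta> :: "real \<Rightarrow> real"
  assumes barrier_mono: "mono_on {b 0<..} \<zeta>" and barrier_less: "\<And>m. b 0 < m \<Longrightarrow> \<zeta> m < m"
begin

text \<open>The barrier can only move up, and the path needs some time to rise back to it.\<close>

lemma below_barrier_persists:
  assumes s: "s \<in> below_barrier \<zeta> b" and "s < v"
  shows "\<exists>q\<in>\<rat>. s < q \<and> q < v \<and> q \<in> below_barrier \<zeta> b"
proof -
  have s': "0 \<le> s" "b 0 < path_max b s" "b s < \<zeta> (path_max b s)"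
    using s by (auto simp: below_barrier_def)
  have "\<forall>\<^sub>F q in at_right s. b q < \<zeta> (path_max b s)"
    using right_tendsto[OF s'(1)] s'(3) by (rule order_tendstoD)
  then obtain e where e: "s < e" "\<And>q. s < q \<Longrightarrow> q < e \<Longrightarrow> b q < \<zeta> (path_max b s)"
    unfolding eventually_at_right_field by auto
  obtain q where q: "q \<in> \<rat>" "s < q" "q < min e v"
    using Rats_dense_in_real[of s "min e v"] e assms by auto
  have "path_max b s \<le> path_max b q" using path_max_mono s' q by auto
  then have "\<zeta> (path_max b s) \<le> \<zeta> (path_max b q)"
    using s' by (intro mono_onD[OF barrier_mono]) auto
  then have "q \<in> below_barrier \<zeta> b"
    using e(2)[of q] q s' \<open>path_max b s \<le> path_max b q\<close> by (auto simp: below_barrier_def)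
  then show ?thesis using q by auto
qed

text \<open>From the time of the maximum on, the path stays above \<open>\<zeta>\<close> of that maximum until it is stopped. If it is
  stopped at the maximum itself, it lies above the barrier anyway.\<close>

lemma barrier_le_stopped:
  assumes \<rho>: "0 \<le> \<rho>" and not_below: "\<And>s. s \<in> below_barrier \<zeta> b \<Longrightarrow> \<rho> \<le> s"
    and c: "b 0 < c" "c \<le> path_max b \<rho>"
  shows "\<zeta> c \<le> b \<rho>"
proof (cases "c \<le> b \<rho>")
  case True
  then show ?thesis using barrier_less[OF c(1)] by simp
next
  case False
  obtain r where r: "0 \<le> r" "r \<le> \<rho>" "b r = path_max b \<rho>" by (rule path_max_attained[OF \<rho>])
  with False c have "r < \<rho>" by (cases "r = \<rho>") auto
  have "\<zeta> c \<le> b s" if "r < s" "s < \<rho>" for s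
  proof -
    have cs: "c \<le> path_max b s" using le_path_max[of r s] r c that by auto
    have "s \<notin> below_barrier \<zeta> b" using not_below[of s] that by auto
    then have "\<zeta> (path_max b s) \<le> b s" using cs c r that by (auto simp: below_barrier_def)
    moreover have "\<zeta> c \<le> \<zeta> (path_max b s)"
      using cs c by (intro mono_onD[OF barrier_mono]) auto
    ultimately show ?thesis by simp
  qed
  then have "\<forall>\<^sub>F s in at_left \<rho>. \<zeta> c \<le> b s"
    using eventually_at_left_real[OF \<open>r < \<rho>\<close>] by (auto elim: eventually_mono)
  then show ?thesis
    using \<open>r < \<rho>\<close> r by (intro tendsto_lowerbound[OF left_tendsto]) auto
qed

text \<open>Right after \<open>\<tau>\<close> the path visits the region below the barrier while its maximum is still below a
  given \<open>c' > c\<close>. This gives \<open>b \<tau> \<le> \<zeta> c'\<close> for every \<open>c' > c\<close>; right continuity of the barrier passes to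
  the limit \<open>c\<close>.\<close>

lemma stopped_le_barrier:
  assumes \<tau>: "0 \<le> \<tau>" and hit: "\<And>v. \<tau> < v \<Longrightarrow> \<exists>s\<in>below_barrier \<zeta> b. \<tau> \<le> s \<and> s < v"
    and c: "b 0 < c" "path_max b \<tau> \<le> c" and rc: "continuous (at_right c) \<zeta>"
  shows "b \<tau> \<le> \<zeta> c"
proof (rule ccontr)
  assume "\<not> b \<tau> \<le> \<zeta> c"
  then have "\<forall>\<^sub>F c' in at_right c. \<zeta> c' < b \<tau>"
    using rc by (intro order_tendstoD) (auto simp: continuous_within)
  moreover have "\<forall>\<^sub>F c' in at_right c. c < c'" by (simp add: eventually_at_filter)
  ultimately have "\<forall>\<^sub>F c' in at_right c. c < c' \<and> \<zeta> c' < b \<tau>" by eventually_elim auto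
  then obtain c' where c': "c < c'" "\<zeta> c' < b \<tau>"
    by (metis (mono_tags, lifting) eventually_happens' trivial_limit_at_right_real)
  have "b \<tau> < c'" using le_path_max[of \<tau> \<tau>] \<tau> c c' by auto
  then have "\<forall>\<^sub>F s in at_right \<tau>. \<zeta> c' < b s \<and> b s < c'"
    using right_tendsto[OF \<tau>] c' by (intro eventually_conj order_tendstoD) auto
  then obtain e where e: "\<tau> < e" "\<And>s. \<tau> < s \<Longrightarrow> s < e \<Longrightarrow> \<zeta> c' < b s \<and> b s < c'"
    unfolding eventually_at_right_field by auto
  obtain s where s: "s \<in> below_barrier \<zeta> b" "\<tau> \<le> s" "s < e" using hit[OF e(1)] by auto
  have "\<zeta> c' < b s" using e(2)[of s] s c' by (cases "s = \<tau>") auto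
  moreover have "path_max b s \<le> c'"
    unfolding path_max_le_iff[OF order_trans[OF \<tau> s(2)]]
  proof
    fix r assume r: "r \<in> {0..s}"
    show "b r \<le> c'"
    proof (cases "r \<le> \<tau>")
      case True
      then show ?thesis using le_path_max[of r \<tau>] r c c' by auto
    next
      case False
      then show ?thesis using e(2)[of r] r s by auto
    qed
  qed
  then have "\<zeta> (path_max b s) \<le> \<zeta> c'"
    using s(1) by (intro mono_onD[OF barrier_mono]) (auto simp: below_barrier_def)
  ultimately show False using s(1) by (auto simp: below_barrier_def)
qed

end

section \<open>Brownian motion stopped at the barrier\<close>

context filtered_brownian
begin

lemma continuous_path_B: "\<omega> \<in> space M \<Longrightarrow> continuous_path (\<lambda>t. B t \<omega>)"
  by unfold_locales (rule continuous_B)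

lemma optional_time_debut:
  assumes T: "0 \<le> T"
    and right: "\<And>\<omega> s v. \<omega> \<in> space M \<Longrightarrow> 0 \<le> s \<Longrightarrow> s \<in> D \<omega> \<Longrightarrow> s < v \<Longrightarrow> \<exists>q\<in>\<rat>. s < q \<and> q < v \<and> q \<in> D \<omega>"
    and adapted: "\<And>q. 0 \<le> q \<Longrightarrow> {\<omega> \<in> space M. q \<in> D \<omega>} \<in> sets (F q)"
  shows "optional_time T (\<lambda>\<omega>. debut T (D \<omega>))"
  unfolding optional_time_def
proof (intro conjI ballI)
  fix u assume u: "u \<in> {0<..T}"
  have "{\<omega> \<in> space M. debut T (D \<omega>) < u} = (\<Union>q\<in>\<rat> \<inter> {0..<u}. {\<omega> \<in> space M. q \<in> D \<omega>})"
  proof (intro set_eqI iffI)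
    fix \<omega> assume "\<omega> \<in> {\<omega> \<in> space M. debut T (D \<omega>) < u}"
    then obtain s where s: "\<omega> \<in> space M" "s \<in> D \<omega>" "0 \<le> s" "s < u"
      using debut_less_iff[OF T, of u "D \<omega>"] u by auto
    then obtain q where q: "q \<in> \<rat>" "s < q" "q < u" "q \<in> D \<omega>" using right[OF s(1,3,2,4)] by auto
    then show "\<omega> \<in> (\<Union>q\<in>\<rat> \<inter> {0..<u}. {\<omega> \<in> space M. q \<in> D \<omega>})"
      using s by (intro UN_I[of q]) auto
  next
    fix \<omega> assume "\<omega> \<in> (\<Union>q\<in>\<rat> \<inter> {0..<u}. {\<omega> \<in> space M. q \<in> D \<omega>})"
    then show "\<omega> \<in> {\<omega> \<in> space M. debut T (D \<omega>) < u}"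
      using debut_less_iff[OF T, of u "D \<omega>"] u by auto
  qed
  also have "\<dots> \<in> sets (F u)"
  proof (rule sets.countable_UN'')
    show "countable (\<rat> \<inter> {0..<u})" by (intro countable_Int1 countable_rat)
    show "{\<omega> \<in> space M. q \<in> D \<omega>} \<in> sets (F u)" if "q \<in> \<rat> \<inter> {0..<u}" for q
      by (rule sets_F_mono[OF _ _ adapted]) (use that in auto)
  qed
  finally show "{\<omega> \<in> space M. debut T (D \<omega>) < u} \<in> sets (F u)" .
qed (use debut_bounds[OF T] in auto)

text \<open>Stopping at \<open>s\<close> on \<open>A\<close> and at \<open>\<sigma>\<close> elsewhere is again an optional time, so its expectation equals
  that of \<open>\<sigma>\<close> itself.\<close>

lemma stopped_martingale:
  assumes \<sigma>: "optional_time T \<sigma>" and s: "0 \<le> s" "s \<le> T" and A: "A \<in> sets (F s)"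
  shows "(\<integral>\<omega>. B (\<sigma> \<omega>) \<omega> * indicator A \<omega> \<partial>M) = (\<integral>\<omega>. B (min s (\<sigma> \<omega>)) \<omega> * indicator A \<omega> \<partial>M)"
proof -
  have T: "0 \<le> T" using s by simp
  have AM: "A \<in> sets M" using A s by (intro sets_F)
  define \<kappa> where "\<kappa> \<omega> = (if \<omega> \<in> A then min s (\<sigma> \<omega>) else \<sigma> \<omega>)" for \<omega>
  have \<kappa>: "optional_time T \<kappa>"
    unfolding optional_time_def
  proof (intro conjI ballI)
    fix u assume u: "u \<in> {0<..T}"
    have \<sigma>u: "{\<omega> \<in> space M. \<sigma> \<omega> < u} \<in> sets (F u)" using \<sigma> u by (auto simp: optional_time_def)
    show "{\<omega> \<in> space M. \<kappa> \<omega> < u} \<in> sets (F u)"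
    proof (cases "u \<le> s")
      case True
      then have "{\<omega> \<in> space M. \<kappa> \<omega> < u} = {\<omega> \<in> space M. \<sigma> \<omega> < u}" by (auto simp: \<kappa>_def)
      then show ?thesis using \<sigma>u by simp
    next
      case False
      then have "{\<omega> \<in> space M. \<kappa> \<omega> < u} = A \<union> {\<omega> \<in> space M. \<sigma> \<omega> < u}"
        using sets.sets_into_space[OF AM] by (auto simp: \<kappa>_def)
      moreover have "A \<in> sets (F u)" using sets_F_mono[of s u A] A False s by simp
      ultimately show ?thesis using \<sigma>u by auto
    qed
  qed (use \<sigma> s in \<open>auto simp: \<kappa>_def optional_time_def\<close>)
  note int = integrable_stopped[OF \<kappa> T] integrable_stopped[OF \<sigma> T]
  have iA: "integrable M (\<lambda>\<omega>. f \<omega> * indicator A \<omega>)" if "integrable M f" for f :: "'a \<Rightarrow> real"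
    using integrable_mult_indicator[OF AM that] by (simp add: mult.commute)
  have "0 = (\<integral>\<omega>. B (\<sigma> \<omega>) \<omega> - B (\<kappa> \<omega>) \<omega> \<partial>M)"
    using int expectation_stopped[OF \<kappa> T] expectation_stopped[OF \<sigma> T] by simp
  also have "\<dots> = (\<integral>\<omega>. B (\<sigma> \<omega>) \<omega> * indicator A \<omega> - B (\<kappa> \<omega>) \<omega> * indicator A \<omega> \<partial>M)"
    by (intro Bochner_Integration.integral_cong) (auto simp: \<kappa>_def)
  also have "\<dots> = (\<integral>\<omega>. B (\<sigma> \<omega>) \<omega> * indicator A \<omega> \<partial>M) - (\<integral>\<omega>. B (\<kappa> \<omega>) \<omega> * indicator A \<omega> \<partial>M)"
    using int by (intro Bochner_Integration.integral_diff iA)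
  also have "(\<integral>\<omega>. B (\<kappa> \<omega>) \<omega> * indicator A \<omega> \<partial>M) = (\<integral>\<omega>. B (min s (\<sigma> \<omega>)) \<omega> * indicator A \<omega> \<partial>M)"
    by (intro Bochner_Integration.integral_cong) (auto simp: \<kappa>_def split: split_indicator)
  finally show ?thesis by simp
qed

text \<open>The Gaussian density is at most \<open>1 / sqrt (2 * pi * k)\<close>, so Brownian motion leaves every bounded
  set in the long run.\<close>

lemma prob_B_near_le:
  assumes k: "0 < k" and K: "0 \<le> K"
  shows "prob {\<omega> \<in> space M. \<bar>B k \<omega> - x0\<bar> \<le> K} \<le> 2 * K / sqrt (2 * pi * k)"
proof -
  note D = increment_distributed[OF order_refl k, simplified]
  have "emeasure M {\<omega> \<in> space M. \<bar>B k \<omega> - x0\<bar> \<le> K}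
      = emeasure M ((\<lambda>\<omega>. B k \<omega> - B 0 \<omega>) -` {-K..K} \<inter> space M)"
    by (intro arg_cong2[where f = emeasure] refl) (auto simp: B_0)
  also have "\<dots> = (\<integral>\<^sup>+x. ennreal (normal_density 0 (sqrt k) x) * indicator {-K..K} x \<partial>lborel)"
    by (rule distributed_emeasure[OF D]) simp
  also have "\<dots> \<le> (\<integral>\<^sup>+x. ennreal (1 / sqrt (2 * pi * k)) * indicator {-K..K} x \<partial>lborel)"
  proof (intro nn_integral_mono mult_right_mono ennreal_leI)
    fix x :: real
    have "exp (- x\<^sup>2 / (2 * k)) \<le> 1" using k by (simp add: divide_nonneg_pos)
    then show "normal_density 0 (sqrt k) x \<le> 1 / sqrt (2 * pi * k)"
      using k unfolding normal_density_def
      by (simp add: divide_right_mono)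
  qed simp
  also have "\<dots> = ennreal (1 / sqrt (2 * pi * k)) * ennreal (2 * K)"
    using K by (subst nn_integral_cmult) auto
  also have "\<dots> = ennreal (2 * K / sqrt (2 * pi * k))"
    using K k by (simp flip: ennreal_mult)
  finally show ?thesis
    using K k by (simp add: emeasure_eq_measure)
qed

end

text \<open>The barrier \<open>\<zeta>\<close> here is \<open>\<zeta> 1\<close> of the theorem. Its linear growth is what keeps the
  expected maximum finite.\<close>

locale barrier_brownian = filtered_brownian M F x0 B
  for M :: "'a measure" and F x0 B +
  fixes \<zeta> :: "real \<Rightarrow> real" and \<alpha> m0 :: real
  assumes mono: "mono_on {x0<..} \<zeta>" and less: "\<And>m. x0 < m \<Longrightarrow> \<zeta> m < m"
    and right_cont: "\<And>m. x0 < m \<Longrightarrow> continuous (at_right m) \<zeta>"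
    and \<alpha>: "0 < \<alpha>" and m0: "0 < m0" "x0 < m0" and growth: "\<And>m. m0 \<le> m \<Longrightarrow> \<alpha> * m \<le> \<zeta> m"
begin

lemma barrier_path_B: "\<omega> \<in> space M \<Longrightarrow> barrier_path (\<lambda>t. B t \<omega>) \<zeta>"
  by (intro barrier_path.intro continuous_path_B barrier_path_axioms.intro)
     (use mono less in \<open>auto simp: B_0\<close>)

definition stop_set :: "'a \<Rightarrow> real set" where
  "stop_set \<omega> = below_barrier \<zeta> (\<lambda>t. B t \<omega>)"

definition stop_time :: "real \<Rightarrow> 'a \<Rightarrow> real" where
  "stop_time u \<omega> = debut u (stop_set \<omega>)"

definition stopped_B :: "real \<Rightarrow> 'a \<Rightarrow> real" where
  "stopped_B u \<omega> = B (stop_time u \<omega>) \<omega>"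

definition stopped_max :: "real \<Rightarrow> 'a \<Rightarrow> real" where
  "stopped_max u \<omega> = running_max B (stop_time u \<omega>) \<omega>"

lemma measurable_path_max:
  assumes "0 \<le> q"
  shows "running_max B q \<in> borel_measurable (F q)"
proof (rule measurable_running_max[OF assms])
  fix \<omega> assume \<omega>: "\<omega> \<in> space (F q)"
  then interpret continuous_path "\<lambda>t. B t \<omega>" using continuous_path_B assms by simp
  show "bdd_above ((\<lambda>t. B t \<omega>) ` {0..q})" by (rule bdd_above_path)
  show "continuous (at_right r) (\<lambda>t. B t \<omega>)" if "0 \<le> r" for r
    using right_tendsto[OF that] by (simp add: continuous_within)
qed (rule measurable_B)

lemma stop_set_adapted:
  assumes q: "0 \<le> q"
  shows "{\<omega> \<in> space M. q \<in> stop_set \<omega>} \<in> sets (F q)"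
proof -
  note [measurable] = measurable_path_max[OF q] measurable_B[OF q order_refl]
  have "\<zeta> \<in> borel_measurable (restrict_space borel {x0<..})"
    by (rule borel_measurable_mono_on_fnc[OF mono])
  then have [measurable]: "(\<lambda>m. if m \<in> {x0<..} then \<zeta> m else 0) \<in> borel_measurable borel"
    by (subst (asm) measurable_restrict_space_iff[where c = 0]) auto
  have "{\<omega> \<in> space M. q \<in> stop_set \<omega>} = {\<omega> \<in> space (F q). x0 < running_max B q \<omega> \<and>
      B q \<omega> < (\<lambda>m. if m \<in> {x0<..} then \<zeta> m else 0) (running_max B q \<omega>)}"
    using q by (auto simp: stop_set_def below_barrier_def running_max_eq_path_max B_0)
  also have "\<dots> \<in> sets (F q)" by measurable
  finally show ?thesis .
qed

lemma stop_set_persists: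
  assumes "\<omega> \<in> space M" "s \<in> stop_set \<omega>" "s < v"
  shows "\<exists>q\<in>\<rat>. s < q \<and> q < v \<and> q \<in> stop_set \<omega>"
  using barrier_path.below_barrier_persists[OF barrier_path_B] assms by (simp add: stop_set_def)

lemma stop_set_nonneg: "s \<in> stop_set \<omega> \<Longrightarrow> 0 \<le> s"
  by (simp add: stop_set_def below_barrier_def)

lemma optional_stop_time: "0 \<le> u \<Longrightarrow> optional_time u (stop_time u)"
  unfolding stop_time_def
  by (rule optional_time_debut) (use stop_set_persists stop_set_adapted in auto)

lemma stop_time_bounds: "0 \<le> u \<Longrightarrow> 0 \<le> stop_time u \<omega>" "0 \<le> u \<Longrightarrow> stop_time u \<omega> \<le> u"
  unfolding stop_time_def using debut_bounds by auto

lemma stop_time_min: "0 \<le> s \<Longrightarrow> s \<le> u \<Longrightarrow> stop_time s \<omega> = min s (stop_time u \<omega>)"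
  unfolding stop_time_def by (rule debut_min)

lemma measurable_stopped_B_F: "0 \<le> u \<Longrightarrow> stopped_B u \<in> borel_measurable (F u)"
  unfolding stopped_B_def by (rule measurable_stopped[OF optional_stop_time])

lemma integrable_stopped_B: "0 \<le> u \<Longrightarrow> integrable M (stopped_B u)"
  and expectation_stopped_B: "0 \<le> u \<Longrightarrow> (\<integral>\<omega>. stopped_B u \<omega> \<partial>M) = x0"
  unfolding stopped_B_def using integrable_stopped expectation_stopped optional_stop_time by blast+

lemma measurable_stopped_B [measurable]: "0 \<le> u \<Longrightarrow> stopped_B u \<in> borel_measurable M"
  using integrable_stopped_B by auto

lemma stopped_B_martingale:
  assumes "0 \<le> s" "s \<le> u" "A \<in> sets (F s)"
  shows "(\<integral>\<omega>. stopped_B u \<omega> * indicator A \<omega> \<partial>M) = (\<integral>\<omega>. stopped_B s \<omega> * indicator A \<omega> \<partial>M)"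
  using stopped_martingale[OF optional_stop_time assms(1,2,3)] assms
  by (simp add: stopped_B_def stop_time_min[OF assms(1,2)])

lemma stopped_max_eq_path_max: "stopped_max u \<omega> = path_max (\<lambda>t. B t \<omega>) (stop_time u \<omega>)"
  by (simp add: stopped_max_def running_max_eq_path_max)

lemma less_stopped_max_iff:
  "\<omega> \<in> space M \<Longrightarrow> 0 \<le> u \<Longrightarrow> c < stopped_max u \<omega> \<longleftrightarrow> (\<exists>s\<in>{0..stop_time u \<omega>}. c < B s \<omega>)"
  unfolding stopped_max_eq_path_max
  by (rule continuous_path.less_path_max_iff[OF continuous_path_B]) (auto simp: stop_time_bounds)

text \<open>The maximum of \<open>B\<close> up to the random stopping time is the maximum of the stopped process up to the fixed
  time \<open>u\<close>, which is a measurable quantity.\<close>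

lemma less_stopped_max_iff_stopped_B:
  assumes \<omega>: "\<omega> \<in> space M" and u: "0 \<le> u"
  shows "c < stopped_max u \<omega> \<longleftrightarrow> (\<exists>s\<in>{0..u}. c < stopped_B s \<omega>)"
  unfolding less_stopped_max_iff[OF assms] stopped_B_def
proof (intro iffI; elim bexE)
  fix s assume s: "s \<in> {0..stop_time u \<omega>}" "c < B s \<omega>"
  then have "stop_time s \<omega> = s" using stop_time_bounds(2)[OF u, of \<omega>] by (simp add: stop_time_min[of s u])
  then show "\<exists>s\<in>{0..u}. c < B (stop_time s \<omega>) \<omega>"
    using s stop_time_bounds(2)[OF u, of \<omega>] by (intro bexI[of _ s]) auto
next
  fix s assume s: "s \<in> {0..u}" "c < B (stop_time s \<omega>) \<omega>"
  then show "\<exists>s\<in>{0..stop_time u \<omega>}. c < B s \<omega>"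
    using stop_time_bounds[of s \<omega>] stop_time_bounds[OF u, of \<omega>]
    by (intro bexI[of _ "stop_time s \<omega>"]) (auto simp: stop_time_min[of s u])
qed

lemma measurable_stopped_max [measurable]:
  assumes u: "0 \<le> u"
  shows "stopped_max u \<in> borel_measurable M"
  unfolding borel_measurable_iff_greater
proof
  fix c
  have "{\<omega> \<in> space M. c < stopped_max u \<omega>} = {\<omega> \<in> space M. \<exists>s\<in>{0..u}. c < stopped_B s \<omega>}"
    using less_stopped_max_iff_stopped_B[OF _ u] by blast
  also have "\<dots> \<in> sets M"
  proof (rule sets_exceeds)
    fix \<omega> r assume \<omega>: "\<omega> \<in> space M" and r: "0 \<le> r" "r < u"
    have "continuous_on {0..u} (\<lambda>s. B (min s (stop_time u \<omega>)) \<omega>)"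
      using stop_time_bounds[OF u, of \<omega>]
      by (intro continuous_on_compose2[OF continuous_B[OF \<omega>]] continuous_intros) auto
    moreover have "stopped_B s \<omega> = B (min s (stop_time u \<omega>)) \<omega>" if "s \<in> {0..u}" for s
      using stop_time_min[of s u \<omega>] that by (simp add: stopped_B_def)
    ultimately have "continuous_on {0..u} (\<lambda>s. stopped_B s \<omega>)"
      by (subst continuous_on_cong[OF refl]) auto
    then have "((\<lambda>s. stopped_B s \<omega>) \<longlongrightarrow> stopped_B r \<omega>) (at r within {0..u})" using r by (auto simp: continuous_on_def)
    then have "((\<lambda>s. stopped_B s \<omega>) \<longlongrightarrow> stopped_B r \<omega>) (at r within {r..u})"
      by (rule tendsto_within_subset) (use r in auto)
    then show "continuous (at_right r) (\<lambda>s. stopped_B s \<omega>)"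
      unfolding continuous_within at_within_Icc_at_right[OF r(2)] .
  qed (auto intro: measurable_stopped_B)
  finally show "{\<omega> \<in> space M. c < stopped_max u \<omega>} \<in> sets M" .
qed

lemma x0_le_stopped_max: "\<omega> \<in> space M \<Longrightarrow> 0 \<le> u \<Longrightarrow> x0 \<le> stopped_max u \<omega>"
  using continuous_path.le_path_max[OF continuous_path_B, of \<omega> 0 "stop_time u \<omega>"] stop_time_bounds[of u \<omega>]
  by (simp add: stopped_max_eq_path_max B_0)

lemma stopped_B_le_stopped_max: "\<omega> \<in> space M \<Longrightarrow> 0 \<le> u \<Longrightarrow> stopped_B u \<omega> \<le> stopped_max u \<omega>"
  using continuous_path.le_path_max[OF continuous_path_B, of \<omega> "stop_time u \<omega>" "stop_time u \<omega>"]
    stop_time_bounds[of u \<omega>]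
  by (simp add: stopped_max_eq_path_max stopped_B_def)

lemma barrier_le_stopped_B:
  assumes \<omega>: "\<omega> \<in> space M" and u: "0 \<le> u" and c: "x0 < c" "c \<le> stopped_max u \<omega>"
  shows "\<zeta> c \<le> stopped_B u \<omega>"
  unfolding stopped_B_def
proof (rule barrier_path.barrier_le_stopped[OF barrier_path_B[OF \<omega>]])
  fix s assume s: "s \<in> below_barrier \<zeta> (\<lambda>t. B t \<omega>)"
  then show "stop_time u \<omega> \<le> s"
    using debut_less_iff[OF u debut_bounds(2)[OF u], of "stop_set \<omega>" "stop_set \<omega>"]
      stop_set_nonneg[of s \<omega>]
    unfolding stop_time_def stop_set_def by (auto simp: not_less[symmetric])
qed (use c stop_time_bounds(1)[OF u] in \<open>auto simp: stopped_max_eq_path_max B_0[OF \<omega>]\<close>)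

lemma integrable_stopped_B_indicator:
  assumes "0 \<le> u" "A \<in> sets M"
  shows "integrable M (\<lambda>\<omega>. (c - stopped_B u \<omega>) * indicator A \<omega>)" "integrable M (\<lambda>\<omega>. (stopped_B u \<omega> - c) * indicator A \<omega>)"
  using integrable_mult_indicator[OF assms(2), of "\<lambda>\<omega>. c - stopped_B u \<omega>"]
    integrable_mult_indicator[OF assms(2), of "\<lambda>\<omega>. stopped_B u \<omega> - c"]
    integrable_stopped_B[OF assms(1)]
  by (auto simp: mult.commute)

lemma sets_stopped_max_greater: "0 \<le> u \<Longrightarrow> {\<omega> \<in> space M. m < stopped_max u \<omega>} \<in> sets M"
  by (rule borel_measurable_iff_greater[THEN iffD1, rule_format]) (rule measurable_stopped_max)

text \<open>Stopping additionally at the first passage over \<open>m\<close> does not change the expectation, and replaces the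
  stopped value by \<open>m\<close> exactly on the event that the maximum exceeds \<open>m\<close>.\<close>

lemma expectation_above_level:
  assumes u: "0 \<le> u" and m: "x0 < m"
  shows "(\<integral>\<omega>. (m - stopped_B u \<omega>) * indicator {\<omega> \<in> space M. m < stopped_max u \<omega>} \<omega> \<partial>M) = 0"
proof -
  define D where "D \<omega> = stop_set \<omega> \<union> {s. m < B s \<omega>}" for \<omega>
  have opt: "optional_time u (\<lambda>\<omega>. debut u (D \<omega>))"
  proof (rule optional_time_debut[OF u])
    fix \<omega> s v assume \<omega>: "\<omega> \<in> space M" and s: "0 \<le> s" "s \<in> D \<omega>" "s < v"
    show "\<exists>q\<in>\<rat>. s < q \<and> q < v \<and> q \<in> D \<omega>"
    proof (cases "s \<in> stop_set \<omega>")
      case True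
      then show ?thesis using stop_set_persists[OF \<omega> True s(3)] by (auto simp: D_def)
    next
      case False
      then have "m < B s \<omega>" using s by (auto simp: D_def)
      then have "\<forall>\<^sub>F q in at_right s. m < B q \<omega>"
        by (rule order_tendstoD(1)[OF continuous_path.right_tendsto[OF continuous_path_B[OF \<omega>] s(1)]])
      then obtain e where e: "s < e" "\<And>q. s < q \<Longrightarrow> q < e \<Longrightarrow> m < B q \<omega>"
        unfolding eventually_at_right_field by auto
      obtain q where "q \<in> \<rat>" "s < q" "q < min e v"
        using Rats_dense_in_real[of s "min e v"] e s by auto
      then show ?thesis using e(2)[of q] by (intro bexI[of _ q]) (auto simp: D_def)
    qed
  next
    fix q :: real assume q: "0 \<le> q"
    note [measurable] = measurable_B[OF q order_refl]
    have "{\<omega> \<in> space (F q). m < B q \<omega>} \<in> sets (F q)" by measurable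
    moreover have "{\<omega> \<in> space M. q \<in> D \<omega>} = {\<omega> \<in> space M. q \<in> stop_set \<omega>} \<union> {\<omega> \<in> space (F q). m < B q \<omega>}"
      using q by (auto simp: D_def)
    ultimately show "{\<omega> \<in> space M. q \<in> D \<omega>} \<in> sets (F q)" using stop_set_adapted[OF q] by auto
  qed
  have "B (debut u (D \<omega>)) \<omega> = (if m < stopped_max u \<omega> then m else stopped_B u \<omega>)" if "\<omega> \<in> space M" for \<omega>
    using continuous_path.debut_with_level[OF continuous_path_B[OF that] u, of m "stop_set \<omega>"] m that
    by (simp add: D_def stopped_max_eq_path_max stopped_B_def stop_time_def B_0)
  then have eq: "(m - stopped_B u \<omega>) * indicator {\<omega> \<in> space M. m < stopped_max u \<omega>} \<omega> = B (debut u (D \<omega>)) \<omega> - stopped_B u \<omega>"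
    if "\<omega> \<in> space M" for \<omega> using that by (simp add: indicator_def)
  have "(\<integral>\<omega>. (m - stopped_B u \<omega>) * indicator {\<omega> \<in> space M. m < stopped_max u \<omega>} \<omega> \<partial>M)
      = (\<integral>\<omega>. B (debut u (D \<omega>)) \<omega> - stopped_B u \<omega> \<partial>M)"
    by (intro Bochner_Integration.integral_cong refl eq)
  also have "\<dots> = 0"
    using integrable_stopped[OF opt u] expectation_stopped[OF opt u] integrable_stopped_B[OF u] expectation_stopped_B[OF u]
    by simp
  finally show ?thesis .
qed

text \<open>The same identity in terms of probabilities: having exceeded \<open>m\<close>, the stopped process has conditional
  mean \<open>m\<close>.\<close>

lemma expectation_above_level':
  assumes u: "0 \<le> u" and m: "x0 < m"
  shows "(\<integral>\<omega>. (stopped_B u \<omega> - c) * indicator {\<omega> \<in> space M. m < stopped_max u \<omega>} \<omega> \<partial>M)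
    = (m - c) * prob {\<omega> \<in> space M. m < stopped_max u \<omega>}"
proof -
  let ?A = "{\<omega> \<in> space M. m < stopped_max u \<omega>}"
  note A = sets_stopped_max_greater[OF u, of m]
  have "(\<integral>\<omega>. (stopped_B u \<omega> - c) * indicator ?A \<omega> \<partial>M) = (\<integral>\<omega>. (m - c) * indicator ?A \<omega> - (m - stopped_B u \<omega>) * indicator ?A \<omega> \<partial>M)"
    by (intro Bochner_Integration.integral_cong) (auto simp: indicator_def)
  also have "\<dots> = (m - c) * prob ?A - (\<integral>\<omega>. (m - stopped_B u \<omega>) * indicator ?A \<omega> \<partial>M)"
    using integrable_stopped_B_indicator(1)[OF u A] integrable_const_indicator[OF A]
    by (subst Bochner_Integration.integral_diff) (use A in auto)
  finally show ?thesis using expectation_above_level[OF assms] by simp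
qed

text \<open>While the stopped process is below \<open>\<zeta> m\<close>, the maximum cannot have passed \<open>m\<close>. The integral of \<open>m\<close> minus
  the stopped process over the event that it has not is \<open>m - x0\<close>. The bound is small for \<open>m\<close> near \<open>x0\<close>, uniformly in \<open>u\<close>.\<close>

lemma expectation_below_barrier:
  assumes u: "0 \<le> u" and m: "x0 < m"
  shows "(\<integral>\<omega>. max 0 (\<zeta> m - stopped_B u \<omega>) \<partial>M) \<le> m - x0"
proof -
  let ?A = "{\<omega> \<in> space M. m < stopped_max u \<omega>}"
  note A = sets_stopped_max_greater[OF u, of m]
  have "(\<integral>\<omega>. max 0 (\<zeta> m - stopped_B u \<omega>) \<partial>M) \<le> (\<integral>\<omega>. (m - stopped_B u \<omega>) - (m - stopped_B u \<omega>) * indicator ?A \<omega> \<partial>M)"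
  proof (intro integral_mono)
    show "integrable M (\<lambda>\<omega>. max 0 (\<zeta> m - stopped_B u \<omega>))"
      using integrable_stopped_B[OF u] by (intro integrable_max) auto
    show "integrable M (\<lambda>\<omega>. (m - stopped_B u \<omega>) - (m - stopped_B u \<omega>) * indicator ?A \<omega>)"
      using integrable_stopped_B_indicator(1)[OF u A] integrable_stopped_B[OF u] by auto
    fix \<omega> assume \<omega>: "\<omega> \<in> space M"
    show "max 0 (\<zeta> m - stopped_B u \<omega>) \<le> (m - stopped_B u \<omega>) - (m - stopped_B u \<omega>) * indicator ?A \<omega>"
    proof (cases "m < stopped_max u \<omega>")
      case True
      then show ?thesis using barrier_le_stopped_B[OF \<omega> u m] \<omega> by simp
    next
      case False
      then show ?thesis using stopped_B_le_stopped_max[OF \<omega> u] less[OF m] by (auto simp: indicator_def)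
    qed
  qed
  also have "\<dots> = m - x0"
    using integrable_stopped_B_indicator(1)[OF u A] integrable_stopped_B[OF u] expectation_stopped_B[OF u]
      expectation_above_level[OF assms] by (simp add: prob_space)
  finally show ?thesis .
qed

text \<open>Once the maximum has passed \<open>m0\<close>, the stopped process is at least \<open>\<alpha>\<close> times its maximum, whereas its
  integral over this event is \<open>m0\<close> times the probability.\<close>

lemma
  assumes u: "0 \<le> u"
  shows integrable_stopped_max_tail: "integrable M (\<lambda>\<omega>. stopped_max u \<omega> * indicator {\<omega> \<in> space M. m0 < stopped_max u \<omega>} \<omega>)" (is ?i)
    and expectation_stopped_max_tail: "(\<integral>\<omega>. stopped_max u \<omega> * indicator {\<omega> \<in> space M. m0 < stopped_max u \<omega>} \<omega> \<partial>M) \<le> m0 / \<alpha>" (is ?e)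
proof -
  let ?A = "{\<omega> \<in> space M. m0 < stopped_max u \<omega>}"
  note A = sets_stopped_max_greater[OF u, of m0]
  have le: "stopped_max u \<omega> * indicator ?A \<omega> \<le> (stopped_B u \<omega> - 0) * indicator ?A \<omega> / \<alpha>"
    if \<omega>: "\<omega> \<in> space M" for \<omega>
    using barrier_le_stopped_B[OF \<omega> u, of "stopped_max u \<omega>"] growth[of "stopped_max u \<omega>"] m0 \<alpha>
    by (auto simp: indicator_def field_simps)
  show i: ?i
  proof (rule Bochner_Integration.integrable_bound)
    show "integrable M (\<lambda>\<omega>. (stopped_B u \<omega> - 0) * indicator ?A \<omega> / \<alpha>)"
      using integrable_stopped_B_indicator(2)[OF u A, of 0] by simp
    show "AE \<omega> in M. norm (stopped_max u \<omega> * indicator ?A \<omega>) \<le> norm ((stopped_B u \<omega> - 0) * indicator ?A \<omega> / \<alpha>)"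
    proof (rule AE_I2)
      fix \<omega> assume \<omega>: "\<omega> \<in> space M"
      have "0 \<le> stopped_max u \<omega> * indicator ?A \<omega>" using m0 by (auto simp: indicator_def)
      then show "norm (stopped_max u \<omega> * indicator ?A \<omega>) \<le> norm ((stopped_B u \<omega> - 0) * indicator ?A \<omega> / \<alpha>)"
        using le[OF \<omega>] by (simp only: real_norm_def abs_of_nonneg order_trans)
    qed
  qed (use A u in measurable)
  have "(\<integral>\<omega>. stopped_max u \<omega> * indicator ?A \<omega> \<partial>M) \<le> (\<integral>\<omega>. (stopped_B u \<omega> - 0) * indicator ?A \<omega> / \<alpha> \<partial>M)"
    by (intro integral_mono i le) (use integrable_stopped_B_indicator(2)[OF u A, of 0] in auto)
  also have "\<dots> = (m0 - 0) * prob ?A / \<alpha>"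
    using expectation_above_level'[OF u m0(2), of 0] by simp
  also have "\<dots> \<le> m0 / \<alpha>"
    using m0 \<alpha> by (intro divide_right_mono) (auto intro: mult_left_le)
  finally show ?e .
qed

text \<open>The positive part is bounded by the maximum, and a variable with mean zero has an absolute mean
  twice that of its positive part.\<close>

lemma expectation_abs_stopped_B:
  assumes u: "0 \<le> u"
  shows "(\<integral>\<omega>. \<bar>stopped_B u \<omega> - x0\<bar> \<partial>M) \<le> 2 * (m0 + m0 / \<alpha> + \<bar>x0\<bar>)"
proof -
  let ?A = "{\<omega> \<in> space M. m0 < stopped_max u \<omega>}"
  note iA = integrable_stopped_max_tail[OF u]
  have i: "integrable M (\<lambda>\<omega>. max 0 (stopped_B u \<omega> - x0))"
    using integrable_stopped_B[OF u] by (intro integrable_max) auto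
  have "(\<integral>\<omega>. max 0 (stopped_B u \<omega> - x0) \<partial>M) \<le> (\<integral>\<omega>. (m0 + \<bar>x0\<bar>) + stopped_max u \<omega> * indicator ?A \<omega> \<partial>M)"
  proof (intro integral_mono i)
    fix \<omega> assume \<omega>: "\<omega> \<in> space M"
    then show "max 0 (stopped_B u \<omega> - x0) \<le> (m0 + \<bar>x0\<bar>) + stopped_max u \<omega> * indicator ?A \<omega>"
      using stopped_B_le_stopped_max[OF \<omega> u] m0 by (auto simp: indicator_def)
  qed (use iA in auto)
  also have "\<dots> \<le> m0 + \<bar>x0\<bar> + m0 / \<alpha>"
    using iA expectation_stopped_max_tail[OF u] by (simp add: prob_space)
  finally have "(\<integral>\<omega>. max 0 (stopped_B u \<omega> - x0) \<partial>M) \<le> m0 + \<bar>x0\<bar> + m0 / \<alpha>" .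
  moreover have "(\<integral>\<omega>. \<bar>stopped_B u \<omega> - x0\<bar> \<partial>M) = (\<integral>\<omega>. 2 * max 0 (stopped_B u \<omega> - x0) - (stopped_B u \<omega> - x0) \<partial>M)"
    by (intro Bochner_Integration.integral_cong) (auto simp: max_def abs_if)
  moreover have "\<dots> = 2 * (\<integral>\<omega>. max 0 (stopped_B u \<omega> - x0) \<partial>M)"
    using i integrable_stopped_B[OF u] expectation_stopped_B[OF u] by (simp add: prob_space)
  ultimately show ?thesis by simp
qed

end

section \<open>The terminal value\<close>

context barrier_brownian
begin

definition hits :: "'a set" where
  "hits = {\<omega> \<in> space M. stop_set \<omega> \<noteq> {}}"

definition hit_time :: "'a \<Rightarrow> real" where
  "hit_time \<omega> = Inf (stop_set \<omega>)"

text \<open>Outside \<open>hits\<close>, which is a null event, the starting value serves as default, so that every path of the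
  process built below is continuous and starts in \<open>x0\<close>.\<close>

definition terminal_value :: "'a \<Rightarrow> real" where
  "terminal_value \<omega> = (if \<omega> \<in> hits then B (hit_time \<omega>) \<omega> else x0)"

definition terminal_max :: "'a \<Rightarrow> real" where
  "terminal_max \<omega> = (if \<omega> \<in> hits then running_max B (hit_time \<omega>) \<omega> else x0)"

lemma hits_space: "\<omega> \<in> hits \<Longrightarrow> \<omega> \<in> space M"
  by (simp add: hits_def)

lemma hit_time_less_iff: "\<omega> \<in> hits \<Longrightarrow> hit_time \<omega> < v \<longleftrightarrow> (\<exists>s\<in>stop_set \<omega>. s < v)"
  unfolding hit_time_def hits_def
  by (rule cInf_less_iff) (auto intro!: bdd_belowI[of _ 0] stop_set_nonneg)

lemma hit_time_nonneg: "\<omega> \<in> hits \<Longrightarrow> 0 \<le> hit_time \<omega>"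
  using hit_time_less_iff[of \<omega> 0] stop_set_nonneg[of _ \<omega>] by (auto simp: not_less[symmetric])

lemma stop_time_eq_min:
  assumes "\<omega> \<in> hits" "0 \<le> u"
  shows "stop_time u \<omega> = min u (hit_time \<omega>)"
proof (rule antisym)
  show "stop_time u \<omega> \<le> min u (hit_time \<omega>)"
    using debut_less_iff[OF assms(2), of "stop_time u \<omega>" "stop_set \<omega>"] stop_time_bounds[OF assms(2), of \<omega>]
      hit_time_less_iff[OF assms(1), of "stop_time u \<omega>"] stop_set_nonneg[of _ \<omega>]
    by (auto simp: stop_time_def simp flip: not_less)
  show "min u (hit_time \<omega>) \<le> stop_time u \<omega>"
    using debut_less_iff[OF assms(2), of "min u (hit_time \<omega>)" "stop_set \<omega>"]
      hit_time_less_iff[OF assms(1), of "hit_time \<omega>"]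
    by (auto simp: stop_time_def simp flip: not_less)
qed

text \<open>Limits in time are trivial pathwise: the stopped path is constant after the hitting time.\<close>

lemma eventually_stopped:
  assumes "\<omega> \<in> hits"
  shows "\<forall>\<^sub>F k :: nat in sequentially. stopped_B k \<omega> = terminal_value \<omega> \<and> stopped_max k \<omega> = terminal_max \<omega>"
proof -
  obtain N :: nat where "hit_time \<omega> \<le> N" using real_arch_simple by blast
  then have "stop_time k \<omega> = hit_time \<omega>" if "N \<le> k" for k :: nat
    using stop_time_eq_min[OF assms, of k] that by auto
  then show ?thesis
    using assms by (intro eventually_sequentiallyI[of N]) (auto simp: stopped_B_def terminal_value_def stopped_max_def terminal_max_def)
qed

lemma stopped_max_le_terminal_max:
  assumes "\<omega> \<in> hits" "0 \<le> u"
  shows "stopped_max u \<omega> \<le> terminal_max \<omega>"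
  using continuous_path.path_max_mono[OF continuous_path_B[OF hits_space[OF assms(1)]],
      of "stop_time u \<omega>" "hit_time \<omega>"] assms stop_time_bounds[OF assms(2), of \<omega>] stop_time_eq_min[OF assms]
  by (simp add: stopped_max_eq_path_max terminal_max_def running_max_eq_path_max)

lemma terminal_value_le_terminal_max: "\<omega> \<in> hits \<Longrightarrow> terminal_value \<omega> \<le> terminal_max \<omega>"
  using continuous_path.le_path_max[OF continuous_path_B[OF hits_space], of \<omega> "hit_time \<omega>" "hit_time \<omega>"]
    hit_time_nonneg[of \<omega>]
  by (simp add: terminal_value_def terminal_max_def running_max_eq_path_max)

lemma barrier_le_terminal_value:
  assumes \<omega>: "\<omega> \<in> hits" and c: "x0 < c" "c \<le> terminal_max \<omega>"
  shows "\<zeta> c \<le> terminal_value \<omega>"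
proof -
  obtain k :: nat where "stopped_B k \<omega> = terminal_value \<omega>" "stopped_max k \<omega> = terminal_max \<omega>"
    using eventually_happens[OF eventually_stopped[OF \<omega>]] by auto
  then show ?thesis using barrier_le_stopped_B[OF hits_space[OF \<omega>], of k c] c by simp
qed

lemma terminal_value_le_barrier:
  assumes \<omega>: "\<omega> \<in> hits" and c: "x0 < c" "terminal_max \<omega> \<le> c"
  shows "terminal_value \<omega> \<le> \<zeta> c"
proof -
  note path = barrier_path_B[OF hits_space[OF \<omega>]]
  have "B (hit_time \<omega>) \<omega> \<le> \<zeta> c"
  proof (rule barrier_path.stopped_le_barrier[OF path hit_time_nonneg[OF \<omega>]])
    fix v assume "hit_time \<omega> < v"
    then obtain s where "s \<in> stop_set \<omega>" "s < v" using hit_time_less_iff[OF \<omega>] by auto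
    moreover have "hit_time \<omega> \<le> s"
      using hit_time_less_iff[OF \<omega>, of "hit_time \<omega>"] \<open>s \<in> stop_set \<omega>\<close> by (auto simp: not_less[symmetric])
    ultimately show "\<exists>s\<in>below_barrier \<zeta> (\<lambda>t. B t \<omega>). hit_time \<omega> \<le> s \<and> s < v"
      by (auto simp: stop_set_def)
  qed (use c \<omega> right_cont in \<open>auto simp: B_0 hits_space terminal_max_def running_max_eq_path_max\<close>)
  then show ?thesis using \<omega> by (simp add: terminal_value_def)
qed

lemma sets_stopped_before: "{\<omega> \<in> space M. stop_time (Suc k) \<omega> < Suc k} \<in> sets M"
proof (rule sets_F[of "Suc k"])
  show "{\<omega> \<in> space M. stop_time (Suc k) \<omega> < Suc k} \<in> sets (F (Suc k))"
    using optional_stop_time[of "Suc k"] by (auto simp: optional_time_def)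
qed simp

lemma not_stopped_before:
  assumes "\<omega> \<in> space M - hits" "0 \<le> u"
  shows "stop_time u \<omega> = u"
  using debut_less_iff[OF assms(2) order_refl, of "stop_set \<omega>"] stop_time_bounds[OF assms(2), of \<omega>] assms
  by (auto simp: stop_time_def hits_def)

lemma sets_hits [measurable]: "hits \<in> sets M"
proof -
  have "hits = (\<Union>k. {\<omega> \<in> space M. stop_time (Suc k) \<omega> < Suc k})"
  proof (intro set_eqI iffI)
    fix \<omega> assume \<omega>: "\<omega> \<in> hits"
    then obtain k :: nat where "hit_time \<omega> < k" using reals_Archimedean2 by blast
    then show "\<omega> \<in> (\<Union>k. {\<omega> \<in> space M. stop_time (Suc k) \<omega> < Suc k})"
      using stop_time_eq_min[OF \<omega>, of "Suc k"] hits_space[OF \<omega>] by (intro UN_I[of k]) auto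
  next
    fix \<omega> assume "\<omega> \<in> (\<Union>k. {\<omega> \<in> space M. stop_time (Suc k) \<omega> < Suc k})"
    then show "\<omega> \<in> hits" using not_stopped_before[of \<omega>] by force
  qed
  then show ?thesis using sets_stopped_before by auto
qed

text \<open>On paths that are never stopped, the stopped process is Brownian motion. The former is bounded in
  \<open>L\<^sup>1\<close>, the latter spreads out, so such paths have probability zero.\<close>

lemma prob_not_hits: "prob (space M - hits) = 0"
proof -
  define C where "C = 2 * (m0 + m0 / \<alpha> + \<bar>x0\<bar>)"
  have le: "prob (space M - hits) \<le> C / K" if K: "0 < K" for K
  proof (rule LIMSEQ_le_const)
    have "(\<lambda>k. 2 * K / sqrt (2 * pi * real (Suc k))) \<longlonglongrightarrow> 0"
      by (intro tendsto_divide_0[OF tendsto_const] filterlim_at_top_imp_at_infinity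
          filterlim_compose[OF sqrt_at_top] filterlim_tendsto_pos_mult_at_top[OF tendsto_const]
          filterlim_compose[OF filterlim_real_sequentially filterlim_Suc]) auto
    from tendsto_add[OF this tendsto_const, of "C / K"] show "(\<lambda>k. 2 * K / sqrt (2 * pi * real (Suc k)) + C / K) \<longlonglongrightarrow> C / K" by simp
    show "\<exists>N. \<forall>k\<ge>N. prob (space M - hits) \<le> 2 * K / sqrt (2 * pi * real (Suc k)) + C / K"
    proof (intro exI allI impI)
      fix k :: nat
      let ?N = "{\<omega> \<in> space M. \<bar>B (Suc k) \<omega> - x0\<bar> \<le> K}"
      let ?L = "{\<omega> \<in> space M. K \<le> \<bar>stopped_B (Suc k) \<omega> - x0\<bar>}"
      have [measurable]: "B (real (Suc k)) \<in> borel_measurable M" "stopped_B (real (Suc k)) \<in> borel_measurable M"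
        by simp_all
      have "space M - hits \<subseteq> ?N \<union> ?L"
        using not_stopped_before[of _ "real (Suc k)"] by (force simp: stopped_B_def)
      then have "prob (space M - hits) \<le> prob (?N \<union> ?L)"
        by (rule finite_measure_mono) measurable
      also have "\<dots> \<le> prob ?N + prob ?L" by (rule measure_Un_le) measurable
      also have "prob ?N \<le> 2 * K / sqrt (2 * pi * real (Suc k))"
        by (rule prob_B_near_le) (use K in auto)
      also have "prob ?L \<le> (\<integral>\<omega>. \<bar>stopped_B (Suc k) \<omega> - x0\<bar> \<partial>M) / K"
        by (rule integral_Markov_inequality_measure[where A = "{}"])
           (use integrable_stopped_B[of "real (Suc k)"] K in auto)
      also have "\<dots> \<le> C / K"
        using expectation_abs_stopped_B[of "real (Suc k)"] K by (intro divide_right_mono) (auto simp: C_def)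
      finally show "prob (space M - hits) \<le> 2 * K / sqrt (2 * pi * real (Suc k)) + C / K" by simp
    qed
  qed
  have "(\<lambda>k. C / real (Suc k)) \<longlonglongrightarrow> 0" by (rule LIMSEQ_Suc[OF lim_const_over_n])
  then have "prob (space M - hits) \<le> 0"
    by (rule LIMSEQ_le_const) (use le in auto)
  then show ?thesis by (simp add: measure_le_0_iff)
qed

lemma AE_hits: "AE \<omega> in M. \<omega> \<in> hits"
  using prob_not_hits by (intro AE_I[of _ _ "space M - hits"]) (auto simp: emeasure_eq_measure)

lemma lim_stopped_B: "AE \<omega> in M. (\<lambda>k. stopped_B (real k) \<omega>) \<longlonglongrightarrow> terminal_value \<omega>"
  using AE_hits
proof eventually_elim
  case (elim \<omega>)
  show ?case
    by (rule tendsto_eventually, rule eventually_mono[OF eventually_stopped[OF elim]]) simp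
qed

lemma measurable_terminal_value [measurable]: "terminal_value \<in> borel_measurable M"
  and measurable_terminal_max [measurable]: "terminal_max \<in> borel_measurable M"
proof -
  have [measurable]: "stopped_B (real k) \<in> borel_measurable M" "stopped_max (real k) \<in> borel_measurable M" for k by simp_all
  show "terminal_value \<in> borel_measurable M"
  proof (rule borel_measurable_LIMSEQ_real)
    show "(\<lambda>k. if \<omega> \<in> hits then stopped_B (real k) \<omega> else x0) \<longlonglongrightarrow> terminal_value \<omega>" for \<omega>
    proof (cases "\<omega> \<in> hits")
      case True
      then show ?thesis
        using eventually_stopped[OF True] by (auto intro!: tendsto_eventually elim!: eventually_mono)
    qed (simp add: terminal_value_def)
  qed measurable
  show "terminal_max \<in> borel_measurable M"
  proof (rule borel_measurable_LIMSEQ_real)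
    show "(\<lambda>k. if \<omega> \<in> hits then stopped_max (real k) \<omega> else x0) \<longlonglongrightarrow> terminal_max \<omega>" for \<omega>
    proof (cases "\<omega> \<in> hits")
      case True
      then show ?thesis
        using eventually_stopped[OF True] by (auto intro!: tendsto_eventually elim!: eventually_mono)
    qed (simp add: terminal_max_def)
  qed measurable
qed

text \<open>The uniform bound on the tail of the maximum survives the limit by Fatou's lemma.\<close>

lemma integrable_terminal_max: "integrable M terminal_max"
proof -
  let ?f = "\<lambda>k \<omega>. stopped_max (real k) \<omega> * indicator {\<omega> \<in> space M. m0 < stopped_max (real k) \<omega>} \<omega>"
  let ?g = "\<lambda>\<omega>. terminal_max \<omega> * indicator {\<omega> \<in> space M. m0 < terminal_max \<omega>} \<omega>"
  have "integrable M ?g"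
  proof (rule integral_le_of_tendsto[where f = ?f and C = "m0 / \<alpha>"])
    show "AE \<omega> in M. (\<lambda>k. ?f k \<omega>) \<longlonglongrightarrow> ?g \<omega>"
      using AE_hits
      by eventually_elim (intro tendsto_eventually eventually_mono[OF eventually_stopped], auto simp: indicator_def)
  qed (use integrable_stopped_max_tail expectation_stopped_max_tail m0 in \<open>auto simp: indicator_def\<close>)
  then have "integrable M (\<lambda>\<omega>. m0 + \<bar>x0\<bar> + ?g \<omega>)" by simp
  then show ?thesis
  proof (rule Bochner_Integration.integrable_bound)
    show "AE \<omega> in M. norm (terminal_max \<omega>) \<le> norm (m0 + \<bar>x0\<bar> + ?g \<omega>)"
      using AE_hits
    proof eventually_elim
      case (elim \<omega>)
      have "x0 \<le> terminal_max \<omega>"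
        using stopped_max_le_terminal_max[OF elim, of 0] x0_le_stopped_max[OF hits_space[OF elim], of 0] by simp
      then show ?case using m0 hits_space[OF elim] by (auto simp: indicator_def)
    qed
  qed simp
qed

text \<open>Uniform integrability by hand. Raising the stopped process to at least \<open>c = \<zeta> (x0 + \<delta>)\<close> changes
  its expectations by at most \<open>\<delta>\<close> at all times, and the raised process is dominated by
  the integrable terminal maximum. Letting \<open>\<delta>\<close> tend to \<open>0\<close> transfers the martingale property to the limit.\<close>

lemma expectation_terminal_value_on_set:
  assumes s: "0 \<le> s" and A: "A \<in> sets (F s)"
  shows "integrable M terminal_value" "(\<integral>\<omega>. terminal_value \<omega> * indicator A \<omega> \<partial>M) = (\<integral>\<omega>. stopped_B s \<omega> * indicator A \<omega> \<partial>M)"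
proof -
  have AM [measurable]: "A \<in> sets M" using sets_F s A by auto
  have iA: "integrable M (\<lambda>\<omega>. f \<omega> * indicator A \<omega>)" if "integrable M f" for f :: "'a \<Rightarrow> real"
    using integrable_mult_indicator[OF AM that] by (simp add: mult.commute)
  have mZ [measurable]: "stopped_B (real k) \<in> borel_measurable M" for k by simp
  have iZ: "integrable M (stopped_B (real k))" for k by (rule integrable_stopped_B) simp
  have *: "integrable M terminal_value \<and>
      \<bar>(\<integral>\<omega>. terminal_value \<omega> * indicator A \<omega> \<partial>M) - (\<integral>\<omega>. stopped_B s \<omega> * indicator A \<omega> \<partial>M)\<bar> \<le> 2 * \<delta>" if \<delta>: "0 < \<delta>" for \<delta>
  proof -
    define c where "c = \<zeta> (x0 + \<delta>)"
    have m: "x0 < x0 + \<delta>" using \<delta> by simp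
    have low: "(\<integral>\<omega>. max 0 (c - stopped_B (real k) \<omega>) \<partial>M) \<le> \<delta>" for k
      using expectation_below_barrier[OF _ m, of "real k"] by (simp add: c_def)
    have iZc: "integrable M (\<lambda>\<omega>. max 0 (c - stopped_B (real k) \<omega>))" for k
      using iZ by (intro integrable_max) auto
    have "AE \<omega> in M. (\<lambda>k. max 0 (c - stopped_B (real k) \<omega>)) \<longlonglongrightarrow> max 0 (c - terminal_value \<omega>)"
      using lim_stopped_B by eventually_elim (intro tendsto_intros)
    note lowY = integral_le_of_tendsto[OF iZc _ low _ this, simplified]
    define W where "W \<omega> = \<bar>terminal_max \<omega>\<bar> + \<bar>c\<bar>" for \<omega>
    have iW: "integrable M W" unfolding W_def using integrable_terminal_max by auto
    have dom: "AE \<omega> in M. norm (max c (stopped_B (real k) \<omega>) * indicator A \<omega>) \<le> W \<omega>" for k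
      using AE_hits
    proof eventually_elim
      case (elim \<omega>)
      then show ?case
        using stopped_B_le_stopped_max[OF hits_space[OF elim], of "real k"] stopped_max_le_terminal_max[OF elim, of "real k"]
        by (auto simp: W_def indicator_def max_def)
    qed
    have iYc: "integrable M (\<lambda>\<omega>. max c (terminal_value \<omega>))"
    proof (rule Bochner_Integration.integrable_bound[OF iW])
      show "AE \<omega> in M. norm (max c (terminal_value \<omega>)) \<le> norm (W \<omega>)"
        using AE_hits
      proof eventually_elim
        case (elim \<omega>)
        then show ?case using terminal_value_le_terminal_max[OF elim] by (auto simp: W_def max_def)
      qed
    qed simp
    have "terminal_value = (\<lambda>\<omega>. max c (terminal_value \<omega>) - max 0 (c - terminal_value \<omega>))" by (auto simp: max_def)
    then have iY: "integrable M terminal_value"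
      using Bochner_Integration.integrable_diff[OF iYc lowY(1)] by simp
    have lim: "(\<lambda>k. \<integral>\<omega>. max c (stopped_B (real k) \<omega>) * indicator A \<omega> \<partial>M) \<longlonglongrightarrow> (\<integral>\<omega>. max c (terminal_value \<omega>) * indicator A \<omega> \<partial>M)"
    proof (rule integral_dominated_convergence[OF _ _ iW _ dom])
      show "AE \<omega> in M. (\<lambda>k. max c (stopped_B (real k) \<omega>) * indicator A \<omega>) \<longlonglongrightarrow> max c (terminal_value \<omega>) * indicator A \<omega>"
        using lim_stopped_B by eventually_elim (intro tendsto_intros)
    qed measurable
    have cut: "\<bar>(\<integral>\<omega>. max c (f \<omega>) * indicator A \<omega> \<partial>M) - (\<integral>\<omega>. f \<omega> * indicator A \<omega> \<partial>M)\<bar> \<le> \<delta>"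
      if f: "integrable M f" "(\<integral>\<omega>. max 0 (c - f \<omega>) \<partial>M) \<le> \<delta>" for f :: "'a \<Rightarrow> real"
    proof -
      have i: "integrable M (\<lambda>\<omega>. max 0 (c - f \<omega>))" "integrable M (\<lambda>\<omega>. max c (f \<omega>))"
        using f by (auto intro: integrable_max)
      have "(\<integral>\<omega>. max c (f \<omega>) * indicator A \<omega> \<partial>M) - (\<integral>\<omega>. f \<omega> * indicator A \<omega> \<partial>M)
          = (\<integral>\<omega>. max c (f \<omega>) * indicator A \<omega> - f \<omega> * indicator A \<omega> \<partial>M)"
        using i f by (intro Bochner_Integration.integral_diff[symmetric] iA)
      also have "\<dots> = (\<integral>\<omega>. max 0 (c - f \<omega>) * indicator A \<omega> \<partial>M)"
        by (intro Bochner_Integration.integral_cong) (auto simp: indicator_def max_def)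
      finally have eq: "(\<integral>\<omega>. max c (f \<omega>) * indicator A \<omega> \<partial>M) - (\<integral>\<omega>. f \<omega> * indicator A \<omega> \<partial>M)
          = (\<integral>\<omega>. max 0 (c - f \<omega>) * indicator A \<omega> \<partial>M)" .
      have "0 \<le> (\<integral>\<omega>. max 0 (c - f \<omega>) * indicator A \<omega> \<partial>M)"
        by (intro integral_nonneg_AE) auto
      moreover have "(\<integral>\<omega>. max 0 (c - f \<omega>) * indicator A \<omega> \<partial>M) \<le> (\<integral>\<omega>. max 0 (c - f \<omega>) \<partial>M)"
        by (intro integral_mono iA i) (auto simp: indicator_def)
      ultimately show ?thesis using eq f by linarith
    qed
    have near: "\<bar>(\<integral>\<omega>. max c (stopped_B (real k) \<omega>) * indicator A \<omega> \<partial>M) - (\<integral>\<omega>. stopped_B s \<omega> * indicator A \<omega> \<partial>M)\<bar> \<le> \<delta>"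
      if "s \<le> real k" for k
      using cut[OF iZ low, of k] stopped_B_martingale[OF s that A] by simp
    have "\<bar>(\<integral>\<omega>. max c (terminal_value \<omega>) * indicator A \<omega> \<partial>M) - (\<integral>\<omega>. stopped_B s \<omega> * indicator A \<omega> \<partial>M)\<bar> \<le> \<delta>"
    proof (rule LIMSEQ_le_const2)
      show "(\<lambda>k. \<bar>(\<integral>\<omega>. max c (stopped_B (real k) \<omega>) * indicator A \<omega> \<partial>M) - (\<integral>\<omega>. stopped_B s \<omega> * indicator A \<omega> \<partial>M)\<bar>)
          \<longlonglongrightarrow> \<bar>(\<integral>\<omega>. max c (terminal_value \<omega>) * indicator A \<omega> \<partial>M) - (\<integral>\<omega>. stopped_B s \<omega> * indicator A \<omega> \<partial>M)\<bar>"
        by (intro tendsto_intros lim)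
      obtain N :: nat where "s \<le> N" using real_arch_simple by blast
      then show "\<exists>N. \<forall>k\<ge>N. \<bar>(\<integral>\<omega>. max c (stopped_B (real k) \<omega>) * indicator A \<omega> \<partial>M) - (\<integral>\<omega>. stopped_B s \<omega> * indicator A \<omega> \<partial>M)\<bar> \<le> \<delta>"
        by (intro exI[of _ N] allI impI near) auto
    qed
    then show ?thesis using cut[OF iY lowY(2)] iY by linarith
  qed
  then show "integrable M terminal_value" using zero_less_one by blast
  have "\<bar>(\<integral>\<omega>. terminal_value \<omega> * indicator A \<omega> \<partial>M) - (\<integral>\<omega>. stopped_B s \<omega> * indicator A \<omega> \<partial>M)\<bar> \<le> 0"
  proof (rule field_le_epsilon)
    fix e :: real assume "0 < e"
    then show "\<bar>(\<integral>\<omega>. terminal_value \<omega> * indicator A \<omega> \<partial>M) - (\<integral>\<omega>. stopped_B s \<omega> * indicator A \<omega> \<partial>M)\<bar> \<le> 0 + e"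
      using *[of "e / 2"] by simp
  qed
  then show "(\<integral>\<omega>. terminal_value \<omega> * indicator A \<omega> \<partial>M) = (\<integral>\<omega>. stopped_B s \<omega> * indicator A \<omega> \<partial>M)" by simp
qed

lemma integrable_terminal_value: "integrable M terminal_value"
  using expectation_terminal_value_on_set(1)[of 0 "{}"] by simp

text \<open>The terminal value is above \<open>\<zeta> m\<close> exactly when the maximum exceeds \<open>m\<close>, up to equality, so the call
  payoff is a limit of non-negative variables with known mean, to which Fatou's lemma applies. The converse
  inequality is the upper bound that holds for all submartingales.\<close>

lemma expectation_call_terminal_value:
  assumes m: "x0 < m"
  shows "(\<integral>\<omega>. max 0 (terminal_value \<omega> - \<zeta> m) \<partial>M) \<le> (m - \<zeta> m) * prob {\<omega> \<in> space M. m < terminal_max \<omega>}"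
proof (rule integral_le_of_tendsto(2))
  let ?f = "\<lambda>k \<omega>. (stopped_B (real k) \<omega> - \<zeta> m) * indicator {\<omega> \<in> space M. m < stopped_max (real k) \<omega>} \<omega>"
  show "AE \<omega> in M. (\<lambda>k. ?f k \<omega>) \<longlonglongrightarrow> max 0 (terminal_value \<omega> - \<zeta> m)"
    using AE_hits
  proof eventually_elim
    case (elim \<omega>)
    have "max 0 (terminal_value \<omega> - \<zeta> m) = (terminal_value \<omega> - \<zeta> m) * indicator {\<omega> \<in> space M. m < terminal_max \<omega>} \<omega>"
      using barrier_le_terminal_value[OF elim m] terminal_value_le_barrier[OF elim m] hits_space[OF elim]
      by (cases "m < terminal_max \<omega>") (auto simp: max_def)
    then show ?case
      by (intro tendsto_eventually eventually_mono[OF eventually_stopped[OF elim]]) (auto simp: indicator_def)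
  qed
  show "0 \<le> ?f k \<omega>" if "\<omega> \<in> space M" for k \<omega>
    using barrier_le_stopped_B[OF that, of "real k" m] m by (auto simp: indicator_def)
  show "integrable M (?f k)" for k
    by (intro integrable_stopped_B_indicator sets_stopped_max_greater) auto
  have "prob {\<omega> \<in> space M. m < stopped_max (real k) \<omega>} \<le> prob {\<omega> \<in> space M. m < terminal_max \<omega>}" for k
  proof (rule finite_measure_mono_AE)
    show "AE \<omega> in M. \<omega> \<in> {\<omega> \<in> space M. m < stopped_max (real k) \<omega>} \<longrightarrow> \<omega> \<in> {\<omega> \<in> space M. m < terminal_max \<omega>}"
      using AE_hits by eventually_elim (auto dest: stopped_max_le_terminal_max[of _ "real k"])
  qed measurable
  then show "(\<integral>\<omega>. ?f k \<omega> \<partial>M) \<le> (m - \<zeta> m) * prob {\<omega> \<in> space M. m < terminal_max \<omega>}" for k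
    using less[OF m] by (subst expectation_above_level'[OF _ m]) (auto intro!: mult_left_mono)
qed measurable

end

section \<open>A continuous martingale that attains the bound\<close>

context barrier_brownian
begin

text \<open>The time change \<open>t / (T - t)\<close> of \<open>[0, T)\<close> onto \<open>[0, \<infinity>)\<close>, frozen at the hitting time. The inner
  maximum only acts after that time has been reached, and makes the formula evidently continuous
  across \<open>t = T\<close>.\<close>

definition clock :: "real \<Rightarrow> real \<Rightarrow> 'a \<Rightarrow> real" where
  "clock T t \<omega> = min (hit_time \<omega>) (t / max (T - t) (T / (1 + hit_time \<omega>)))"

text \<open>The Azema-Yor martingale on the time interval \<open>[0, T]\<close>, constant afterwards.\<close>

definition azema_yor :: "real \<Rightarrow> real \<Rightarrow> 'a \<Rightarrow> real" where
  "azema_yor T t \<omega> = (if \<omega> \<in> hits then B (clock T t \<omega>) \<omega> else x0)"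

lemma clock_before:
  assumes \<omega>: "\<omega> \<in> hits" and t: "0 \<le> t" "t < T"
  shows "clock T t \<omega> = min (hit_time \<omega>) (t / (T - t))"
proof (cases "T / (1 + hit_time \<omega>) \<le> T - t")
  case True
  then show ?thesis by (simp add: clock_def max_absorb1)
next
  case False
  define h where "h = hit_time \<omega>"
  have h: "0 \<le> h" using hit_time_nonneg[OF \<omega>] by (simp add: h_def)
  have "T - t < T / (1 + h)" using False by (simp add: h_def)
  then have lt: "(T - t) * (1 + h) < T" using h by (simp add: pos_less_divide_eq)
  have "h * (T - t) \<le> t" using lt by (simp add: algebra_simps)
  then have "h \<le> t / (T - t)" using t by (simp add: pos_le_divide_eq)
  moreover have "h * T \<le> t * (1 + h)" using lt by (simp add: algebra_simps)
  then have "h \<le> t / (T / (1 + h))" using t h by (simp add: field_simps)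
  ultimately show ?thesis using False by (simp add: clock_def max_absorb2 h_def)
qed

lemma clock_after:
  assumes \<omega>: "\<omega> \<in> hits" and t: "0 < T" "T \<le> t"
  shows "clock T t \<omega> = hit_time \<omega>"
proof -
  define h where "h = hit_time \<omega>"
  have h: "0 \<le> h" using hit_time_nonneg[OF \<omega>] by (simp add: h_def)
  have "T - t \<le> 0" "0 < T / (1 + h)" using t h by auto
  then have "max (T - t) (T / (1 + h)) = T / (1 + h)" by simp
  moreover have "h \<le> t / (T / (1 + h))"
  proof -
    have "h * T \<le> h * t" using t h by (intro mult_left_mono) auto
    then have "h * T \<le> t * (1 + h)" using t h by (simp add: algebra_simps)
    then show ?thesis using t h by (simp add: field_simps)
  qed
  ultimately show ?thesis by (simp add: clock_def h_def)
qed

lemma azema_yor_before: "\<omega> \<in> hits \<Longrightarrow> 0 \<le> t \<Longrightarrow> t < T \<Longrightarrow> azema_yor T t \<omega> = stopped_B (t / (T - t)) \<omega>"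
  by (simp add: azema_yor_def stopped_B_def clock_before stop_time_eq_min min.commute)

lemma azema_yor_after: "0 < T \<Longrightarrow> T \<le> t \<Longrightarrow> azema_yor T t \<omega> = terminal_value \<omega>"
  by (simp add: azema_yor_def terminal_value_def clock_after)

lemma azema_yor_0: "0 < T \<Longrightarrow> \<omega> \<in> space M \<Longrightarrow> azema_yor T 0 \<omega> = x0"
  using hit_time_nonneg[of \<omega>] by (auto simp: azema_yor_def clock_def B_0 min_def)

lemma continuous_azema_yor:
  assumes T: "0 < T" and \<omega>: "\<omega> \<in> space M"
  shows "continuous_on {0..} (\<lambda>t. azema_yor T t \<omega>)"
proof (cases "\<omega> \<in> hits")
  case True
  have pos: "0 < max (T - t) (T / (1 + hit_time \<omega>))" for t
    using T hit_time_nonneg[OF True] by (simp add: less_max_iff_disj)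
  then have "continuous_on {0..} (\<lambda>t. clock T t \<omega>)"
    unfolding clock_def by (intro continuous_intros) (auto simp: less_le)
  moreover have "0 \<le> clock T t \<omega>" if "0 \<le> t" for t
    using pos[of t] hit_time_nonneg[OF True] that by (simp add: clock_def less_imp_le)
  ultimately have "continuous_on {0..} (\<lambda>t. B (clock T t \<omega>) \<omega>)"
    by (intro continuous_on_compose2[OF continuous_B[OF \<omega>]]) auto
  then show ?thesis using True by (simp add: azema_yor_def)
qed (simp add: azema_yor_def)

lemma AE_azema_yor_before: "0 \<le> t \<Longrightarrow> t < T \<Longrightarrow> AE \<omega> in M. azema_yor T t \<omega> = stopped_B (t / (T - t)) \<omega>"
  using AE_hits by eventually_elim (rule azema_yor_before)

lemma measurable_azema_yor:
  assumes T: "0 < T" and t: "0 \<le> t"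
  shows "azema_yor T t \<in> borel_measurable M"
proof (cases "t < T")
  case True
  have [measurable]: "stopped_B (t / (T - t)) \<in> borel_measurable M" using t True by simp
  have "(\<lambda>\<omega>. if \<omega> \<in> hits then stopped_B (t / (T - t)) \<omega> else x0) \<in> borel_measurable M" by measurable
  moreover have "azema_yor T t \<omega> = (if \<omega> \<in> hits then stopped_B (t / (T - t)) \<omega> else x0)" for \<omega>
    using azema_yor_before[of \<omega> t T] t True by (auto simp: azema_yor_def)
  ultimately show ?thesis by (simp cong: measurable_cong)
next
  case False
  then have "azema_yor T t = terminal_value" using azema_yor_after[OF T] by (auto simp: fun_eq_iff)
  then show ?thesis by simp
qed

lemma integrable_azema_yor:
  assumes T: "0 < T" and t: "0 \<le> t"
  shows "integrable M (azema_yor T t)"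
proof (cases "t < T")
  case True
  have "integrable M (stopped_B (t / (T - t)))" using t True by (intro integrable_stopped_B) auto
  then show ?thesis
    by (rule integrable_cong_AE_imp[OF _ measurable_azema_yor[OF T t]])
       (use AE_azema_yor_before[OF t True] in \<open>auto elim: eventually_mono\<close>)
next
  case False
  then have "azema_yor T t = terminal_value" using azema_yor_after[OF T] by (auto simp: fun_eq_iff)
  then show ?thesis using integrable_terminal_value by simp
qed

text \<open>On the almost sure event \<open>hits\<close>, the process is observable from the Brownian filtration at the
  running clock; the event itself need not belong to that filtration.\<close>

lemma natural_filtration_trace:
  assumes s: "0 \<le> s" "s < T" and A: "A \<in> sets (natural_filtration M (azema_yor T) s)"
  shows "\<exists>A'\<in>sets (F (s / (T - s))). A \<inter> hits = A' \<inter> hits"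
proof -
  define g where "g r = r / (T - r)" for r
  have g: "0 \<le> g r" "g r \<le> g s" if "0 \<le> r" "r \<le> s" for r
    using that s by (auto simp: g_def intro!: frac_le)
  note gs = g(1)[OF s(1) order_refl]
  have "A \<in> sigma_sets (space M) (\<Union>r\<in>{0..s}. {azema_yor T r -` C \<inter> space M | C. C \<in> sets borel})"
    using A unfolding natural_filtration_def by (subst (asm) sets_measure_of) auto
  then have "\<exists>A'\<in>sets (F (g s)). A \<inter> hits = A' \<inter> hits"
  proof induction
    case (Basic a)
    then obtain r C where r: "0 \<le> r" "r \<le> s" and C: "C \<in> sets borel" and a: "a = azema_yor T r -` C \<inter> space M" by auto
    have "stopped_B (g r) \<in> borel_measurable (F (g s))"
      by (rule measurable_F_mono[OF g[OF r] measurable_stopped_B_F[OF g(1)[OF r]]])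
    then have "stopped_B (g r) -` C \<inter> space (F (g s)) \<in> sets (F (g s))" using C by (rule measurable_sets)
    moreover have "a \<inter> hits = (stopped_B (g r) -` C \<inter> space (F (g s))) \<inter> hits"
      using azema_yor_before[of _ r T] r s gs by (auto simp: a g_def)
    ultimately show ?case by blast
  next
    case Empty
    then show ?case by (intro bexI[of _ "{}"]) auto
  next
    case (Compl a)
    then obtain A' where "A' \<in> sets (F (g s))" "a \<inter> hits = A' \<inter> hits" by auto
    then show ?case
      using hits_space gs by (intro bexI[of _ "space (F (g s)) - A'"] sets.compl_sets) auto
  next
    case (Union a)
    then obtain A' where A': "\<And>i :: nat. A' i \<in> sets (F (g s))" "\<And>i. a i \<inter> hits = A' i \<inter> hits" by metis
    then have "(\<Union>i. a i) \<inter> hits = (\<Union>i. A' i) \<inter> hits" by blast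
    then show ?case using A'(1) by (intro bexI[of _ "\<Union>i. A' i"]) auto
  qed
  then show ?thesis by (simp add: g_def)
qed

text \<open>The process is closed by its terminal value: over an event of the past, both \<open>s\<close> and \<open>t\<close> yield
  the integral of the terminal value.\<close>

lemma martingale_azema_yor:
  assumes T: "0 < T"
  shows "martingale M x0 (azema_yor T)"
  unfolding martingale_def
proof (intro conjI ballI allI impI)
  fix s t :: real assume s: "0 \<le> s" and t: "s \<le> t"
  have sub: "subalgebra M (natural_filtration M (azema_yor T) s)"
    by (rule subalgebra_natural_filtration) (rule measurable_azema_yor[OF T])
  interpret sf: sigma_finite_subalgebra M "natural_filtration M (azema_yor T) s"
    by (intro finite_measure_subalgebra_is_sigma_finite finite_measure_subalgebra.intro
        finite_measure_axioms sub finite_measure_subalgebra_axioms.intro)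
  show "AE \<omega> in M. real_cond_exp M (natural_filtration M (azema_yor T) s) (azema_yor T t) \<omega> = azema_yor T s \<omega>"
  proof (rule sf.real_cond_exp_charact)
    fix A assume A: "A \<in> sets (natural_filtration M (azema_yor T) s)"
    then have [measurable]: "A \<in> sets M" using sub by (auto simp: subalgebra_def)
    show "(\<integral>\<omega>\<in>A. azema_yor T t \<omega> \<partial>M) = (\<integral>\<omega>\<in>A. azema_yor T s \<omega> \<partial>M)"
    proof (cases "s < T")
      case False
      then show ?thesis using azema_yor_after[OF T] t by simp
    next
      case True
      define g where "g r = r / (T - r)" for r
      have gs: "0 \<le> g s" using s True by (simp add: g_def)
      obtain A' where A': "A' \<in> sets (F (g s))" "A \<inter> hits = A' \<inter> hits"
        using natural_filtration_trace[OF s True A] by (auto simp: g_def)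
      have [measurable]: "A' \<in> sets M" using sets_F gs A' by auto
      have ind: "AE \<omega> in M. indicator A \<omega> = (indicator A' \<omega> :: real)"
        using AE_hits by eventually_elim (use A'(2) in \<open>auto simp: indicator_def\<close>)
      have to_terminal_value: "(\<integral>\<omega>\<in>A. azema_yor T r \<omega> \<partial>M) = (\<integral>\<omega>. terminal_value \<omega> * indicator A' \<omega> \<partial>M)" if r: "s \<le> r" for r
      proof (cases "r < T")
        case r': True
        have gr: "g s \<le> g r" "0 \<le> g r" using r r' s by (auto simp: g_def intro!: frac_le)
        note [measurable] = measurable_azema_yor[OF T order_trans[OF s r]] measurable_stopped_B[OF gr(2)]
        have "(\<integral>\<omega>\<in>A. azema_yor T r \<omega> \<partial>M) = (\<integral>\<omega>. stopped_B (g r) \<omega> * indicator A' \<omega> \<partial>M)"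
          unfolding set_lebesgue_integral_def
        proof (rule integral_cong_AE)
          show "AE \<omega> in M. indicator A \<omega> *\<^sub>R azema_yor T r \<omega> = stopped_B (g r) \<omega> * indicator A' \<omega>"
            using ind AE_azema_yor_before[OF order_trans[OF s r] r'] by eventually_elim (simp add: g_def)
        qed measurable
        also have "\<dots> = (\<integral>\<omega>. terminal_value \<omega> * indicator A' \<omega> \<partial>M)"
          using expectation_terminal_value_on_set(2)[OF gr(2) sets_F_mono[OF gs gr(1) A'(1)]] by simp
        finally show ?thesis .
      next
        case False
        show ?thesis
          unfolding set_lebesgue_integral_def
        proof (rule integral_cong_AE)
          show "AE \<omega> in M. indicator A \<omega> *\<^sub>R azema_yor T r \<omega> = terminal_value \<omega> * indicator A' \<omega>"
            using ind by eventually_elim (use azema_yor_after[OF T, of r] False in simp)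
          note [measurable] = measurable_azema_yor[OF T order_trans[OF s r]]
          show "(\<lambda>\<omega>. indicator A \<omega> *\<^sub>R azema_yor T r \<omega>) \<in> borel_measurable M" by measurable
        qed measurable
      qed
      show ?thesis using to_terminal_value[OF order_refl] to_terminal_value[OF t] by simp
    qed
  next
    show "azema_yor T s \<in> borel_measurable (natural_filtration M (azema_yor T) s)"
      by (rule measurable_natural_filtration[OF s order_refl])
  qed (use integrable_azema_yor[OF T] s t in auto)
qed (use azema_yor_0 integrable_azema_yor T in auto)

text \<open>The clock attains every time up to the hitting time, in particular the time of the maximum.\<close>

lemma terminal_max_le_running_max:
  assumes T: "0 < T" "T \<le> t" and \<omega>: "\<omega> \<in> hits"
  shows "terminal_max \<omega> \<le> running_max (azema_yor T) t \<omega>"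
proof -
  interpret continuous_path "\<lambda>t. azema_yor T t \<omega>"
    by unfold_locales (rule continuous_azema_yor[OF T(1) hits_space[OF \<omega>]])
  define h where "h = hit_time \<omega>"
  have h: "0 \<le> h" using hit_time_nonneg[OF \<omega>] by (simp add: h_def)
  obtain s where s: "0 \<le> s" "s \<le> h" "B s \<omega> = path_max (\<lambda>t. B t \<omega>) h"
    using continuous_path.path_max_attained[OF continuous_path_B[OF hits_space[OF \<omega>]] h] by auto
  \<comment> \<open>The time at which the clock \<open>r / (T - r)\<close> shows \<open>s\<close>.\<close>
  define r where "r = T * s / (1 + s)"
  have r: "0 \<le> r" "r < T" using s T by (auto simp: r_def field_simps)
  have "T - r = T / (1 + s)" using s by (simp add: r_def field_simps)
  then have "r / (T - r) = s" using T s by (simp add: r_def)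
  then have "azema_yor T r \<omega> = B s \<omega>"
    using clock_before[OF \<omega> r] s \<omega> by (simp add: azema_yor_def h_def min_absorb2)
  then have "terminal_max \<omega> = azema_yor T r \<omega>" using s \<omega> by (simp add: terminal_max_def running_max_eq_path_max h_def)
  also have "\<dots> \<le> path_max (\<lambda>t. azema_yor T t \<omega>) t" by (rule le_path_max) (use r T in auto)
  finally show ?thesis by (simp add: running_max_eq_path_max)
qed

lemma call_bound_attained:
  assumes T: "0 < T" "T \<le> t" and m: "x0 < m"
  shows "(\<integral>\<omega>. max 0 (terminal_value \<omega> - \<zeta> m) / (m - \<zeta> m) \<partial>M) \<le> prob {\<omega> \<in> space M. m \<le> running_max (azema_yor T) t \<omega>}"
proof -
  have t: "0 \<le> t" using T by simp
  have path: "continuous_path (\<lambda>r. azema_yor T r \<omega>)" if "\<omega> \<in> space M" for \<omega>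
    by unfold_locales (rule continuous_azema_yor[OF T(1) that])
  have [measurable]: "running_max (azema_yor T) t \<in> borel_measurable M"
    using continuous_path.bdd_above_path[OF path] continuous_path.right_tendsto[OF path]
    by (intro measurable_running_max[OF t] measurable_azema_yor[OF T(1)]) (auto simp: continuous_within)
  have "prob {\<omega> \<in> space M. m < terminal_max \<omega>} \<le> prob {\<omega> \<in> space M. m \<le> running_max (azema_yor T) t \<omega>}"
  proof (rule finite_measure_mono_AE)
    show "AE \<omega> in M. \<omega> \<in> {\<omega> \<in> space M. m < terminal_max \<omega>} \<longrightarrow> \<omega> \<in> {\<omega> \<in> space M. m \<le> running_max (azema_yor T) t \<omega>}"
      using AE_hits by eventually_elim (use terminal_max_le_running_max[OF T] in fastforce)
  qed measurable
  then have "(m - \<zeta> m) * prob {\<omega> \<in> space M. m < terminal_max \<omega>}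
      \<le> (m - \<zeta> m) * prob {\<omega> \<in> space M. m \<le> running_max (azema_yor T) t \<omega>}"
    using less[OF m] by (intro mult_left_mono) auto
  then show ?thesis
    using expectation_call_terminal_value[OF m] less[OF m] by (simp add: field_simps)
qed

end

lemma martingale_imp_submartingale:
  assumes "martingale M x0 X"
  shows "submartingale M x0 X"
  unfolding submartingale_def
proof (intro conjI allI impI)
  fix s t :: real assume "0 \<le> s" "s \<le> t"
  then have "AE \<omega> in M. real_cond_exp M (natural_filtration M X s) (X t) \<omega> = X s \<omega>"
    using assms by (simp add: martingale_def)
  then show "AE \<omega> in M. X s \<omega> \<le> real_cond_exp M (natural_filtration M X s) (X t) \<omega>"
    by eventually_elim simp
qed (use assms in \<open>auto simp: martingale_def\<close>)

lemma continuous_imp_cadlag: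
  assumes "continuous_paths M X"
  shows "cadlag_paths M X"
  unfolding cadlag_paths_def
proof (intro ballI conjI allI impI)
  fix \<omega> t assume "\<omega> \<in> space M"
  then interpret continuous_path "\<lambda>t. X t \<omega>"
    using assms by unfold_locales (auto simp: continuous_paths_def)
  show "continuous (at_right t) (\<lambda>s. X s \<omega>)" if "0 \<le> t"
    using right_tendsto[OF that] by (simp add: continuous_within)
  show "\<exists>l. ((\<lambda>s. X s \<omega>) \<longlongrightarrow> l) (at_left t)" if "0 < t"
    using left_tendsto[OF that] by blast
qed

text \<open>Halving \<open>\<alpha>\<close> turns the asymptotic lower bound for the barrier into one that holds from some point on.\<close>

lemma barrier_linear_growth:
  assumes "growth_condition \<zeta> \<phi>"
  obtains \<alpha> m0 where "0 < \<alpha>" "0 < m0" "x0 < m0" "\<And>m. m0 \<le> m \<Longrightarrow> \<alpha> * m \<le> \<zeta> m"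
proof -
  obtain \<alpha> where \<alpha>: "0 < \<alpha>" "1 \<le> Liminf at_top (\<lambda>m. ereal (\<zeta> m / (\<alpha> * m)))"
    using assms by (auto simp: growth_condition_def)
  have "ereal (1 / 2) < 1" by simp
  then have "\<forall>\<^sub>F m in at_top. ereal (1 / 2) < ereal (\<zeta> m / (\<alpha> * m))"
    using \<alpha>(2) unfolding le_Liminf_iff by blast
  then obtain N where N: "\<And>m. N \<le> m \<Longrightarrow> 1 / 2 < \<zeta> m / (\<alpha> * m)"
    unfolding eventually_at_top_linorder by auto
  show ?thesis
  proof (rule that[of "\<alpha> / 2" "max N (max 1 (x0 + 1))"])
    fix m assume m: "max N (max 1 (x0 + 1)) \<le> m"
    then have "0 < \<alpha> * m" using \<alpha> by auto
    then show "\<alpha> / 2 * m \<le> \<zeta> m" using N[of m] m by (simp add: pos_less_divide_eq)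
  qed (use \<alpha> in auto)
qed

lemma expectation_phi_running_max:
  assumes "prob_space M" "submartingale M x0 X" "cadlag_paths M X" "0 \<le> T"
    and "mono \<phi>" "\<forall>x. continuous (at_right x) \<phi>"
  shows "ereal_integral M (\<lambda>\<omega>. \<phi> (running_max X T \<omega>)) = ereal (\<phi> x0) +
    enn2ereal (\<integral>\<^sup>+m. ennreal (measure M {\<omega> \<in> space M. m \<le> running_max X T \<omega>})
      \<partial>restrict_space (interval_measure \<phi>) {x0<..})"
proof (rule layer_cake)
  interpret prob_space M by fact
  have bdd: "bdd_above ((\<lambda>s. X s \<omega>) ` {0..T})" if "\<omega> \<in> space M" for \<omega>
    by (rule cadlag_bdd_above) (use assms(3) that in \<open>auto simp: cadlag_paths_def\<close>)
  show "running_max X T \<in> borel_measurable M"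
    by (rule measurable_running_max)
       (use assms bdd in \<open>auto simp: cadlag_paths_def submartingale_def\<close>)
  fix \<omega> assume \<omega>: "\<omega> \<in> space M"
  have "X 0 \<omega> \<le> running_max X T \<omega>"
    unfolding running_max_def by (rule cSUP_upper[OF _ bdd[OF \<omega>]]) (use assms in auto)
  then show "x0 \<le> running_max X T \<omega>" using assms(2) \<omega> by (auto simp: submartingale_def)
qed (use assms in auto)

lemma UB_eq_nn_integral:
  assumes "\<And>m. x0 < m \<Longrightarrow> 0 \<le> (\<Sum>i=1..n. \<integral>\<omega>. lambda_zeta n \<zeta> i m (X (t i) \<omega>) \<partial>M)"
  shows "UB M x0 n t X \<phi> \<zeta> = ereal (\<phi> x0) +
    enn2ereal (\<integral>\<^sup>+m. ennreal (\<Sum>i=1..n. \<integral>\<omega>. lambda_zeta n \<zeta> i m (X (t i) \<omega>) \<partial>M)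
      \<partial>restrict_space (interval_measure \<phi>) {x0<..})"
  unfolding UB_def by (subst ereal_integral_nonneg) (use assms in \<open>auto simp: space_restrict_space\<close>)

theorem theorem2p1:
  fixes M :: "'a measure" and F :: "real \<Rightarrow> 'a measure" and B :: "real \<Rightarrow> 'a \<Rightarrow> real"
    and x0 :: real and n :: nat and t :: "nat \<Rightarrow> real"
    and \<phi> :: "real \<Rightarrow> real" and \<zeta> :: "nat \<Rightarrow> real \<Rightarrow> real"
  assumes "filtered_prob_space M F" and "brownian_motion M F x0 B"
    and "t 0 = 0" and "\<forall>i<n. t i \<le> t (i + 1)"
    and "mono \<phi>" and "\<forall>x. continuous (at_right x) \<phi>"
    and "\<zeta> \<in> zeta_class n x0"
  shows "(\<forall>X. submartingale M x0 X \<and> cadlag_paths M X \<longrightarrow>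
            ereal_integral M (\<lambda>\<omega>. \<phi> (running_max X (t n) \<omega>)) \<le> UB M x0 n t X \<phi> \<zeta>) \<and>
         (0 < t 1 \<and> mono_on {x0<..} (\<zeta> 1) \<and> growth_condition (\<zeta> 1) \<phi> \<longrightarrow>
            (\<exists>X. martingale M x0 X \<and> continuous_paths M X \<and>
               ereal_integral M (\<lambda>\<omega>. \<phi> (running_max X (t n) \<omega>)) = UB M x0 n t X \<phi> \<zeta>))"
proof -
  interpret filtered_brownian M F x0 B by unfold_locales fact+
  have n: "1 \<le> n" using assms(7) by (simp add: zeta_class_def)
  have t_mono: "\<And>i. i < n \<Longrightarrow> t i \<le> t (i + 1)" using assms(4) by auto
  have tn: "0 \<le> t n" by (rule grid_nonneg[OF assms(3) t_mono order_refl])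
  have tail_le: "prob {\<omega> \<in> space M. m \<le> running_max X (t n) \<omega>}
      \<le> (\<Sum>i=1..n. \<integral>\<omega>. lambda_zeta n \<zeta> i m (X (t i) \<omega>) \<partial>M)"
    if X: "submartingale M x0 X" "cadlag_paths M X" and m: "x0 < m" for X m
  proof -
    interpret X: right_continuous_submartingale M X x0
      by unfold_locales (use X in \<open>auto simp: cadlag_paths_def\<close>)
    show ?thesis
    proof (rule X.running_max_bound[OF _ assms(3) t_mono assms(7) m])
      show "bdd_above ((\<lambda>s. X s \<omega>) ` {0..t n})" if "\<omega> \<in> space M" for \<omega>
        by (rule cadlag_bdd_above) (use X(2) that in \<open>auto simp: cadlag_paths_def\<close>)
    qed
  qed
  have UB: "UB M x0 n t X \<phi> \<zeta> = ereal (\<phi> x0) +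
      enn2ereal (\<integral>\<^sup>+m. ennreal (\<Sum>i=1..n. \<integral>\<omega>. lambda_zeta n \<zeta> i m (X (t i) \<omega>) \<partial>M)
        \<partial>restrict_space (interval_measure \<phi>) {x0<..})"
    if X: "submartingale M x0 X" "cadlag_paths M X" for X
    by (rule UB_eq_nn_integral) (rule order_trans[OF measure_nonneg tail_le[OF X]])
  note lhs = expectation_phi_running_max[OF prob_space_axioms _ _ tn assms(5,6)]
  show ?thesis
  proof (intro conjI allI impI; (elim conjE)?)
    fix X assume X: "submartingale M x0 X" "cadlag_paths M X"
    show "ereal_integral M (\<lambda>\<omega>. \<phi> (running_max X (t n) \<omega>)) \<le> UB M x0 n t X \<phi> \<zeta>"
      unfolding lhs[OF X] UB[OF X]
      by (intro add_left_mono less_eq_ennreal.rep_eq[THEN iffD1] nn_integral_mono ennreal_leI tail_le[OF X])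
         (auto simp: space_restrict_space)
  next
    assume t1: "0 < t 1" and mono: "mono_on {x0<..} (\<zeta> 1)" and growth: "growth_condition (\<zeta> 1) \<phi>"
    obtain \<alpha> m0 where am: "0 < \<alpha>" "0 < m0" "x0 < m0" "\<And>m. m0 \<le> m \<Longrightarrow> \<alpha> * m \<le> \<zeta> 1 m"
      using barrier_linear_growth[OF growth, of x0] by metis
    have z1: "\<zeta> 1 m < m" if "x0 < m" for m
    proof -
      have "\<zeta> 1 m \<le> \<zeta> n m"
        using grid_mono[of "n - 1" "\<lambda>i. \<zeta> (i + 1) m" 0 "n - 1"] assms(7) n that
        by (auto simp: zeta_class_def)
      also have "\<zeta> n m < m" using assms(7) that by (auto simp: zeta_class_def)
      finally show ?thesis .
    qed
    interpret barrier_brownian M F x0 B "\<zeta> 1" \<alpha> m0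
      by unfold_locales (use mono z1 am assms(7) n in \<open>auto simp: zeta_class_def\<close>)
    \<comment> \<open>All dates from the first on see the terminal value of the embedding on \<open>[0, t 1]\<close>.\<close>
    define W where "W = azema_yor (t 1)"
    have t1_le: "t 1 \<le> t i" if "i \<in> {1..n}" for i
      by (rule grid_mono[of n]) (use t_mono that in auto)
    have W: "martingale M x0 W" "continuous_paths M W"
      using martingale_azema_yor[OF t1] continuous_azema_yor[OF t1] by (auto simp: W_def continuous_paths_def)
    have W_terminal: "W (t i) \<omega> = terminal_value \<omega>" if "i \<in> {1..n}" for i \<omega>
      unfolding W_def by (rule azema_yor_after[OF t1 t1_le[OF that]])
    note W' = martingale_imp_submartingale[OF W(1)] continuous_imp_cadlag[OF W(2)]
    have "prob {\<omega> \<in> space M. m \<le> running_max W (t n) \<omega>} =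
        (\<Sum>i=1..n. \<integral>\<omega>. lambda_zeta n \<zeta> i m (W (t i) \<omega>) \<partial>M)" if m: "x0 < m" for m
    proof (rule antisym[OF tail_le[OF W' m]])
      have "(\<Sum>i=1..n. \<integral>\<omega>. lambda_zeta n \<zeta> i m (W (t i) \<omega>) \<partial>M) = (\<Sum>i=1..n. \<integral>\<omega>. lambda_zeta n \<zeta> i m (terminal_value \<omega>) \<partial>M)"
        by (intro sum.cong refl) (simp only: W_terminal)
      also have "\<dots> = (\<integral>\<omega>. (\<Sum>i=1..n. lambda_zeta n \<zeta> i m (terminal_value \<omega>)) \<partial>M)"
        unfolding lambda_zeta_def
        by (intro Bochner_Integration.integral_sum[symmetric] Bochner_Integration.integrable_diff
            integrable_mult_left integrable_divide integrable_max) (use integrable_terminal_value in auto)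
      also have "\<dots> = (\<integral>\<omega>. max 0 (terminal_value \<omega> - \<zeta> 1 m) / (m - \<zeta> 1 m) \<partial>M)"
        using sum_lambda_zeta[OF n, of \<zeta> m "\<lambda>_. terminal_value _"] by (intro Bochner_Integration.integral_cong) auto
      also have "\<dots> \<le> prob {\<omega> \<in> space M. m \<le> running_max W (t n) \<omega>}"
        unfolding W_def by (rule call_bound_attained[OF t1 t1_le m]) (use n in auto)
      finally show "(\<Sum>i=1..n. \<integral>\<omega>. lambda_zeta n \<zeta> i m (W (t i) \<omega>) \<partial>M)
          \<le> prob {\<omega> \<in> space M. m \<le> running_max W (t n) \<omega>}" .
    qed
    then have "ereal_integral M (\<lambda>\<omega>. \<phi> (running_max W (t n) \<omega>)) = UB M x0 n t W \<phi> \<zeta>"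
      unfolding lhs[OF W'] UB[OF W']
      by (intro arg_cong2[where f = plus] arg_cong[where f = enn2ereal] nn_integral_cong refl)
         (auto simp: space_restrict_space)
    then show "\<exists>X. martingale M x0 X \<and> continuous_paths M X \<and>
        ereal_integral M (\<lambda>\<omega>. \<phi> (running_max X (t n) \<omega>)) = UB M x0 n t X \<phi> \<zeta>"
      using W by blast
  qed
qed

end
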